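(* Let $\mathbb{K}$ be a commutative ring with unit. The left $\Lambda^{-1}\mathrm{As}$-module $\check{h}^{\bullet}({}^{\mathrm{As}}\Pi)$ is isomorphic to the operadic quotient $\Lambda^{-1}\mathrm{Com}$ (viewed as a left $\Lambda^{-1}\mathrm{As}$-module via the desuspension of the canonical surjection of operads $\mathrm{As}\to\mathrm{Com}$).
   Context: All finite sets are non-empty. $\mathrm{As}$ and $\mathrm{Com}$ are the $\mathbb{K}$-linear operads encoding associative, resp. commutative (associative), algebras. The operadic desuspension is $(\Lambda^{-1}\mathcal{P})(n)=s^{n-1}\mathrm{sgn}_n\otimes\mathcal{P}(n)$ with $(sV)^\bullet=V^{\bullet-1}$, i.e. the arity-wise tensor product with the endomorphism operad of $\mathbb{K}$ placed in cohomological degree $-1$. Graded modules carry the Koszul sign symmetry. ${}^{\mathrm{As}}\Pi(S)$ is the poset of partitions of $S$ equipped with a linear order on the set of blocks, where $x\le y$ iff $x$ is obtained from $y$ by merging blocks that are consecutive in the linear order. For a finite poset $P$, $\check{c}^n(P)$ is the free $\mathbb{K}$-module on symbols $[x_0<\cdots<x_n]$ for chains with $x_0$ minimal in $P$, with differential $d[x_0<\cdots<x_n]=\sum_{i=1}^n(-1)^i\sum_{x_{i-1}<y<x_i}[\cdots<x_{i-1}<y<x_i<\cdots]+(-1)^{n+1}\sum_{y>x_n}[x_0<\cdots<x_n<y]$; $c^\bullet(P)$ is the subcomplex of chains with moreover $x_n$ maximal. Their cohomologies are $\check{h}^\bullet(P)$ and $h^\bullet(P)$. Write $h^\bullet({}^{\mathrm{As}}\Pi):S\mapsto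 h^\bullet({}^{\mathrm{As}}\Pi(S))$, and similarly for $\check{h}^\bullet$. Structures. Let $\pi$ be a partition of $S$ (identified with its set of blocks). For each linear order $\xi$ on $\pi$, viewed as $x=(\pi,\xi)\in{}^{\mathrm{As}}\Pi(S)$, let $\varphi_x:{}^{\mathrm{As}}\Pi_{\le x}(S)\to{}^{\mathrm{As}}\Pi(\pi)$ be the map viewing a coarsening of $x$ as a set composition of the set of blocks $\pi$, and let $\psi_x:{}^{\mathrm{As}}\Pi_{\ge x}(S)\to\prod_{T\in\pi}{}^{\mathrm{As}}\Pi(T)$ be the map sending $y$ to the family of set compositions that it induces on the blocks $T$ of $\pi$. The operad structure on $h^\bullet({}^{\mathrm{As}}\Pi)$ and the left module structure on $\check{h}^\bullet({}^{\mathrm{As}}\Pi)$ are given by $\rho_\pi=\sum_{x}\mu_x\circ(\varphi_x^*\otimes\psi_x^* )\circ(\mathrm{id}\otimes\kappa)$ from $h^\bullet({}^{\mathrm{As}}\Pi(\pi))\otimes\bigotimes_{T\in\pi}h^\bullet({}^{\mathrm{As}}\Pi(T))$ to $h^\bullet({}^{\mathrm{As}}\Pi(S))$, resp. from $h^\bullet({}^{\mathrm{As}}\Pi(\pi))\otimes\bigotimes_{T\in\pi}\check{h}^\bullet({}^{\mathrm{As}}\Pi(T))$ to $\check{h}^\bullet({}^{\mathrm{As}}\Pi(S))$. Here $f^*[y_0<\cdots<y_n]=\sum_{f(x_i)=y_i}[x_0<\cdots<x_n]$; $\kappa$ is the Künneth morphism induced by $[x_0<\cdots<x_m]\otimes[y_0<\cdots<y_n]\mapsto[(x_0,y_0)<\cdots<(x_m,y_0)<(x_m,y_1)<\cdots<(x_m,y_n)]$;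 and $\mu_x$ is concatenation $[x_0<\cdots<x_m=x]\otimes[x=x_m<\cdots<x_{m+n}]\mapsto[x_0<\cdots<x_{m+n}]$. The graded operad $h^\bullet({}^{\mathrm{As}}\Pi)$ is isomorphic to $\Lambda^{-1}\mathrm{As}$ (the product $x_1x_2$ corresponding to the class of $[\{1,2\}<\{1\}\{2\}]$), and $\check{h}^\bullet({}^{\mathrm{As}}\Pi)$ is viewed as a left $\Lambda^{-1}\mathrm{As}$-module through this isomorphism. *)

theory Defs
  imports Main "HOL-Library.Disjoint_Sets" "HOL-Library.Nat_Bijection"
begin

section \<open>Cochain complexes of a finite poset\<close>

text \<open>
  A poset is a carrier \<open>P\<close> with an order \<open>le\<close>.  The free module on a finite set \<open>X\<close> is the set
  of coefficient functions supported on \<open>X\<close>; \<open>symb x\<close> is the basis symbol of \<open>x\<close>, and a linear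
  map is given by its values on symbols.
\<close>

definition symb :: "'b \<Rightarrow> 'b \<Rightarrow> 'k::comm_ring_1" where
  "symb x = (\<lambda>z. if z = x then 1 else 0)"

definition free_mod :: "'b set \<Rightarrow> ('b \<Rightarrow> 'k::comm_ring_1) set" where
  "free_mod X = {c. \<forall>z. z \<notin> X \<longrightarrow> c z = 0}"

definition lin_ext :: "'a set \<Rightarrow> ('a \<Rightarrow> 'b \<Rightarrow> 'k::comm_ring_1) \<Rightarrow> ('a \<Rightarrow> 'k) \<Rightarrow> 'b \<Rightarrow> 'k" where
  "lin_ext X f c = (\<lambda>z. \<Sum>x\<in>X. c x * f x z)"

definition lt_of :: "('p \<Rightarrow> 'p \<Rightarrow> bool) \<Rightarrow> 'p \<Rightarrow> 'p \<Rightarrow> bool" where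
  "lt_of le x y \<longleftrightarrow> le x y \<and> x \<noteq> y"

definition minimal_in :: "'p set \<Rightarrow> ('p \<Rightarrow> 'p \<Rightarrow> bool) \<Rightarrow> 'p \<Rightarrow> bool" where
  "minimal_in P le x \<longleftrightarrow> x \<in> P \<and> (\<forall>y\<in>P. le y x \<longrightarrow> y = x)"

definition maximal_in :: "'p set \<Rightarrow> ('p \<Rightarrow> 'p \<Rightarrow> bool) \<Rightarrow> 'p \<Rightarrow> bool" where
  "maximal_in P le x \<longleftrightarrow> x \<in> P \<and> (\<forall>y\<in>P. le x y \<longrightarrow> y = x)"

definition chains :: "'p set \<Rightarrow> ('p \<Rightarrow> 'p \<Rightarrow> bool) \<Rightarrow> nat \<Rightarrow> 'p list set" where
  "chains P le n = {xs. length xs = Suc n \<and> set xs \<subseteq> P \<and> sorted_wrt (lt_of le) xs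
                        \<and> minimal_in P le (hd xs)}"

definition max_chains :: "'p set \<Rightarrow> ('p \<Rightarrow> 'p \<Rightarrow> bool) \<Rightarrow> nat \<Rightarrow> 'p list set" where
  "max_chains P le n = {xs \<in> chains P le n. maximal_in P le (last xs)}"

definition diff_sym :: "'p set \<Rightarrow> ('p \<Rightarrow> 'p \<Rightarrow> bool) \<Rightarrow> 'p list \<Rightarrow> 'p list \<Rightarrow> 'k::comm_ring_1" where
  "diff_sym P le xs = (\<lambda>z.
     (\<Sum>i = 1..length xs - 1. (- 1) ^ i *
        (\<Sum>y\<in>{y \<in> P. lt_of le (xs ! (i - 1)) y \<and> lt_of le y (xs ! i)}.
           symb (take i xs @ y # drop i xs) z))
     + (- 1) ^ length xs * (\<Sum>y\<in>{y \<in> P. lt_of le (last xs) y}. symb (xs @ [y]) z))"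

definition diff :: "'p set \<Rightarrow> ('p \<Rightarrow> 'p \<Rightarrow> bool) \<Rightarrow> nat \<Rightarrow> ('p list \<Rightarrow> 'k::comm_ring_1) \<Rightarrow> 'p list \<Rightarrow> 'k" where
  "diff P le n = lin_ext (chains P le n) (diff_sym P le)"

definition c_check :: "'p set \<Rightarrow> ('p \<Rightarrow> 'p \<Rightarrow> bool) \<Rightarrow> nat \<Rightarrow> ('p list \<Rightarrow> 'k::comm_ring_1) set" where
  "c_check P le n = free_mod (chains P le n)"

definition c_max :: "'p set \<Rightarrow> ('p \<Rightarrow> 'p \<Rightarrow> bool) \<Rightarrow> nat \<Rightarrow> ('p list \<Rightarrow> 'k::comm_ring_1) set" where
  "c_max P le n = free_mod (max_chains P le n)"

text \<open>
  Cohomology of a nonnegatively graded complex \<open>(C, d)\<close> of functions: a class is the coset of a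
  cocycle modulo coboundaries.
\<close>

type_synonym ('b, 'k) cochain_complex = "nat \<Rightarrow> ('b \<Rightarrow> 'k) set"
type_synonym ('b, 'k) differential = "nat \<Rightarrow> ('b \<Rightarrow> 'k) \<Rightarrow> 'b \<Rightarrow> 'k"

definition cocycles :: "('b, 'k::comm_ring_1) cochain_complex \<Rightarrow> ('b, 'k) differential \<Rightarrow> nat \<Rightarrow> ('b \<Rightarrow> 'k) set" where
  "cocycles C d n = {c \<in> C n. d n c = (\<lambda>_. 0)}"

definition coboundaries :: "('b, 'k::comm_ring_1) cochain_complex \<Rightarrow> ('b, 'k) differential \<Rightarrow> nat \<Rightarrow> ('b \<Rightarrow> 'k) set" where
  "coboundaries C d n = (case n of 0 \<Rightarrow> {\<lambda>_. 0} | Suc m \<Rightarrow> d m ` C m)"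

definition coh_class :: "('b, 'k::comm_ring_1) cochain_complex \<Rightarrow> ('b, 'k) differential \<Rightarrow> nat \<Rightarrow> ('b \<Rightarrow> 'k) \<Rightarrow> ('b \<Rightarrow> 'k) set" where
  "coh_class C d n c = {\<lambda>z. c z + b z | b. b \<in> coboundaries C d n}"

definition cohomology :: "('b, 'k::comm_ring_1) cochain_complex \<Rightarrow> ('b, 'k) differential \<Rightarrow> nat \<Rightarrow> ('b \<Rightarrow> 'k) set set" where
  "cohomology C d n = coh_class C d n ` cocycles C d n"

definition pullback :: "'p list set \<Rightarrow> 'q list set \<Rightarrow> ('p \<Rightarrow> 'q) \<Rightarrow> ('q list \<Rightarrow> 'k::comm_ring_1) \<Rightarrow> 'p list \<Rightarrow> 'k" where
  "pullback X Y f = lin_ext Y (\<lambda>ys z. \<Sum>xs\<in>{xs \<in> X. map f xs = ys}. symb xs z)"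

text \<open>
  Kuenneth morphism for the product of the posets in the list \<open>Ps\<close>, whose elements are the lists
  in \<open>listset Ps\<close> ordered componentwise.  On a tensor of symbols it is the cross product (front
  face in the first factor, back face in the last one): the sum of all chains of the product whose
  consecutive segments, of the lengths of the given chains and overlapping in one element, project
  onto these chains.

  For two chains \<open>[x\<^sub>0 < \<dots> < x\<^sub>m]\<close> and \<open>[y\<^sub>0 < \<dots> < y\<^sub>n]\<close> with \<open>x\<^sub>m\<close> maximal, the only such chain is
  the staircase \<open>[(x\<^sub>0,y\<^sub>0) < \<dots> < (x\<^sub>m,y\<^sub>0) < (x\<^sub>m,y\<^sub>1) < \<dots> < (x\<^sub>m,y\<^sub>n)]\<close>; see
  \<open>kuenneth_sym_staircase\<close> below.  If \<open>x\<^sub>m\<close> is not maximal then keeping only the staircase does not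
  commute with the differentials: for \<open>P = {x < x'}\<close> and \<open>Q = {y < y'}\<close> the differential of
  \<open>[(x,y)]\<close> contains \<open>[(x,y) < (x',y')]\<close>.
\<close>

definition seg_start :: "'b list list \<Rightarrow> nat \<Rightarrow> nat" where
  "seg_start xss i = (\<Sum>j<i. length (xss ! j) - 1)"

definition kuenneth_sym :: "'p set list \<Rightarrow> ('p \<Rightarrow> 'p \<Rightarrow> bool) \<Rightarrow> 'p list list \<Rightarrow> 'p list list \<Rightarrow> 'k::comm_ring_1" where
  "kuenneth_sym Ps le xss = (\<lambda>z.
     \<Sum>w\<in>{w \<in> chains (listset Ps) (list_all2 le) (seg_start xss (length xss)).
           \<forall>i<length xss. map (\<lambda>v. v ! i) (take (length (xss ! i)) (drop (seg_start xss i) w)) = xss ! i}.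
       symb w z)"

lemma kuenneth_sym_staircase:
  assumes xs: "xs \<in> chains P le m" and ys: "ys \<in> chains Q le n"
    and mx: "maximal_in P le (last xs)" and refl: "\<And>x. x \<in> P \<union> Q \<Longrightarrow> le x x"
  shows "kuenneth_sym [P, Q] le [xs, ys]
           = symb (map (\<lambda>x. [x, hd ys]) xs @ map (\<lambda>y. [last xs, y]) (tl ys))"
    (is "_ = symb ?st")
proof -
  have lx: "length xs = Suc m" and Px: "set xs \<subseteq> P" and sx: "sorted_wrt (lt_of le) xs"
    and mnx: "minimal_in P le (hd xs)" using xs by (auto simp: chains_def)
  have ly: "length ys = Suc n" and Qy: "set ys \<subseteq> Q" and sy: "sorted_wrt (lt_of le) ys"
    and mny: "minimal_in Q le (hd ys)" using ys by (auto simp: chains_def)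
  have lastx: "last xs = xs ! m" using lx by (cases xs rule: rev_cases) auto
  have hdx: "hd xs = xs ! 0" using lx by (cases xs) auto
  have hdy: "hd ys = ys ! 0" using ly by (cases ys) auto
  have Pn: "xs ! i \<in> P" if "i \<le> m" for i using Px lx that by (auto simp: subset_iff)
  have Qn: "ys ! i \<in> Q" if "i \<le> n" for i using Qy ly that by (auto simp: subset_iff)
  have lex: "lt_of le (xs ! i) (xs ! j)" if "i < j" "j \<le> m" for i j
    using sx lx that by (auto simp: sorted_wrt_iff_nth_less)
  have ley: "lt_of le (ys ! i) (ys ! j)" if "i < j" "j \<le> n" for i j
    using sy ly that by (auto simp: sorted_wrt_iff_nth_less)
  have lst: "length ?st = Suc (m + n)" using lx ly by simp
  have nst: "?st ! i = [xs ! min i m, ys ! (i - m)]" if "i \<le> m + n" for i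
  proof (cases "i \<le> m")
    case True
    then show ?thesis using lx hdy by (simp add: nth_append)
  next
    case False
    then have "tl ys ! (i - Suc m) = ys ! (i - m)"
      using that ly by (subst nth_tl) (auto simp: Suc_diff_Suc)
    then show ?thesis using False that lx ly lastx by (simp add: nth_append)
  qed
  have seg: "seg_start [xs, ys] (length [xs, ys]) = m + n" "seg_start [xs, ys] 0 = 0" "seg_start [xs, ys] 1 = m"
    using lx ly by (simp_all add: seg_start_def numeral_2_eq_2)
  have mem: "v \<in> listset [P, Q] \<longleftrightarrow> (\<exists>a b. a \<in> P \<and> b \<in> Q \<and> v = [a, b])" for v
    by (auto simp: set_Cons_def)
  let ?W = "{w \<in> chains (listset [P, Q]) (list_all2 le) (seg_start [xs, ys] (length [xs, ys])).
           \<forall>i<length [xs, ys]. map (\<lambda>v. v ! i) (take (length ([xs, ys] ! i)) (drop (seg_start [xs, ys] i) w)) = [xs, ys] ! i}"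
  have inW: "w \<in> ?W \<longleftrightarrow> w \<in> chains (listset [P, Q]) (list_all2 le) (m + n)
      \<and> (\<forall>i\<le>m. w ! i ! 0 = xs ! i) \<and> (\<forall>i\<le>n. w ! (m + i) ! 1 = ys ! i)" for w
  proof -
    have "(\<forall>i<length [xs, ys]. map (\<lambda>v. v ! i) (take (length ([xs, ys] ! i)) (drop (seg_start [xs, ys] i) w)) = [xs, ys] ! i)
      \<longleftrightarrow> (\<forall>i\<le>m. w ! i ! 0 = xs ! i) \<and> (\<forall>i\<le>n. w ! (m + i) ! 1 = ys ! i)"
      if lw: "length w = Suc (m + n)"
    proof -
      have all2: "(\<forall>i<length [xs, ys]. R i) \<longleftrightarrow> R 0 \<and> R 1" for R
        by (auto simp: less_Suc_eq)
      have "map (\<lambda>v. v ! 0) (take (length xs) w) = xs \<longleftrightarrow> (\<forall>i\<le>m. w ! i ! 0 = xs ! i)"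
        using lx lw by (auto simp: list_eq_iff_nth_eq less_Suc_eq_le min_def)
      moreover have "map (\<lambda>v. v ! 1) (take (length ys) (drop m w)) = ys \<longleftrightarrow> (\<forall>i\<le>n. w ! (m + i) ! 1 = ys ! i)"
        using ly lw by (auto simp: list_eq_iff_nth_eq less_Suc_eq_le min_def)
      ultimately show ?thesis unfolding all2 seg by simp
    qed
    then show ?thesis unfolding mem_Collect_eq seg by (auto simp: chains_def)
  qed
  have st: "?st \<in> ?W"
  proof -
    have "sorted_wrt (lt_of (list_all2 le)) ?st"
    proof (unfold sorted_wrt_iff_nth_less, intro allI impI)
      fix i j assume ij: "i < j" "j < length ?st"
      then have b: "i \<le> m + n" "j \<le> m + n" using lst by auto
      have "le (xs ! min i m) (xs ! min j m)"
        using lex[of "min i m" "min j m"] refl[of "xs ! min i m"] Pn[of "min i m"] ij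
        by (cases "min i m = min j m") (auto simp: lt_of_def)
      moreover have "le (ys ! (i - m)) (ys ! (j - m))"
        using ley[of "i - m" "j - m"] refl[of "ys ! (i - m)"] Qn[of "i - m"] ij b
        by (cases "i - m = j - m") (auto simp: lt_of_def)
      moreover have "xs ! min i m \<noteq> xs ! min j m \<or> ys ! (i - m) \<noteq> ys ! (j - m)"
        using lex[of "min i m" "min j m"] ley[of "i - m" "j - m"] ij b
        by (cases "i < m") (auto simp: lt_of_def min_def)
      ultimately show "lt_of (list_all2 le) (?st ! i) (?st ! j)"
        unfolding nst[OF b(1)] nst[OF b(2)] by (simp add: lt_of_def)
    qed
    moreover have "set ?st \<subseteq> listset [P, Q]"
    proof
      fix v assume "v \<in> set ?st"
      then obtain i where "i \<le> m + n" "v = ?st ! i" using lst by (metis in_set_conv_nth less_Suc_eq_le)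
      then show "v \<in> listset [P, Q]" unfolding mem using nst[of i] Pn[of "min i m"] Qn[of "i - m"] by auto
    qed
    moreover have "minimal_in (listset [P, Q]) (list_all2 le) (hd ?st)"
    proof -
      have "hd ?st = [hd xs, hd ys]" using lx by (cases xs) auto
      moreover have "v = [hd xs, hd ys]" if "v \<in> listset [P, Q]" "list_all2 le v [hd xs, hd ys]" for v
        using that mnx mny unfolding minimal_in_def mem by auto
      ultimately show ?thesis using mnx mny by (auto simp: minimal_in_def mem simp del: listset.simps)
    qed
    ultimately have "?st \<in> chains (listset [P, Q]) (list_all2 le) (m + n)"
      unfolding chains_def using lst by blast
    then show ?thesis unfolding inW using nst by simp
  qed
  have uniq: "w = ?st" if "w \<in> ?W" for w
  proof (rule nth_equalityI)
    have w: "w \<in> chains (listset [P, Q]) (list_all2 le) (m + n)"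
      and a: "\<And>i. i \<le> m \<Longrightarrow> w ! i ! 0 = xs ! i" and b: "\<And>i. i \<le> n \<Longrightarrow> w ! (m + i) ! 1 = ys ! i"
      using that unfolding inW by auto
    have lw: "length w = Suc (m + n)" and sw: "sorted_wrt (lt_of (list_all2 le)) w"
      and Pw: "set w \<subseteq> listset [P, Q]" using w unfolding chains_def by auto
    show "length w = length ?st" using lw lst by simp
    fix i assume "i < length w"
    then have i: "i \<le> m + n" using lw by simp
    have "w ! i \<in> listset [P, Q]" "w ! m \<in> listset [P, Q]" using Pw lw i by (auto simp: subset_iff)
    then obtain c d c' d' where cd: "w ! i = [c, d]" "c \<in> P" "d \<in> Q" and cd': "w ! m = [c', d']"
      unfolding mem by blast
    have m0: "c' = xs ! m" "d' = ys ! 0" using a[of m] b[of 0] cd' by auto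
    show "w ! i = ?st ! i"
    proof (cases "i = m")
      case True
      then show ?thesis using nst[OF i] m0 cd' by simp
    next
      case False
      show ?thesis
      proof (cases "i < m")
        case True
        then have "le d d'" using sorted_wrt_nth_less[OF sw, of i m] lw cd cd' by (simp add: lt_of_def)
        then have "d = ys ! 0" using mny cd m0 hdy unfolding minimal_in_def by auto
        then show ?thesis using nst[OF i] True a[of i] cd by simp
      next
        case F: False
        then have "le c' c" using sorted_wrt_nth_less[OF sw, of m i] lw cd cd' False i by (simp add: lt_of_def)
        then have "c = xs ! m" using mx cd m0 lastx unfolding maximal_in_def by auto
        then show ?thesis using nst[OF i] F b[of "i - m"] cd i by simp
      qed
    qed
  qed
  have "?W = {?st}" using st uniq by blast
  then show ?thesis unfolding kuenneth_sym_def by (auto simp: fun_eq_iff)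
qed

definition kuenneth :: "'p set list \<Rightarrow> ('p \<Rightarrow> 'p \<Rightarrow> bool) \<Rightarrow> nat list \<Rightarrow> ('p list \<Rightarrow> 'k::comm_ring_1) list \<Rightarrow> 'p list list \<Rightarrow> 'k" where
  "kuenneth Ps le qs cs = (\<lambda>z.
     \<Sum>xss\<in>listset (map2 (\<lambda>P q. chains P le q) Ps qs).
       (\<Prod>i<length Ps. (cs ! i) (xss ! i)) * kuenneth_sym Ps le xss z)"

definition concat_chains :: "'p list set \<Rightarrow> 'p list set \<Rightarrow> ('p list \<Rightarrow> 'k::comm_ring_1) \<Rightarrow> ('p list \<Rightarrow> 'k) \<Rightarrow> 'p list \<Rightarrow> 'k" where
  "concat_chains X Y a b = (\<lambda>z. \<Sum>xs\<in>X. \<Sum>ys\<in>Y. a xs * b ys * symb (xs @ tl ys) z)"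


section \<open>Partitions with a linear order on the blocks\<close>

definition as_part :: "'a set \<Rightarrow> 'a set list set" where
  "as_part S = {x. distinct x \<and> partition_on S (set x)}"

definition as_le :: "'a set list \<Rightarrow> 'a set list \<Rightarrow> bool" where
  "as_le x y \<longleftrightarrow> (\<exists>yss. [] \<notin> set yss \<and> y = concat yss \<and> x = map (\<lambda>ys. \<Union>(set ys)) yss)"

text \<open>
  Finite sets are finite sets of natural numbers.  To stay inside one type of finite sets, a block
  \<open>T\<close> of a partition \<open>\<pi>\<close>, regarded as an element of the finite set \<open>\<pi>\<close>, is named by the number
  \<open>set_encode T\<close>; \<open>set_encode\<close> is injective on finite sets.  A family indexed by the blocks, as
  well as a tensor product over the blocks, is written with respect to a list \<open>Ts\<close> of the blocks
  in an arbitrary order, i.e. \<open>Ts \<in> as_part S\<close>.  All statements below quantify over all such \<open>Ts\<close>.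
\<close>

definition blocks :: "nat set list \<Rightarrow> nat set" where
  "blocks Ts = set_encode ` set Ts"

definition phi :: "nat set list \<Rightarrow> nat set list \<Rightarrow> nat set list" where
  "phi x = map (\<lambda>B. set_encode ` {T \<in> set x. T \<subseteq> B})"

definition psi :: "nat set list \<Rightarrow> nat set list \<Rightarrow> nat set list list" where
  "psi Ts y = map (\<lambda>T. filter (\<lambda>B. B \<subseteq> T) y) Ts"

definition below :: "'a set \<Rightarrow> 'a set list \<Rightarrow> 'a set list set" where
  "below S x = {y \<in> as_part S. as_le y x}"

definition above :: "'a set \<Rightarrow> 'a set list \<Rightarrow> 'a set list set" where
  "above S x = {y \<in> as_part S. as_le x y}"

text \<open>
  The structure map at the partition \<open>set Ts\<close>, on a cochain \<open>a\<close> of degree \<open>p\<close> on the set of blocks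
  (supported on chains ending at a maximal element) and cochains \<open>cs\<close> of degrees \<open>qs\<close> on the
  blocks.  The same formula serves for the operad and for the left module: it preserves the
  subcomplexes \<open>c_max\<close>.
\<close>

definition rho :: "nat set list \<Rightarrow> nat \<Rightarrow> nat list \<Rightarrow> (nat set list list \<Rightarrow> 'k::comm_ring_1)
    \<Rightarrow> (nat set list list \<Rightarrow> 'k) list \<Rightarrow> nat set list list \<Rightarrow> 'k" where
  "rho Ts p qs a cs = (let S = \<Union>(set Ts) in (\<lambda>z.
     \<Sum>x\<in>{x \<in> as_part S. set x = set Ts}.
       concat_chains (max_chains (below S x) as_le p) (chains (above S x) as_le (sum_list qs))
         (pullback (max_chains (below S x) as_le p) (max_chains (as_part (blocks Ts)) as_le p)
            (phi x) a)
         (pullback (chains (above S x) as_le (sum_list qs))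
            (chains (listset (map as_part Ts)) (list_all2 as_le) (sum_list qs))
            (psi Ts) (kuenneth (map as_part Ts) as_le qs cs)) z))"


section \<open>Graded species, operads and left modules\<close>

text \<open>
  A graded species \<open>M\<close> assigns to every nonempty finite set \<open>S\<close> and degree \<open>n\<close> a module with
  underlying set \<open>piece M S n\<close>; \<open>relabel M S n \<sigma>\<close> is the action of an injection \<open>\<sigma>\<close> on \<open>S\<close>, regarded as
  a bijection from \<open>S\<close> to \<open>\<sigma> ` S\<close>.  Only nonnegative degrees occur.
\<close>

record ('k, 'e) species =
  piece :: "nat set \<Rightarrow> nat \<Rightarrow> 'e set"
  zero_elt :: "nat set \<Rightarrow> nat \<Rightarrow> 'e"
  add :: "nat set \<Rightarrow> nat \<Rightarrow> 'e \<Rightarrow> 'e \<Rightarrow> 'e"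
  scale :: "nat set \<Rightarrow> nat \<Rightarrow> 'k \<Rightarrow> 'e \<Rightarrow> 'e"
  relabel :: "nat set \<Rightarrow> nat \<Rightarrow> (nat \<Rightarrow> nat) \<Rightarrow> 'e \<Rightarrow> 'e"

text \<open>
  \<open>compose P Ts p qs a bs\<close> is the composite of \<open>a\<close>, of arity \<open>blocks Ts\<close> and degree \<open>p\<close>, with the
  list \<open>bs\<close>, where \<open>bs ! i\<close> has arity \<open>Ts ! i\<close> and degree \<open>qs ! i\<close>, applied to the tensor
  \<open>a \<otimes> bs ! 0 \<otimes> bs ! 1 \<otimes> \<dots>\<close> in this order.  Similarly for \<open>act\<close>.
\<close>

record ('k, 'e) operad = "('k, 'e) species" +
  unit_op :: "nat \<Rightarrow> 'e"
  compose :: "nat set list \<Rightarrow> nat \<Rightarrow> nat list \<Rightarrow> 'e \<Rightarrow> 'e list \<Rightarrow> 'e"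

record ('k, 'o, 'e) left_module = "('k, 'e) species" +
  act :: "nat set list \<Rightarrow> nat \<Rightarrow> nat list \<Rightarrow> 'o \<Rightarrow> 'e list \<Rightarrow> 'e"

definition species_iso :: "('k, 'e, 'x) species_scheme \<Rightarrow> ('k, 'f, 'y) species_scheme
    \<Rightarrow> (nat set \<Rightarrow> nat \<Rightarrow> 'e \<Rightarrow> 'f) \<Rightarrow> bool" where
  "species_iso M N \<theta> \<longleftrightarrow> (\<forall>S n. finite S \<and> S \<noteq> {} \<longrightarrow>
      bij_betw (\<theta> S n) (piece M S n) (piece N S n)
    \<and> (\<forall>a\<in>piece M S n. \<forall>b\<in>piece M S n. \<theta> S n (add M S n a b) = add N S n (\<theta> S n a) (\<theta> S n b))
    \<and> (\<forall>k. \<forall>a\<in>piece M S n. \<theta> S n (scale M S n k a) = scale N S n k (\<theta> S n a))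
    \<and> (\<forall>\<sigma>. inj_on \<sigma> S \<longrightarrow> (\<forall>a\<in>piece M S n.
          \<theta> (\<sigma> ` S) n (relabel M S n \<sigma> a) = relabel N S n \<sigma> (\<theta> S n a))))"

definition apply_blocks :: "(nat set \<Rightarrow> nat \<Rightarrow> 'e \<Rightarrow> 'f) \<Rightarrow> nat set list \<Rightarrow> nat list \<Rightarrow> 'e list \<Rightarrow> 'f list" where
  "apply_blocks \<theta> Ts qs bs = map (\<lambda>(T, q, b). \<theta> T q b) (zip Ts (zip qs bs))"

definition operad_iso :: "('k, 'e) operad \<Rightarrow> ('k, 'f) operad \<Rightarrow> (nat set \<Rightarrow> nat \<Rightarrow> 'e \<Rightarrow> 'f) \<Rightarrow> bool" where
  "operad_iso P Q \<Phi> \<longleftrightarrow> species_iso P Q \<Phi>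
    \<and> (\<forall>s. \<Phi> {s} 0 (unit_op P s) = unit_op Q s)
    \<and> (\<forall>S Ts p qs. finite S \<and> S \<noteq> {} \<and> Ts \<in> as_part S \<and> length qs = length Ts \<longrightarrow>
        (\<forall>a\<in>piece P (blocks Ts) p. \<forall>bs\<in>listset (map2 (piece P) Ts qs).
          \<Phi> S (p + sum_list qs) (compose P Ts p qs a bs)
            = compose Q Ts p qs (\<Phi> (blocks Ts) p a) (apply_blocks \<Phi> Ts qs bs)))"

definition left_module_iso :: "('k, 'o) operad \<Rightarrow> ('k, 'o, 'e) left_module \<Rightarrow> ('k, 'o, 'f) left_module
    \<Rightarrow> (nat set \<Rightarrow> nat \<Rightarrow> 'e \<Rightarrow> 'f) \<Rightarrow> bool" where
  "left_module_iso P M N \<theta> \<longleftrightarrow> species_iso M N \<theta>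
    \<and> (\<forall>S Ts p qs. finite S \<and> S \<noteq> {} \<and> Ts \<in> as_part S \<and> length qs = length Ts \<longrightarrow>
        (\<forall>a\<in>piece P (blocks Ts) p. \<forall>ms\<in>listset (map2 (piece M) Ts qs).
          \<theta> S (p + sum_list qs) (act M Ts p qs a ms)
            = act N Ts p qs a (apply_blocks \<theta> Ts qs ms)))"

definition regular_module :: "('k, 'e) operad \<Rightarrow> ('k, 'e, 'e) left_module" where
  "regular_module P = \<lparr>piece = piece P, zero_elt = zero_elt P, add = add P, scale = scale P,
     relabel = relabel P, act = compose P\<rparr>"

definition restrict_module :: "(nat set \<Rightarrow> nat \<Rightarrow> 'o \<Rightarrow> 'q) \<Rightarrow> ('k, 'q, 'e) left_module
    \<Rightarrow> ('k, 'o, 'e) left_module" where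
  "restrict_module f M = \<lparr>piece = piece M, zero_elt = zero_elt M, add = add M, scale = scale M,
     relabel = relabel M, act = (\<lambda>Ts p qs a ms. act M Ts p qs (f (blocks Ts) p a) ms)\<rparr>"


section \<open>The operad \<open>h(\<^sup>A\<^sup>s\<Pi>)\<close> and its left module\<close>

abbreviation as_diff :: "nat set \<Rightarrow> (nat set list list, 'k::comm_ring_1) differential" where
  "as_diff S \<equiv> diff (as_part S) as_le"

abbreviation as_max :: "nat set \<Rightarrow> (nat set list list, 'k::comm_ring_1) cochain_complex" where
  "as_max S \<equiv> c_max (as_part S) as_le"

abbreviation as_check :: "nat set \<Rightarrow> (nat set list list, 'k::comm_ring_1) cochain_complex" where
  "as_check S \<equiv> c_check (as_part S) as_le"

text \<open>
  An operation on cochains that is compatible with the differentials acts on classes by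
  \<open>\<Union>c\<in>A. coh_class C d n (f c)\<close>: all sets in this union are equal.
\<close>

definition coh_species :: "(nat set \<Rightarrow> (nat set list list, 'k::comm_ring_1) cochain_complex)
    \<Rightarrow> ('k, (nat set list list \<Rightarrow> 'k) set) species" where
  "coh_species C = \<lparr>
     piece = (\<lambda>S. cohomology (C S) (as_diff S)),
     zero_elt = (\<lambda>S n. coh_class (C S) (as_diff S) n (\<lambda>_. 0)),
     add = (\<lambda>S n A B. \<Union>a\<in>A. \<Union>b\<in>B. coh_class (C S) (as_diff S) n (\<lambda>z. a z + b z)),
     scale = (\<lambda>S n k A. \<Union>a\<in>A. coh_class (C S) (as_diff S) n (\<lambda>z. k * a z)),
     relabel = (\<lambda>S n \<sigma> A. \<Union>a\<in>A. coh_class (C (\<sigma> ` S)) (as_diff (\<sigma> ` S)) n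
        (lin_ext (chains (as_part S) as_le n) (\<lambda>xs. symb (map (map ((`) \<sigma>)) xs)) a))\<rparr>"

definition rho_class :: "(nat set \<Rightarrow> (nat set list list, 'k::comm_ring_1) cochain_complex)
    \<Rightarrow> nat set list \<Rightarrow> nat \<Rightarrow> nat list \<Rightarrow> (nat set list list \<Rightarrow> 'k) set
    \<Rightarrow> (nat set list list \<Rightarrow> 'k) set list \<Rightarrow> (nat set list list \<Rightarrow> 'k) set" where
  "rho_class C Ts p qs A Bs = (\<Union>a\<in>A. \<Union>bs\<in>listset Bs.
     coh_class (C (\<Union>(set Ts))) (as_diff (\<Union>(set Ts))) (p + sum_list qs) (rho Ts p qs a bs))"

definition h_operad :: "('k::comm_ring_1, (nat set list list \<Rightarrow> 'k) set) operad" where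
  "h_operad = species.extend (coh_species as_max)
     (operad.fields (\<lambda>s. coh_class (as_max {s}) (as_diff {s}) 0 (symb [[{s}]])) (rho_class as_max))"

definition h_check_module :: "('k::comm_ring_1, (nat set list list \<Rightarrow> 'k) set,
    (nat set list list \<Rightarrow> 'k) set) left_module" where
  "h_check_module = species.extend (coh_species as_check) (left_module.fields (rho_class as_check))"


section \<open>\<open>As\<close>, \<open>Com\<close> and the operadic desuspension\<close>

definition lin_orders :: "nat set \<Rightarrow> nat list set" where
  "lin_orders S = {l. distinct l \<and> set l = S}"

text \<open>Substitution of the linear orders \<open>ls ! i\<close> on \<open>Ts ! i\<close> into a linear order \<open>\<xi>\<close> on the blocks.\<close>

definition subst_orders :: "nat set list \<Rightarrow> nat list \<Rightarrow> nat list list \<Rightarrow> nat list" where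
  "subst_orders Ts \<xi> ls = concat (map (\<lambda>t. the (map_of (zip (map set_encode Ts) ls) t)) \<xi>)"

definition As :: "('k::comm_ring_1, nat list \<Rightarrow> 'k) operad" where
  "As = \<lparr>
     piece = (\<lambda>S n. if n = 0 then free_mod (lin_orders S) else {\<lambda>_. 0}),
     zero_elt = (\<lambda>S n. \<lambda>_. 0),
     add = (\<lambda>S n a b. \<lambda>l. a l + b l),
     scale = (\<lambda>S n k a. \<lambda>l. k * a l),
     relabel = (\<lambda>S n \<sigma>. lin_ext (lin_orders S) (\<lambda>l. symb (map \<sigma> l))),
     unit_op = (\<lambda>s. symb [s]),
     compose = (\<lambda>Ts p qs a bs. \<lambda>z. \<Sum>\<xi>\<in>lin_orders (blocks Ts). \<Sum>ls\<in>listset (map lin_orders Ts).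
        a \<xi> * (\<Prod>i<length Ts. (bs ! i) (ls ! i)) * symb (subst_orders Ts \<xi> ls) z)\<rparr>"

definition Com :: "('k::comm_ring_1, 'k) operad" where
  "Com = \<lparr>
     piece = (\<lambda>S n. if n = 0 then UNIV else {0}),
     zero_elt = (\<lambda>S n. 0),
     add = (\<lambda>S n a b. a + b),
     scale = (\<lambda>S n k a. k * a),
     relabel = (\<lambda>S n \<sigma> a. a),
     unit_op = (\<lambda>s. 1),
     compose = (\<lambda>Ts p qs a bs. a * prod_list bs)\<rparr>"

definition As_to_Com :: "nat set \<Rightarrow> nat \<Rightarrow> (nat list \<Rightarrow> 'k) \<Rightarrow> 'k::comm_ring_1" where
  "As_to_Com S n a = (\<Sum>l\<in>lin_orders S. a l)"

text \<open>
  Let \<open>E = K \<epsilon>\<close> with \<open>\<epsilon>\<close> in cohomological degree \<open>-1\<close>.  An element of \<open>End\<^sub>E(S) \<otimes> P(S)\<close>, where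
  \<open>End\<^sub>E(S) = Hom(E\<^sup>\<otimes>\<^sup>S, E) = s\<^sup>n\<^sup>-\<^sup>1 sgn\<close> and \<open>n = card S\<close>, is recorded by its values on
  \<open>\<epsilon> \<otimes> \<dots> \<otimes> \<epsilon>\<close>, the factors of which are arranged along an enumeration \<open>w\<close> of \<open>S\<close>: it is a map \<open>F\<close>
  from enumerations of \<open>S\<close> to \<open>P(S)\<close> that changes by the sign of the permutation when \<open>w\<close> is
  permuted.

  In a composite, evaluated along an enumeration \<open>v\<close>, the factors \<open>\<epsilon>\<close> are first sorted
  into the blocks \<open>Ts ! 0\<close>, \<open>Ts ! 1\<close>, \<dots>, which gives \<open>reorder_sign\<close>; then the \<open>j\<close>-th operation, of
  degree \<open>card (Ts ! j) - 1\<close>, passes the \<open>card (Ts ! i)\<close> factors \<open>\<epsilon>\<close> of each earlier block,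
  which gives \<open>koszul_sign\<close>.  No further signs occur since \<open>P\<close> is assumed to be concentrated in degree \<open>0\<close>.
\<close>

definition reorder_sign :: "nat list \<Rightarrow> nat list \<Rightarrow> 'k::comm_ring_1" where
  "reorder_sign v w = (- 1) ^ card {(i, j). i < j \<and> j < length v \<and>
     (\<exists>k l. k < l \<and> l < length w \<and> w ! k = v ! j \<and> w ! l = v ! i)}"

definition koszul_sign :: "nat set list \<Rightarrow> 'k::comm_ring_1" where
  "koszul_sign Ts = (- 1) ^ (\<Sum>j<length Ts. \<Sum>i<j. card (Ts ! i) * (card (Ts ! j) - 1))"

definition desusp :: "('k::comm_ring_1, 'e) operad \<Rightarrow> ('k, nat list \<Rightarrow> 'e) operad" where
  "desusp P = \<lparr>
     piece = (\<lambda>S n. if n = card S - 1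
        then {F. (\<forall>w. w \<notin> lin_orders S \<longrightarrow> F w = zero_elt P S 0)
               \<and> (\<forall>w\<in>lin_orders S. F w \<in> piece P S 0)
               \<and> (\<forall>v\<in>lin_orders S. \<forall>w\<in>lin_orders S. F v = scale P S 0 (reorder_sign v w) (F w))}
        else {\<lambda>_. zero_elt P S 0}),
     zero_elt = (\<lambda>S n. \<lambda>_. zero_elt P S 0),
     add = (\<lambda>S n F G. \<lambda>w. add P S 0 (F w) (G w)),
     scale = (\<lambda>S n k F. \<lambda>w. scale P S 0 k (F w)),
     relabel = (\<lambda>S n \<sigma> F. \<lambda>w. if w \<in> lin_orders (\<sigma> ` S)
        then relabel P S 0 \<sigma> (F (map (inv_into S \<sigma>) w)) else zero_elt P (\<sigma> ` S) 0),
     unit_op = (\<lambda>s. \<lambda>w. if w = [s] then unit_op P s else zero_elt P {s} 0),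
     compose = (\<lambda>Ts p qs F Gs. \<lambda>v. let S = \<Union>(set Ts); ws = map (\<lambda>T. filter (\<lambda>s. s \<in> T) v) Ts in
        if v \<in> lin_orders S
        then scale P S 0 (reorder_sign v (concat ws) * koszul_sign Ts)
               (compose P Ts 0 (map (\<lambda>_. 0) Ts) (F (map set_encode Ts)) (map2 (\<lambda>G w. G w) Gs ws))
        else zero_elt P S 0)\<rparr>"

definition desusp_map :: "(nat set \<Rightarrow> nat \<Rightarrow> 'e \<Rightarrow> 'f) \<Rightarrow> nat set \<Rightarrow> nat \<Rightarrow> (nat list \<Rightarrow> 'e) \<Rightarrow> nat list \<Rightarrow> 'f" where
  "desusp_map f S n F = (\<lambda>w. f S 0 (F w))"

text \<open>
  The desuspension of the product \<open>x\<^sub>1 x\<^sub>2\<close>; the identification of \<open>s sgn\<^sub>2 \<otimes> As(2)\<close> with \<open>s As(2)\<close>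
  uses the enumeration \<open>1, 2\<close>.
\<close>

definition product_elt :: "nat list \<Rightarrow> nat list \<Rightarrow> 'k::comm_ring_1" where
  "product_elt w = (if w = [1, 2] then symb [1, 2] else if w = [2, 1] then (\<lambda>l. - symb [1, 2] l) else (\<lambda>_. 0))"

definition product_class :: "(nat set list list \<Rightarrow> 'k::comm_ring_1) set" where
  "product_class = coh_class (as_max {1, 2}) (as_diff {1, 2}) 1 (symb [[{1, 2}], [{1}, {2}]])"

end

theory Submission
  imports Defs
begin

text \<open>
  Sending an ordered partition to the set of unions of its initial segments identifies
  \<open>\<^sup>A\<^sup>s\<Pi>(S)\<close> with the face poset of the Coxeter complex of type \<open>A\<close>, a sphere of dimension \<open>n - 2\<close>
  which is shelled by the permutations obtained by sorting every block.  An acyclic matching on the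
  chains of faces, in which only a chain below the decreasing permutation remains unmatched, shows that
  the cohomology of all chains starting at the minimum vanishes below degree \<open>n - 1\<close> and is cyclic in
  degree \<open>n - 1\<close>.

  In the top degree the two cochain modules coincide, so every top cochain represents a unique
  element of \<open>\<Lambda>\<^sup>-\<^sup>1As\<close> under the given isomorphism, and can be pushed to \<open>\<Lambda>\<^sup>-\<^sup>1Com\<close>.  This kills
  the coboundaries of the larger complex: the only new ones are boundaries of chains whose last
  element has one block \<open>{a, b}\<close>, and such a boundary is an operadic composite with the sum of the two
  maximal chains on \<open>{a, b}\<close>, i.e. with the commutator of the product up to sign.  The induced surjection from
  a cyclic module onto \<open>K\<close> is injective.  Compatibility with the module structure is inherited from the operad
  isomorphism because all other degrees vanish.
\<close>

text \<open>As \<open>[S]\<close> is the only minimal element, \<open>as_check S\<close> is, up to a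
  shift by one, the augmented cochain complex of the subdivided sphere; hence the degree
  \<open>card S - 1\<close>. Over an arbitrary ring nothing may be divided by, so the matching rests
  on incidence coefficients that are signs and on a rank that makes the system of matched pairs
  triangular. The map \<open>\<Psi>\<close> is an arbitrary isomorphism, normalised only on the
  product of two elements. Its values on longer chains are therefore never computed: linearity,
  relabelling and composition suffice to see that the boundaries of the larger complex die. That
  nothing else dies would require a count of relations among the maximal chains of all permutations.
  Instead the generators are bounded from above, by the single critical chain, and the surjection
  onto the ground ring supplies the bound from below. Neither the sign nor the class of the critical
  chain has to be known.\<close>

section \<open>Deleting and inserting entries of a chain\<close>

definition remove_nth :: "nat \<Rightarrow> 'a list \<Rightarrow> 'a list" where
  "remove_nth i xs = take i xs @ drop (Suc i) xs"

lemma length_remove_nth: "i < length xs \<Longrightarrow> length (remove_nth i xs) = length xs - 1"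
  by (auto simp: remove_nth_def)

lemma nth_remove_nth:
  assumes "i < length xs" "j < length xs - 1"
  shows "remove_nth i xs ! j = (if j < i then xs ! j else xs ! Suc j)"
  using assms by (auto simp: remove_nth_def nth_append min_def)

lemma remove_nth_insert: "i \<le> length xs \<Longrightarrow> remove_nth i (take i xs @ y # drop i xs) = xs"
  by (auto simp: remove_nth_def)

lemma insert_remove_nth: "i < length z \<Longrightarrow> take i (remove_nth i z) @ z ! i # drop i (remove_nth i z) = z"
  by (simp add: remove_nth_def id_take_nth_drop[symmetric])

lemma set_remove_nth: "set (remove_nth i xs) \<subseteq> set xs"
  by (auto simp: remove_nth_def dest: in_set_takeD in_set_dropD)

lemma remove_nth_inj:
  assumes "distinct z" "i < length z" "j < length z" "remove_nth i z = remove_nth j z"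
  shows "i = j"
proof -
  have *: False if "i < j" "j < length z" "remove_nth i z = remove_nth j z" for i j
  proof -
    have "remove_nth i z ! i = z ! Suc i" "remove_nth j z ! i = z ! i"
      using that(1,2) by (auto simp: nth_remove_nth)
    then have "z ! i = z ! Suc i" using that(3) by simp
    then show False using that assms(1) by (auto simp: nth_eq_iff_index_eq)
  qed
  show ?thesis using *[of i j] *[of j i] assms by (metis linorder_neqE_nat)
qed

text \<open>The simplicial identity for face maps, which makes the terms of a twofold differential
  cancel in pairs.\<close>

lemma remove_nth_commute:
  assumes "i \<le> j" "Suc j < length z"
  shows "remove_nth j (remove_nth i z) = remove_nth i (remove_nth (Suc j) z)"
  by (rule nth_equalityI) (use assms in \<open>auto simp: length_remove_nth nth_remove_nth\<close>)

lemma finite_chains: "finite P \<Longrightarrow> finite (chains P le n)"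
  by (rule finite_subset[of _ "{xs. set xs \<subseteq> P \<and> length xs = Suc n}"])
    (auto simp: chains_def intro: finite_lists_length_eq)

text \<open>Index 0 is excluded because the minimal head must stay. The last entry may go, since
  nothing is asked of the end of these chains.\<close>

lemma chains_remove_nth:
  assumes "z \<in> chains P le (Suc n)" "1 \<le> i" "i \<le> Suc n"
  shows "remove_nth i z \<in> chains P le n"
proof -
  have z: "length z = Suc (Suc n)" "set z \<subseteq> P" "sorted_wrt (lt_of le) z" "minimal_in P le (hd z)"
    using assms(1) by (auto simp: chains_def)
  have "sorted_wrt (lt_of le) (take i z @ drop i z)" using z by simp
  then have "sorted_wrt (lt_of le) (remove_nth i z)"
    unfolding remove_nth_def sorted_wrt_append
    using z(3) by (auto simp: sorted_wrt_take sorted_wrt_drop) (metis drop_Suc in_set_dropD nth_via_drop set_drop_subset_set_drop subset_iff Suc_n_not_le_n nat_le_linear)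
  moreover have "hd (remove_nth i z) = hd z" using assms z by (cases z; cases i) (auto simp: remove_nth_def)
  ultimately show ?thesis using z assms set_remove_nth[of i z] by (auto simp: chains_def length_remove_nth)
qed

section \<open>The differential of a finite order as a sum over faces\<close>

locale finite_order =
  fixes P :: "'p set" and le :: "'p \<Rightarrow> 'p \<Rightarrow> bool"
  assumes fin: "finite P"
    and trans: "\<And>x y z. x \<in> P \<Longrightarrow> y \<in> P \<Longrightarrow> z \<in> P \<Longrightarrow> le x y \<Longrightarrow> le y z \<Longrightarrow> le x z"
    and antisym: "\<And>x y. x \<in> P \<Longrightarrow> y \<in> P \<Longrightarrow> le x y \<Longrightarrow> le y x \<Longrightarrow> x = y"
begin

lemma lt_trans: "x \<in> P \<Longrightarrow> y \<in> P \<Longrightarrow> z \<in> P \<Longrightarrow> lt_of le x y \<Longrightarrow> lt_of le y z \<Longrightarrow> lt_of le x z"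
  using trans antisym unfolding lt_of_def by metis

lemma lt_irrefl: "\<not> lt_of le x x"
  by (simp add: lt_of_def)

lemma chain_distinct: "z \<in> chains P le n \<Longrightarrow> distinct z"
  by (auto simp: chains_def distinct_conv_nth sorted_wrt_iff_nth_less)
    (metis lt_irrefl linorder_neqE_nat)

lemma chains_insert:
  assumes xs: "xs \<in> chains P le n" and i: "1 \<le> i" "i \<le> Suc n" and y: "y \<in> P"
    and l: "lt_of le (xs ! (i - 1)) y" and r: "i < Suc n \<Longrightarrow> lt_of le y (xs ! i)"
  shows "take i xs @ y # drop i xs \<in> chains P le (Suc n)"
proof -
  have z: "length xs = Suc n" "set xs \<subseteq> P" "sorted_wrt (lt_of le) xs" "minimal_in P le (hd xs)"
    using xs by (auto simp: chains_def)
  have PP: "xs ! j \<in> P" if "j < Suc n" for j using z that by auto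
  have a: "lt_of le (xs ! j) y" if "j < i" for j
  proof (cases "j = i - 1")
    case False
    then have "lt_of le (xs ! j) (xs ! (i - 1))" using z i that by (auto simp: sorted_wrt_iff_nth_less)
    then show ?thesis using lt_trans[of "xs ! j" "xs ! (i-1)" y] PP i that l y by auto
  qed (use l in simp)
  have b: "lt_of le y (xs ! j)" if "i \<le> j" "j < Suc n" for j
  proof (cases "j = i")
    case False
    then have "lt_of le (xs ! i) (xs ! j)" using z i that by (auto simp: sorted_wrt_iff_nth_less)
    then show ?thesis using lt_trans[of y "xs ! i" "xs ! j"] PP i that r y by auto
  qed (use r that in simp)
  have 1: "sorted_wrt (lt_of le) (take i xs @ drop i xs)" using z by simp
  have "sorted_wrt (lt_of le) (take i xs @ y # drop i xs)"
    using 1 z a b i unfolding sorted_wrt_append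
    by (auto simp: in_set_conv_nth)
  moreover have "hd (take i xs @ y # drop i xs) = hd xs" using i z by (cases xs; cases i) auto
  moreover have "set (take i xs @ y # drop i xs) \<subseteq> P"
    using z y by (auto dest: in_set_takeD in_set_dropD)
  ultimately show ?thesis using z i by (auto simp: chains_def)
qed

text \<open>Insertions into \<open>xs\<close> become deletions from the longer chain
  \<open>z\<close>. The upper bound on \<open>y\<close> is imposed only for
  \<open>i < Suc n\<close>, so that the elements appended at the end, a separate sum in the
  differential, are the case \<open>i = Suc n\<close> of one formula.\<close>

lemma insert_iff_remove:
  assumes xs: "xs \<in> chains P le n" and i: "1 \<le> i" "i \<le> Suc n"
  shows "y \<in> P \<and> lt_of le (xs ! (i - 1)) y \<and> (i < Suc n \<longrightarrow> lt_of le y (xs ! i))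
           \<and> z = take i xs @ y # drop i xs
     \<longleftrightarrow> z \<in> chains P le (Suc n) \<and> remove_nth i z = xs \<and> y = z ! i"
    (is "?L \<longleftrightarrow> ?R")
proof
  have lx: "length xs = Suc n" using xs by (auto simp: chains_def)
  assume ?L
  then show ?R using chains_insert[OF xs i, of y] remove_nth_insert[of i xs y] lx i by (auto simp: nth_append)
next
  assume R: ?R
  have z: "length z = Suc (Suc n)" "set z \<subseteq> P" "sorted_wrt (lt_of le) z" 
    using R by (auto simp: chains_def)
  have "z = take i xs @ y # drop i xs" using R insert_remove_nth[of i z] z i by auto
  moreover have "xs ! (i - 1) = z ! (i - 1)" "i < Suc n \<longrightarrow> xs ! i = z ! Suc i"
    using R z i nth_remove_nth[of i z "i - 1"] nth_remove_nth[of i z i] by auto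
  ultimately show ?L using R z i by (auto simp: sorted_wrt_iff_nth_less subset_iff)
qed

lemma diff_sym_eq:
  assumes xs: "xs \<in> chains P le n"
  shows "diff_sym P le xs z = (if z \<in> chains P le (Suc n)
     then \<Sum>i = 1..Suc n. (- 1) ^ i * (if remove_nth i z = xs then 1 else 0) else (0::'k::comm_ring_1))"
proof -
  have lx: "length xs = Suc n" using xs by (auto simp: chains_def)
  let ?Y = "\<lambda>i. {y \<in> P. lt_of le (xs ! (i - 1)) y \<and> (i < Suc n \<longrightarrow> lt_of le y (xs ! i))}"
  have S: "(\<Sum>y\<in>?Y i. symb (take i xs @ y # drop i xs) z)
      = (if z \<in> chains P le (Suc n) \<and> remove_nth i z = xs then 1 else (0::'k))"
    if i: "1 \<le> i" "i \<le> Suc n" for i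
  proof -
    have e: "y \<in> ?Y i \<and> z = take i xs @ y # drop i xs
       \<longleftrightarrow> z \<in> chains P le (Suc n) \<and> remove_nth i z = xs \<and> y = z ! i" for y
      using insert_iff_remove[OF xs i, of y z] by blast
    have fY: "finite (?Y i)" using fin by simp
    show ?thesis
    proof (cases "z \<in> chains P le (Suc n) \<and> remove_nth i z = xs")
      case True
      then have m: "z ! i \<in> ?Y i" and "z = take i xs @ z ! i # drop i xs" using e[of "z ! i"] by blast+
      then have "symb (take i xs @ y # drop i xs) z = (if y = z ! i then 1 else (0::'k))" if "y \<in> ?Y i" for y
        using e[of y] that True unfolding symb_def by auto
      then have "(\<Sum>y\<in>?Y i. symb (take i xs @ y # drop i xs) z) = (\<Sum>y\<in>?Y i. if y = z ! i then 1 else (0::'k))"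
        by (rule sum.cong[OF refl])
      also have "\<dots> = 1" using fY m by (subst sum.delta) auto
      finally show ?thesis using True by simp
    next
      case False
      then have "symb (take i xs @ y # drop i xs) z = (0::'k)" if "y \<in> ?Y i" for y
        using e[of y] that unfolding symb_def by auto
      then have "(\<Sum>y\<in>?Y i. symb (take i xs @ y # drop i xs) z) = (0::'k)" by (rule sum.neutral[OF ballI])
      then show ?thesis using False by auto
    qed
  qed
  have "diff_sym P le xs z = (\<Sum>i = 1..n. (- 1) ^ i * (\<Sum>y\<in>?Y i. symb (take i xs @ y # drop i xs) z))
     + (- 1) ^ Suc n * (\<Sum>y\<in>?Y (Suc n). symb (take (Suc n) xs @ y # drop (Suc n) xs) z)"
    using lx unfolding diff_sym_def by (cases xs rule: rev_cases) (auto intro!: sum.cong)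
  also have "\<dots> = (\<Sum>i = 1..Suc n. (- 1) ^ i * (\<Sum>y\<in>?Y i. symb (take i xs @ y # drop i xs) z))"
    by simp
  also have "\<dots> = (\<Sum>i = 1..Suc n. (- 1) ^ i *
      (if z \<in> chains P le (Suc n) \<and> remove_nth i z = xs then 1 else (0::'k)))"
    by (intro sum.cong refl arg_cong2[where f="(*)"] S) auto
  also have "\<dots> = (if z \<in> chains P le (Suc n)
     then \<Sum>i = 1..Suc n. (- 1) ^ i * (if remove_nth i z = xs then 1 else 0) else 0)"
    by auto
  finally show ?thesis .
qed

text \<open>Evaluation at a chain turns the sum over inserted elements into the usual simplicial
  coboundary formula without the face at the minimum.\<close>

lemma diff_apply:
  "diff P le n c z = (if z \<in> chains P le (Suc n)
     then \<Sum>i = 1..Suc n. (- 1) ^ i * c (remove_nth i z) else (0::'k::comm_ring_1))"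
proof -
  have "diff P le n c z = (\<Sum>xs\<in>chains P le n. c xs * diff_sym P le xs z)"
    by (simp add: diff_def lin_ext_def)
  also have "\<dots> = (\<Sum>xs\<in>chains P le n. c xs * (if z \<in> chains P le (Suc n)
     then \<Sum>i = 1..Suc n. (- 1) ^ i * (if remove_nth i z = xs then 1 else 0) else 0))"
    by (intro sum.cong refl) (simp only: diff_sym_eq)
  also have "\<dots> = (if z \<in> chains P le (Suc n) then
      \<Sum>xs\<in>chains P le n. \<Sum>i = 1..Suc n. c xs * ((- 1) ^ i * (if remove_nth i z = xs then 1 else 0)) else 0)"
    by (simp only: if_distrib[of "\<lambda>t. _ * t"] sum_distrib_left mult_zero_right) auto
  also have "\<dots> = (if z \<in> chains P le (Suc n) then
      \<Sum>i = 1..Suc n. \<Sum>xs\<in>chains P le n. c xs * ((- 1) ^ i * (if remove_nth i z = xs then 1 else 0)) else 0)"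
    by (simp only: sum.swap[of _ "chains P le n"])
  also have "\<dots> = (if z \<in> chains P le (Suc n)
     then \<Sum>i = 1..Suc n. (- 1) ^ i * c (remove_nth i z) else 0)"
  proof (rule if_cong[OF refl _ refl], rule sum.cong[OF refl])
    fix i assume z: "z \<in> chains P le (Suc n)" and "i \<in> {1..Suc n}"
    then have m: "remove_nth i z \<in> chains P le n" using chains_remove_nth[of z P le n i] by auto
    have "(\<Sum>xs\<in>chains P le n. c xs * ((- 1) ^ i * (if remove_nth i z = xs then 1 else 0)))
      = (\<Sum>xs\<in>chains P le n. if remove_nth i z = xs then (- 1) ^ i * c xs else 0)"
      by (rule sum.cong) auto
    then show "(\<Sum>xs\<in>chains P le n. c xs * ((- 1) ^ i * (if remove_nth i z = xs then 1 else 0))) = (- 1) ^ i * c (remove_nth i z)"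
      using m finite_chains[OF fin, of le n] by (simp add: sum.delta)
  qed
  finally show ?thesis .
qed

lemma diff_diff: "diff P le (Suc n) (diff P le n c) = (\<lambda>_. 0::'k::comm_ring_1)"
proof
  fix z
  show "diff P le (Suc n) (diff P le n c) z = 0"
  proof (cases "z \<in> chains P le (Suc (Suc n))")
    case True
    then have lz: "length z = Suc (Suc (Suc n))" by (auto simp: chains_def)
    let ?t = "\<lambda>(i, j). (- 1) ^ (i + j) * c (remove_nth j (remove_nth i z))"
    let ?I = "{1..Suc (Suc n)}" and ?J = "{1..Suc n}"
    let ?A = "{(i, j). i \<in> ?I \<and> j \<in> ?J \<and> i \<le> j}" and ?B = "{(i, j). i \<in> ?I \<and> j \<in> ?J \<and> j < i}"
    have "diff P le (Suc n) (diff P le n c) z = (\<Sum>i\<in>?I. (- 1) ^ i * (\<Sum>j\<in>?J. (- 1) ^ j * c (remove_nth j (remove_nth i z))))"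
      unfolding diff_apply[of "Suc n"] if_P[OF True]
      by (intro sum.cong refl) (use chains_remove_nth[OF True] in \<open>auto simp: diff_apply simp del: sum.cl_ivl_Suc\<close>)
    also have "\<dots> = (\<Sum>p\<in>?I \<times> ?J. ?t p)"
      by (simp add: sum.cartesian_product[symmetric] sum_distrib_left power_add mult.assoc del: sum.cl_ivl_Suc)
    also have "?I \<times> ?J = ?A \<union> ?B" by auto
    also have "(\<Sum>p\<in>?A \<union> ?B. ?t p) = (\<Sum>p\<in>?A. ?t p) + (\<Sum>p\<in>?B. ?t p)"
      by (rule sum.union_disjoint) (auto intro: finite_subset[of _ "?I \<times> ?J"])
    \<comment> \<open>Deleting \<open>i\<close> and then \<open>j\<close>, for
      \<open>i \<le> j\<close>, is the same as deleting \<open>Suc j\<close> and then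
      \<open>i\<close>. The sum of the indices differs by one, hence the opposite sign.\<close>
    also have "(\<Sum>p\<in>?B. ?t p) = (\<Sum>p\<in>?A. ?t (case p of (i, j) \<Rightarrow> (Suc j, i)))"
      by (rule sum.reindex_bij_witness[where i="\<lambda>(i, j). (Suc j, i)" and j="\<lambda>(i, j). (j, i - 1)"]) auto
    also have "(\<Sum>p\<in>?A. ?t (case p of (i, j) \<Rightarrow> (Suc j, i))) = (\<Sum>p\<in>?A. - ?t p)"
      by (rule sum.cong) (use lz in \<open>auto simp: remove_nth_commute add.commute\<close>)
    finally show ?thesis by (simp add: sum_negf)
  qed (simp add: diff_apply)
qed

lemma diff_sym_cases:
  assumes xs: "xs \<in> chains P le n" and ne: "diff_sym P le xs z \<noteq> (0::'k::comm_ring_1)"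
  shows "z \<in> chains P le (Suc n) \<and> (\<exists>i. 1 \<le> i \<and> i \<le> Suc n \<and> remove_nth i z = xs)"
proof (rule ccontr)
  assume "\<not> ?thesis"
  then have "diff_sym P le xs z = (0::'k)"
    unfolding diff_sym_eq[OF xs] by (auto intro!: sum.neutral simp del: sum.cl_ivl_Suc)
  then show False using ne by simp
qed

text \<open>A chain has distinct entries, so only one deletion leads from \<open>z\<close> to a
  given face and the incidence coefficient is a sign. This is what makes every pair of the matching
  invertible.\<close>

lemma diff_sym_remove:
  assumes z: "z \<in> chains P le (Suc n)" and i: "1 \<le> i" "i \<le> Suc n"
  shows "diff_sym P le (remove_nth i z) z = ((- 1) ^ i :: 'k::comm_ring_1)"
proof -
  have lz: "length z = Suc (Suc n)" using z by (auto simp: chains_def)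
  have "remove_nth j z = remove_nth i z \<longleftrightarrow> j = i" if "j \<in> {1..Suc n}" for j
    using remove_nth_inj[OF chain_distinct[OF z], of j i] that i lz by auto
  then have "diff_sym P le (remove_nth i z) z = (\<Sum>j = 1..Suc n. if j = i then (- 1) ^ j else (0::'k))"
    unfolding diff_sym_eq[OF chains_remove_nth[OF z i]] using z by (simp only: if_True) (intro sum.cong refl, simp)
  also have "\<dots> = (- 1) ^ i" using i by (subst sum.delta) auto
  finally show ?thesis .
qed

end

section \<open>Acyclic matchings\<close>

text \<open>A discrete Morse matching for two consecutive cochain modules with bases
  \<open>X\<close> and \<open>Z\<close>; \<open>coef\<close> is the matrix of the differential. A
  matched coefficient is its own inverse, and \<open>rank\<close> increases along every gradient
  step, so the matrix restricted to matched pairs is triangular.\<close>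

locale acyclic_matching =
  fixes X :: "'a set" and Z :: "'b set" and coef :: "'a \<Rightarrow> 'b \<Rightarrow> 'k::comm_ring_1"
    and M :: "'a \<Rightarrow> 'b \<Rightarrow> bool" and rank :: "'b \<Rightarrow> nat"
  assumes finX: "finite X" and finZ: "finite Z"
    and M_X: "M x z \<Longrightarrow> x \<in> X" and M_Z: "M x z \<Longrightarrow> z \<in> Z"
    and M_coef: "M x z \<Longrightarrow> coef x z * coef x z = 1"
    and M_inj: "M x z \<Longrightarrow> M x' z \<Longrightarrow> x = x'"
    and M_rank: "M x z \<Longrightarrow> M x' z' \<Longrightarrow> z' \<noteq> z \<Longrightarrow> coef x z' \<noteq> 0 \<Longrightarrow> rank z < rank z'"
begin

text \<open>Forward substitution in the triangular system: some coboundary takes prescribed values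
  at all matched elements of \<open>Z\<close>.\<close>

lemma eliminate:
  "\<exists>b. (\<forall>x. x \<notin> X \<longrightarrow> b x = 0) \<and> (\<forall>x z. M x z \<longrightarrow> c z = (\<Sum>x\<in>X. b x * coef x z))"
proof -
  have "\<exists>b. (\<forall>x. x \<notin> X \<longrightarrow> b x = 0) \<and> (\<forall>x z. M x z \<and> rank z < N \<longrightarrow> c z = (\<Sum>x\<in>X. b x * coef x z))" for N
  proof (induction N)
    case 0
    show ?case by (rule exI[of _ "\<lambda>_. 0"]) auto
  next
    case (Suc N)
    then obtain b where b0: "\<forall>x. x \<notin> X \<longrightarrow> b x = 0"
      and b: "\<And>x z. M x z \<Longrightarrow> rank z < N \<Longrightarrow> c z = (\<Sum>x\<in>X. b x * coef x z)" by blast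
    define e where "e z = c z - (\<Sum>x\<in>X. b x * coef x z)" for z
    \<comment> \<open>The error at \<open>z\<close> is added at the partner \<open>x\<close>; the
      factor \<open>coef x z\<close> cancels against itself. Matched elements of rank at most
      \<open>N\<close> other than \<open>z\<close> do not notice, as a nonzero coefficient there
      would force a rank above \<open>N\<close>.\<close>
    define b' where "b' x = b x + (\<Sum>z | M x z \<and> rank z = N. coef x z * e z)" for x
    have finM: "finite {z. M x z \<and> rank z = N}" for x
      by (rule finite_subset[OF _ finZ]) (auto dest: M_Z)
    have "c z = (\<Sum>x\<in>X. b' x * coef x z)" if m: "M x z" and r: "rank z < Suc N" for x z
    proof -
      have "(\<Sum>x'\<in>X. b' x' * coef x' z) = (\<Sum>x'\<in>X. b x' * coef x' z)
          + (\<Sum>x'\<in>X. \<Sum>z' | M x' z' \<and> rank z' = N. coef x' z' * e z' * coef x' z)"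
        unfolding b'_def by (simp add: distrib_right sum.distrib sum_distrib_right)
      also have "(\<Sum>x'\<in>X. \<Sum>z' | M x' z' \<and> rank z' = N. coef x' z' * e z' * coef x' z)
          = (\<Sum>x'\<in>X. if x' = x then (if rank z = N then e z else 0) else 0)"
      proof (rule sum.cong[OF refl])
        fix x' assume "x' \<in> X"
        have 1: "coef x' z' * e z' * coef x' z = (if z' = z then e z else 0)" if "M x' z'" "rank z' = N" for z'
        proof (cases "z' = z")
          case True
          have "coef x' z * e z * coef x' z = e z * (coef x' z * coef x' z)" by (simp only: ac_simps)
          also have "\<dots> = e z * 1" using M_coef[of x' z] that(1) True by (simp only:)
          finally show ?thesis by (simp only: mult_1_right True refl if_True)
        next
          case False
          then have "coef x' z = 0" using M_rank[OF that(1) m] that(2) r by fastforce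
          then show ?thesis using False by simp
        qed
        have "(\<Sum>z' | M x' z' \<and> rank z' = N. coef x' z' * e z' * coef x' z)
          = (\<Sum>z' | M x' z' \<and> rank z' = N. if z' = z then e z else 0)" by (intro sum.cong refl 1) auto
        also have "\<dots> = (if M x' z \<and> rank z = N then e z else 0)" using finM by (subst sum.delta) auto
        also have "\<dots> = (if x' = x then (if rank z = N then e z else 0) else 0)"
        proof -
          have eq: "M x' z \<longleftrightarrow> x' = x" using M_inj m by blast
          show ?thesis unfolding eq by simp
        qed
        finally show "(\<Sum>z' | M x' z' \<and> rank z' = N. coef x' z' * e z' * coef x' z) = \<dots>" .
      qed
      also have "\<dots> = (if rank z = N then e z else 0)" using M_X[OF m] finX by (subst sum.delta) auto
      also have "\<dots> = e z"
      proof (cases "rank z = N")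
        case False
        then show ?thesis using r b[OF m] by (simp add: e_def)
      qed simp
      finally show ?thesis by (simp add: e_def)
    qed
    moreover have "b' x = 0" if "x \<notin> X" for x
      using b0 that by (auto simp: b'_def dest: M_X intro!: sum.neutral)
    ultimately show ?case by blast
  qed
  from this[of "Suc (Max (rank ` Z))"] obtain b where
    b: "\<forall>x. x \<notin> X \<longrightarrow> b x = 0" "\<forall>x z. M x z \<and> rank z < Suc (Max (rank ` Z)) \<longrightarrow> c z = (\<Sum>x\<in>X. b x * coef x z)" by blast
  have "rank z < Suc (Max (rank ` Z))" if "M x z" for x z
    using M_Z[OF that] finZ by (simp add: le_imp_less_Suc)
  then show ?thesis using b by blast
qed

text \<open>Evaluate the cocycle at the partner \<open>z\<close> of an element of its support, with
  \<open>rank z\<close> as small as possible. Any other contribution would come from an element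
  whose partner has smaller rank, so a single term with invertible coefficient remains.\<close>

lemma matched_support_trivial:
  assumes supp: "\<And>x. x \<in> X \<Longrightarrow> c x \<noteq> 0 \<Longrightarrow> \<exists>z. M x z"
    and ker: "\<And>z. z \<in> Z \<Longrightarrow> (\<Sum>x\<in>X. c x * coef x z) = 0" and x: "x \<in> X"
  shows "c x = 0"
proof (rule ccontr)
  assume "c x \<noteq> 0"
  then obtain z where "M x z" using supp x by blast
  with \<open>c x \<noteq> 0\<close> show False
  proof (induction "rank z" arbitrary: x z rule: less_induct)
    case less
    have "(\<Sum>x'\<in>X. c x' * coef x' z) = (\<Sum>x'\<in>X. if x' = x then c x * coef x z else 0)"
    proof (rule sum.cong[OF refl])
      fix x' assume x': "x' \<in> X"
      show "c x' * coef x' z = (if x' = x then c x * coef x z else 0)"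
      proof (cases "x' = x \<or> c x' = 0")
        case False
        then obtain z' where z': "M x' z'" using supp x' by blast
        then have "z' \<noteq> z" using M_inj less.prems False by blast
        then have "coef x' z = 0" using less.hyps[of z' x'] M_rank[OF z' less.prems(2)] z' False by auto
        then show ?thesis using False by simp
      qed auto
    qed
    also have "\<dots> = c x * coef x z" using M_X[OF less.prems(2)] finX by (subst sum.delta) auto
    finally have "c x * coef x z = 0" using ker[OF M_Z[OF less.prems(2)]] by simp
    then have "c x * (coef x z * coef x z) = 0" by (simp add: mult.assoc[symmetric])
    then show False using M_coef[OF less.prems(2)] less.prems(1) by simp
  qed
qed

end

section \<open>A matching on chains of faces\<close>

context
  fixes k :: "'v \<Rightarrow> nat" and e :: bool and h :: 'v
begin

text \<open>Read from the bottom, the first place where the chain can be altered decides. A gap of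
  at least two vertices is filled by its vertex of least key (\<open>split\<close>). A step that
  adds one vertex \<open>g\<close> is passed over only if the next set brings in a vertex of smaller
  key (\<open>step\<close>); otherwise this step is one that \<open>split\<close> creates. If
  \<open>e\<close> holds, the end of the chain counts as a gap, to be filled by \<open>h\<close>
  (\<open>append\<close>). The condition in \<open>step\<close> speaks of the enlarged chain, so
  that the rule can be recovered from its result.\<close>

inductive face_match :: "'v set list \<Rightarrow> 'v set list \<Rightarrow> bool" where
  split: "v \<in> Y - X \<Longrightarrow> \<forall>w\<in>Y - X. k v \<le> k w \<Longrightarrow> Y \<noteq> insert v X \<Longrightarrow>
    face_match (X # Y # r) (X # insert v X # Y # r)"
| append: "e \<Longrightarrow> h \<notin> X \<Longrightarrow> face_match [X] [X, insert h X]"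
| step: "face_match (Y # r) (Y # W # t) \<Longrightarrow> Y = insert g X \<Longrightarrow> g \<notin> X \<Longrightarrow> \<exists>w\<in>W - Y. k w < k g \<Longrightarrow>
    face_match (X # Y # r) (X # Y # W # t)"


lemma face_match_nonempty: "face_match x z \<Longrightarrow> \<exists>X r W t. x = X # r \<and> z = X # W # t"
  by (induction rule: face_match.induct) auto

lemma face_match_right_Cons:
  assumes "face_match x (X # Y # t)"
  obtains (split) v Y' r where "x = X # Y' # r" "Y = insert v X" "t = Y' # r" "v \<in> Y' - X"
      "\<forall>w\<in>Y' - X. k v \<le> k w" "Y' \<noteq> insert v X"
  | (append) "x = [X]" "Y = insert h X" "t = []" "e" "h \<notin> X"
  | (step) r W t' g where "x = X # Y # r" "t = W # t'" "face_match (Y # r) (Y # W # t')" "Y = insert g X"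
      "g \<notin> X" "\<exists>w\<in>W - Y. k w < k g"
  using assms
proof cases
  case (split v Y' r)
  show ?thesis by (rule that(1)[of Y' r v]) (use split in simp_all)
next
  case append
  show ?thesis by (rule that(2)) (use append in simp_all)
next
  case (step r W t' g)
  show ?thesis by (rule that(3)[of r W t' g]) (use step in simp_all)
qed

text \<open>The larger chain betrays the rule: the first vertex added has the least key of the
  following difference after \<open>split\<close>, not so after \<open>step\<close>, and only
  \<open>append\<close> produces a chain of two sets.\<close>

lemma face_match_inj: "face_match x z \<Longrightarrow> face_match x' z \<Longrightarrow> x = x'"
proof (induction arbitrary: x' rule: face_match.induct)
  case (split v Y X r)
  from split.prems show ?case
  proof (cases rule: face_match_right_Cons)
    case (step r' W t' g)
    have "g = v" using step(4,5) split.hyps(1) by (blast elim: equalityE)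
    moreover have "W = Y" using step(2) by simp
    ultimately show ?thesis using step(6) split.hyps(2) by (auto simp: not_le[symmetric])
  qed auto
next
  case (append X)
  from append.prems show ?case
    by (cases rule: face_match_right_Cons) auto
next
  case (step Y r W t g X)
  from step.prems show ?case
  proof (cases rule: face_match_right_Cons)
    case (split v Y' r')
    have "g = v" using step.hyps(2,3) split(2,4) by (blast elim: equalityE)
    moreover have "W = Y'" using split(3) by simp
    moreover have "X \<subseteq> Y" using step.hyps(2) by auto
    ultimately show ?thesis using step.hyps(4) split(5) by (auto simp: not_le[symmetric])
  next
    case (step r' W' t' g')
    then show ?thesis using \<open>\<And>x'. face_match x' (Y # W # t) \<Longrightarrow> Y # r = x'\<close> by auto
  qed auto
qed

text \<open>The unmatched chains: vertices enter one at a time with falling keys, as in the falling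
  chains of a lexicographic shelling. If \<open>e\<close> holds, every set of the chain contains
  \<open>h\<close>, so none of them starts at the empty set.\<close>

inductive face_critical :: "'v set list \<Rightarrow> bool" where
  last: "(e \<Longrightarrow> h \<in> X) \<Longrightarrow> face_critical [X]"
| step: "face_critical (Y # r) \<Longrightarrow> Y = insert g X \<Longrightarrow> g \<notin> X \<Longrightarrow> (e \<Longrightarrow> h \<in> X) \<Longrightarrow>
    (\<And>R t. r = R # t \<Longrightarrow> \<exists>g'. R = insert g' Y \<and> g' \<notin> Y \<and> k g' < k g) \<Longrightarrow>
    face_critical (X # Y # r)"

text \<open>Induction on the tail. If the set after \<open>Y\<close> brings in a vertex of smaller
  key than the first vertex \<open>g\<close>, the first step is passed over and the status of the
  tail is inherited. Otherwise \<open>g\<close> is least and \<open>Y\<close> can be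
  deleted.\<close>

lemma face_match_total:
  assumes "sorted_wrt (\<subset>) xs" "xs \<noteq> []" "\<Union>(set xs) \<subseteq> F" "finite F" "inj_on k F"
    and h: "e \<Longrightarrow> h \<in> F \<and> (\<forall>w\<in>F. k h \<le> k w)"
  shows "(\<exists>zs. face_match xs zs) \<or> (\<exists>ys. face_match ys xs) \<or> face_critical xs"
  using assms(1-3)
proof (induction xs rule: induct_list012)
  case 1
  then show ?case by simp
next
  case (2 X)
  show ?case
    using face_match.append[of X] face_critical.last[of X] by blast
next
  case (3 X Y r)
  have XY: "X \<subset> Y" and YF: "Y \<subseteq> F" using 3 by auto
  have IH: "(\<exists>zs. face_match (Y # r) zs) \<or> (\<exists>ys. face_match ys (Y # r)) \<or> face_critical (Y # r)"
    using 3 by auto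
  have minim: "\<exists>v\<in>A. \<forall>w\<in>A. k v \<le> k w" if "A \<noteq> {}" "A \<subseteq> F" for A
    using ex_min_if_finite[of "k ` A"] that finite_subset[OF that(2) assms(4)] by (metis (mono_tags) arg_min_if_finite(1) arg_min_least)
  show ?case
  proof (cases "\<exists>g. Y = insert g X")
    case False
    obtain v where "v \<in> Y - X" "\<forall>w\<in>Y - X. k v \<le> k w" using minim[of "Y - X"] XY YF by blast
    then show ?thesis using face_match.split[of v Y X r] False by blast
  next
    case True
    then obtain g where g: "Y = insert g X" "g \<notin> X" using XY by blast
    have gF: "g \<in> F" using g YF by auto
    \<comment> \<open>Here \<open>Y\<close> is just the set that \<open>split\<close> would insert
      between \<open>X\<close> and \<open>R\<close>.\<close>
    have down: ?thesis if R: "r = R # t" and min: "\<forall>w\<in>R - X. k g \<le> k w" for R t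
    proof -
      have "Y \<subset> R" using 3 R by auto
      then have "face_match (X # R # t) (X # insert g X # R # t)"
        by (intro face_match.split) (use g min in auto)
      then show ?thesis using R g by blast
    qed
    have key: "k g < k w" if "w \<in> F" "w \<notin> Y" "\<not> k w < k g" for w
      using that g gF assms(5) by (metis inj_on_eq_iff insertI1 linorder_neqE_nat)
    have sub: "R \<subseteq> F" "Y \<subset> R" if "r = R # t" for R t using 3 that by auto
    from IH consider (up) zs where "face_match (Y # r) zs" | (dn) ys where "face_match ys (Y # r)"
      | (cr) "face_critical (Y # r)" by blast
    then show ?thesis
    proof cases
      case up
      then obtain W t where zs: "zs = Y # W # t" using face_match_nonempty by blast
      show ?thesis
      proof (cases "\<exists>w\<in>W - Y. k w < k g")
        case True
        then show ?thesis using face_match.step[of Y r W t g X] up g zs by blast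
      next
        case no: False
        from up[unfolded zs] show ?thesis
        proof (cases rule: face_match_right_Cons)
          case (split v R r')
          have "k g \<le> k w" if "w \<in> R - X" for w
          proof (cases "w = g")
            case False
            then have "k v \<le> k w" using that split(5) g by blast
            moreover have "k g \<le> k v" using no split(2,4) by (auto simp: not_less)
            ultimately show ?thesis by linarith
          qed simp
          moreover have "r = R # r'" using split(1) by simp
          ultimately show ?thesis using down by blast
        next
          case append
          then have "h \<in> F" "\<not> k h < k g" using h g no by auto
          then have "k g < k h" using key[of h] append by blast
          then show ?thesis using append(4) h gF by (auto simp: not_le[symmetric])
        next
          case (step r' W' t' g')
          have W: "W - X = {g, g'}" "\<not> k g' < k g" using no g step(4,5) by auto
          have "r = W # r'" using step(1) by simp
          then show ?thesis by (rule down) (unfold W(1), use W(2) in auto)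
        qed
      qed
    next
      case dn
      then obtain W t where r: "r = W # t" using face_match_nonempty by blast
      show ?thesis
      proof (cases "\<exists>w\<in>W - Y. k w < k g")
        case True
        obtain r' where "ys = Y # r'" using face_match_nonempty[OF dn] by auto
        then show ?thesis using face_match.step[of Y r' W t g X] dn g r True by blast
      next
        case no: False
        then show ?thesis using down[of W t] r g by (auto simp: not_less)
      qed
    next
      case cr
      show ?thesis
      proof (cases r)
        case Nil
        have hY: "h \<in> Y" if e using cr that unfolding Nil by (cases) auto
        show ?thesis
        proof (cases "e \<and> h \<notin> X")
          case True
          then have "face_match [X] [X, Y]" using face_match.append[of X] g hY by auto
          then show ?thesis using Nil by blast
        next
          case False
          have "face_critical (X # Y # r)" by (rule face_critical.step[OF cr g]) (use Nil False in auto)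
          then show ?thesis by blast
        qed
      next
        case (Cons R t)
        obtain g' where g': "R = insert g' Y" "g' \<notin> Y" using cr unfolding Cons by cases auto
        have hY: "h \<in> Y" if e using cr that unfolding Cons by cases auto
        show ?thesis
        proof (cases "k g' < k g")
          case True
          have "h \<in> X" if e
          proof (rule ccontr)
            assume "h \<notin> X"
            then have "h = g" using hY that g by auto
            moreover have "g' \<in> F" using sub Cons g' by auto
            ultimately show False using h[OF that] True by auto
          qed
          then have "face_critical (X # Y # r)" by (intro face_critical.step[OF cr g]) (use Cons g' True in auto)
          then show ?thesis by blast
        next
          case False
          then show ?thesis using down[of R t] Cons g' g by (auto simp: not_less)
        qed
      qed
    qed
  qed
qed

lemma face_critical_top:
  assumes "face_critical xs"
  shows "xs = A # t \<Longrightarrow> A \<subseteq> last xs"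
    and "xs = A # B # u \<Longrightarrow> \<exists>g. B = insert g A \<and> g \<in> last xs - A \<and> (\<forall>w\<in>last xs - A. k w \<le> k g)"
proof -
  have "(\<forall>A t. xs = A # t \<longrightarrow> A \<subseteq> last xs) \<and> (\<forall>A B u. xs = A # B # u \<longrightarrow>
      (\<exists>g. B = insert g A \<and> g \<in> last xs - A \<and> (\<forall>w\<in>last xs - A. k w \<le> k g)))"
    using assms
  proof (induction rule: face_critical.induct)
    case (last X)
    then show ?case by simp
  next
    case (step Y r g X)
    have "\<forall>w\<in>last (Y # r) - X. k w \<le> k g"
    proof (cases r)
      case Nil
      then show ?thesis using step.hyps by auto
    next
      case (Cons R t)
      then obtain g' where "R = insert g' Y" "g' \<notin> Y" "k g' < k g" using step.hyps by blast
      moreover obtain g'' where "R = insert g'' Y" "g'' \<notin> Y" "\<forall>w\<in>last (Y # r) - Y. k w \<le> k g''"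
        using step.IH Cons by auto
      ultimately have "\<forall>w\<in>last (Y # r) - Y. k w < k g"
        by (metis insertE insertI1 le_less_trans)
      then show ?thesis unfolding step.hyps(2) by (metis DiffD1 DiffD2 DiffI insertE less_imp_le order_refl)
    qed
    then show ?case using step by auto
  qed
  then show "xs = A # t \<Longrightarrow> A \<subseteq> last xs"
    and "xs = A # B # u \<Longrightarrow> \<exists>g. B = insert g A \<and> g \<in> last xs - A \<and> (\<forall>w\<in>last xs - A. k w \<le> k g)"
    by blast+
qed

text \<open>Keys fall along the chain, so each new vertex is the one of largest key still missing
  from the last set. The two ends therefore determine everything in between.\<close>

lemma face_critical_unique:
  assumes "face_critical xs" "face_critical ys" "hd xs = hd ys" "last xs = last ys"
    "last xs \<subseteq> F" "inj_on k F"
  shows "xs = ys"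
  using assms(1-5)
proof (induction arbitrary: ys rule: face_critical.induct)
  case (last X)
  show ?case
  proof (cases ys)
    case (Cons A t)
    then show ?thesis using last face_critical_top(2)[OF last.prems(1)] by (cases t) auto
  qed (use last.prems(1) in \<open>auto elim: face_critical.cases\<close>)
next
  case (step Y r g X)
  have cs: "face_critical (X # Y # r)" using step.hyps by (intro face_critical.step)
  obtain g1 where g1: "Y = insert g1 X" "g1 \<in> last ys - X" "\<forall>w\<in>last ys - X. k w \<le> k g1"
    using face_critical_top(2)[OF cs refl] step.prems by auto
  from step.prems(1) show ?case
  proof cases
    case (last X')
    then show ?thesis using step.prems g1 by auto
  next
    case (step Y' r' g' X')
    have X': "X' = X" using step(1) \<open>hd (X # Y # r) = hd ys\<close> by simp
    obtain g2 where g2: "Y' = insert g2 X" "g2 \<in> last ys - X" "\<forall>w\<in>last ys - X. k w \<le> k g2"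
      using face_critical_top(2)[OF step.prems(1) step(1)] X' by auto
    have "k g1 = k g2" using g1 g2 by (meson antisym)
    then have "g1 = g2" using g1 g2 step.prems assms(6) by (metis DiffD1 inj_onD subsetD)
    then have "Y # r = Y' # r'" using g1 g2 step step.prems by (intro step.IH) auto
    then show ?thesis using step(1) X' by simp
  qed
qed

text \<open>The pairs counted by \<open>key_inv\<close> are the inversions, with respect to the key, of the order in
  which the vertices enter a chain of faces.\<close>

definition key_inv :: "'v set \<Rightarrow> 'v set list \<Rightarrow> ('v \<times> 'v) set" where
  "key_inv F xs = {(v, w). v \<in> F \<and> w \<in> F \<and> k v < k w \<and> (\<exists>X\<in>set xs. w \<in> X \<and> v \<notin> X)}"

text \<open>The inserted vertex has the least key of its gap, so a pair in the wrong order that the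
  new set separates was already separated by the set below or above it. A vertex appended at the end
  has the least key of all and creates no such pair.\<close>

lemma key_inv_match: "face_match x z \<Longrightarrow> \<Union>(set z) \<subseteq> F \<Longrightarrow> inj_on k F \<Longrightarrow>
    (e \<Longrightarrow> h \<in> F \<and> (\<forall>w. k h \<le> k w)) \<Longrightarrow> key_inv F z = key_inv F x"
proof (induction rule: face_match.induct)
  case (split v Y X r)
  have "\<exists>Z\<in>{X, Y}. w \<in> Z \<and> u \<notin> Z" if "k u < k w" "w \<in> insert v X" "u \<notin> insert v X" for u w
    using that split by (cases "w \<in> X") (auto simp: not_le[symmetric])
  then show ?case unfolding key_inv_def by fastforce
next
  case (append X)
  have "\<exists>Z\<in>{X}. w \<in> Z \<and> u \<notin> Z" if "k u < k w" "w \<in> insert h X" "u \<notin> insert h X" for u w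
    using that append by (cases "w \<in> X") (auto simp: not_le[symmetric])
  then show ?case unfolding key_inv_def by fastforce
next
  case (step Y r W t g X)
  then have "key_inv F (Y # W # t) = key_inv F (Y # r)" by auto
  moreover have "key_inv F (X # A) = key_inv F [X] \<union> key_inv F A" for A unfolding key_inv_def by auto
  ultimately show ?case by metis
qed

text \<open>If a coface \<open>z'\<close> of \<open>x\<close> leaves out the least vertex of the gap
  in which \<open>x\<close> is matched, it separates this vertex from one of larger key, which is a
  new inversion. Without new inversions \<open>z'\<close> can only be the partner \<open>z\<close>.
  So inversions grow strictly along a gradient path, and their number serves as rank.\<close>

lemma face_match_acyclic:
  assumes "face_match x z" "sorted_wrt (\<subset>) z'" "remove_nth i z' = x" "1 \<le> i" "i < length z'"
    "face_match x' z'" "key_inv F z' \<subseteq> key_inv F x" "\<Union>(set z) \<union> \<Union>(set z') \<subseteq> F" "inj_on k F"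
    and h: "e \<Longrightarrow> h \<in> F \<and> (\<forall>w. k h \<le> k w)"
  shows "z' = z"
  using assms(1-8)
proof (induction arbitrary: z' i x' rule: face_match.induct)
  case (split v Y X r)
  obtain z1 where z': "z' = X # z1" using split.prems by (cases z'; cases i) (auto simp: remove_nth_def)
  then have z1: "remove_nth (i - 1) z1 = Y # r" "i - 1 < length z1"
    using split.prems by (cases i; auto simp: remove_nth_def)+
  show ?case
  proof (cases "i - 1")
    case 0
    then obtain N where N: "z' = X # N # Y # r" using z1 z' by (cases z1) (auto simp: remove_nth_def)
    have XN: "X \<subset> N" "N \<subset> Y" using split.prems(1) N by auto
    have "v \<in> N"
    proof (rule ccontr)
      assume vN: "v \<notin> N"
      obtain w where w: "w \<in> N - X" using XN by auto
      have "v \<in> F" "w \<in> F" using split.prems(7) split.hyps w XN N by auto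
      then have "k v < k w" using split.hyps w XN vN assms(9)
        by (metis DiffI DiffD1 DiffD2 inj_onD le_neq_implies_less psubsetD)
      then have "(v, w) \<in> key_inv F z'" using w vN N \<open>v \<in> F\<close> \<open>w \<in> F\<close> unfolding key_inv_def by auto
      then have "(v, w) \<in> key_inv F (X # Y # r)" using split.prems(6) by auto
      then obtain Z where "Z \<in> set (X # Y # r)" "w \<in> Z" "v \<notin> Z" unfolding key_inv_def by auto
      then show False using w split.hyps split.prems(1) N by auto
    qed
    from split.prems(5)[unfolded N] show ?thesis
    proof (cases rule: face_match_right_Cons)
      case (split v' Y' r')
      then show ?thesis using N \<open>v \<in> N\<close> \<open>v \<in> Y - X\<close> by auto
    next
      case (step r' W t' g)
      then show ?thesis using N \<open>v \<in> N\<close> \<open>v \<in> Y - X\<close> by auto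
    qed auto
  next
    case (Suc j)
    then obtain z2 where N: "z' = X # Y # z2" using z1 z' by (cases z1) (auto simp: remove_nth_def)
    from split.prems(5)[unfolded N] show ?thesis
      by (cases rule: face_match_right_Cons) (use split.hyps in auto)
  qed
next
  case (append X)
  have i: "i < length z'" "1 \<le> i" "remove_nth i z' = [X]" using append.prems by auto
  then have "length z' = 2" using length_remove_nth[of i z'] by simp
  then obtain A N where AN: "z' = [A, N]" by (auto simp: length_Suc_conv numeral_2_eq_2)
  then have "i = 1" using i by simp
  then have z': "z' = [X, N]" using i(3) AN by (simp add: remove_nth_def)
  from append.prems(5)[unfolded z'] show ?case
    by (cases rule: face_match_right_Cons) (use z' in auto)
next
  case (step Y r W t g X)
  obtain z1 where z': "z' = X # z1" using step.prems by (cases z'; cases i) (auto simp: remove_nth_def)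
  then have z1: "remove_nth (i - 1) z1 = Y # r" "i - 1 < length z1"
    using step.prems by (cases i; auto simp: remove_nth_def)+
  show ?case
  proof (cases "i - 1")
    case 0
    then obtain N where N: "z' = X # N # Y # r" using z1 z' by (cases z1) (auto simp: remove_nth_def)
    then show ?thesis using step.prems(1) step.hyps by auto
  next
    case (Suc j)
    then obtain z2 where z2: "z1 = Y # z2" using z1 z' by (cases z1) (auto simp: remove_nth_def)
    have i: "i = Suc (Suc j)" using Suc by arith
    have z2r: "remove_nth j z2 = r" "j < length z2" using z1 z2 i by (simp_all add: remove_nth_def)
    have srt: "\<And>N. N \<in> set z2 \<Longrightarrow> Y \<subset> N" "sorted_wrt (\<subset>) z2" using step.prems(1) z' z2 by auto
    \<comment> \<open>Passing to the tail loses no inversion: a set of \<open>z1\<close> that misses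
      \<open>u\<close> contains \<open>Y\<close>, so \<open>u\<close> is not in \<open>Y\<close>,
      and a separation by \<open>X\<close> is also one by \<open>Y\<close>.\<close>
    have ki: "key_inv F z1 \<subseteq> key_inv F (Y # r)"
    proof -
      have "\<exists>Z\<in>set (Y # r). w \<in> Z \<and> u \<notin> Z" if "Z \<in> set z1" "w \<in> Z" "u \<notin> Z" "k u < k w" "u \<in> F" "w \<in> F" for u w Z
      proof -
        have "(u, w) \<in> key_inv F z'" using that z' unfolding key_inv_def by auto
        then have "(u, w) \<in> key_inv F (X # Y # r)" using step.prems(6) by auto
        then obtain Z' where Z': "Z' \<in> set (X # Y # r)" "w \<in> Z'" "u \<notin> Z'" unfolding key_inv_def by auto
        have "u \<notin> Y" "X \<subseteq> Y" using that srt z2 step.hyps by auto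
        then show ?thesis using Z' by auto
      qed
      then show ?thesis unfolding key_inv_def by auto
    qed
    from step.prems(5)[unfolded z' z2] show ?thesis
    proof (cases rule: face_match_right_Cons)
      case (split v W' r')
      have vg: "v = g" using split step.hyps by auto
      have W': "z2 = W' # r'" using split by auto
      have gmin: "\<not> k w < k g" if "w \<in> W'" "w \<notin> Y" for w using split that step.hyps vg by (auto simp: not_less)
      \<comment> \<open>The newly inserted \<open>W'\<close> contains no new vertex of key below
        \<open>g\<close>, so it separates \<open>u\<close> from some \<open>w\<close> of larger key.
        In \<open>x\<close> this pair is not separated, since \<open>u\<close> lies in all sets
        after \<open>Y\<close> and \<open>w\<close> is not in \<open>Y\<close>.\<close>
      have new: False if N: "j = 0" "u \<in> W - Y" "k u < k g" and u: "\<And>Z. Z \<in> set r \<Longrightarrow> u \<in> Z" for u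
      proof -
        have uW': "u \<notin> W'" using gmin[of u] N by auto
        obtain w where w: "w \<in> W'" "w \<notin> Y" using srt(1)[of W'] W' by auto
        have "k u < k w" using gmin[OF w] N by auto
        moreover have "u \<in> F" "w \<in> F" using N w W' z2 z' step.prems(7) by auto
        ultimately have "(u, w) \<in> key_inv F z1" using w uW' z2 W' unfolding key_inv_def by auto
        then have "(u, w) \<in> key_inv F (Y # r)" using ki by auto
        then show False using w u N unfolding key_inv_def by auto
      qed
      obtain u where u: "u \<in> W - Y" "k u < k g" using step.hyps by auto
      show ?thesis
      proof (cases j)
        case 0
        then have r: "r = r'" using z2r W' by (simp add: remove_nth_def)
        from step.hyps(1) show ?thesis
        proof (cases rule: face_match_right_Cons)
          case (split v'' R r'')
          have "R \<subseteq> Z" if "Z \<in> set r" for Z using srt(2) that split(1) W' r by auto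
          moreover have "u = v''" using u(1) split(2) by blast
          ultimately show ?thesis using new[of v''] u 0 split(4) by blast
        next
          case append
          then show ?thesis using new[of h] u 0 by auto
        next
          case (step r'' W'' t'' g'')
          have "Y \<subset> W'" "W' \<subset> W" "W = insert g'' Y" using srt W' r step(1,4) by auto
          then show ?thesis by blast
        qed
      next
        case (Suc j')
        then have r: "\<exists>t. r = W' # t" using z2r W' by (auto simp: remove_nth_def)
        from step.hyps(1) show ?thesis
        proof (cases rule: face_match_right_Cons)
          case (split v'' R r'')
          then show ?thesis using r u gmin by auto
        next
          case append
          then show ?thesis using r by auto
        next
          case (step r'' W'' t'' g'')
          then show ?thesis using r u gmin by auto
        qed
      qed
    next
      case append
      then show ?thesis using z2r by auto
    next
      case (step r' W' t' g')
      have "z1 = Y # W # t"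
      proof (rule step.IH)
        show "sorted_wrt (\<subset>) z1" using step.prems(1) z' by simp
        show "remove_nth (i - 1) z1 = Y # r" "i - 1 < length z1" by fact+
        show "1 \<le> i - 1" using Suc by simp
        show "face_match (Y # r') z1" using step z2 by auto
      qed (use ki step.prems(7) z' in auto)
      then show ?thesis using z' by simp
    qed
  qed
qed

end

section \<open>Cohomology of a shelled complex\<close>

text \<open>
  \<open>\<Delta>\<close> is a simplicial complex, ordered by inclusion, whose faces are partitioned into the fibres of
  \<open>m\<close>; the fibre over a facet \<open>F\<close> is an interval \<open>[D F, F]\<close>.  For every facet other than \<open>F\<^sub>0\<close> the
  vertex \<open>h F\<close> lies outside \<open>D F\<close>, whereas \<open>D F\<^sub>0 = F\<^sub>0\<close>.
\<close>

locale shelled_complex =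
  fixes \<Delta> :: "'v set set" and m :: "'v set \<Rightarrow> 'v set" and wt :: "'v set \<Rightarrow> nat"
    and h :: "'v set \<Rightarrow> 'v" and F0 :: "'v set" and r :: nat and key :: "'v \<Rightarrow> nat"
  assumes fin\<Delta>: "finite \<Delta>" and empty\<Delta>: "{} \<in> \<Delta>"
    and down: "x \<in> \<Delta> \<Longrightarrow> y \<subseteq> x \<Longrightarrow> y \<in> \<Delta>"
    and m_face: "x \<in> \<Delta> \<Longrightarrow> m x \<in> \<Delta>" and m_above: "x \<in> \<Delta> \<Longrightarrow> x \<subseteq> m x"
    and m_card: "x \<in> \<Delta> \<Longrightarrow> finite (m x) \<and> card (m x) = r"
    and m_between: "x \<in> \<Delta> \<Longrightarrow> x \<subseteq> y \<Longrightarrow> y \<subseteq> m x \<Longrightarrow> m y = m x"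
    and m_mono: "x \<in> \<Delta> \<Longrightarrow> y \<in> \<Delta> \<Longrightarrow> x \<subseteq> y \<Longrightarrow> m x = m y \<or> wt (m x) < wt (m y)"
    and h_vertex: "x \<in> \<Delta> \<Longrightarrow> m x \<noteq> F0 \<Longrightarrow> h (m x) \<in> m x"
    and h_remove: "x \<in> \<Delta> \<Longrightarrow> m x \<noteq> F0 \<Longrightarrow> m (x - {h (m x)}) = m x"
    and F0: "x \<in> \<Delta> \<Longrightarrow> m x = F0 \<Longrightarrow> x = F0"
    and key: "inj_on key (\<Union>\<Delta>)"
begin

abbreviation ch :: "nat \<Rightarrow> 'v set list set" where "ch \<equiv> chains \<Delta> (\<subseteq>)"

sublocale finite_order \<Delta> "(\<subseteq>)"
  by unfold_locales (use fin\<Delta> in auto)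

text \<open>The vertex \<open>h F\<close> is put first, so that appending it at the end of a chain
  obeys the same rule as filling a gap.\<close>

definition facet_key :: "'v set \<Rightarrow> 'v \<Rightarrow> nat" where
  "facet_key F v = (if v = h F then 0 else Suc (key v))"

text \<open>Key, flag and vertex are read off at the facet of the last face. The end of the chain
  counts as a gap over every facet except \<open>F0\<close>, where no vertex is free.\<close>

definition matched :: "'v set list \<Rightarrow> 'v set list \<Rightarrow> bool" where
  "matched x z \<longleftrightarrow> face_match (facet_key (m (last x))) (m (last x) \<noteq> F0) (h (m (last x))) x z"

text \<open>A lexicographic order packed into one number: the factor of the weight exceeds any
  possible number of inversions.\<close>

definition chain_rank :: "'v set list \<Rightarrow> nat" where
  "chain_rank z = wt (m (last z)) * Suc (card (\<Union>\<Delta> \<times> \<Union>\<Delta>))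
     + card (key_inv (facet_key (m (last z))) (\<Union>\<Delta>) z)"

lemma lt_of_subset: "lt_of (\<subseteq>) = (\<subset>)"
  by (auto simp: lt_of_def fun_eq_iff)

lemma ch_iff: "xs \<in> ch n \<longleftrightarrow> length xs = Suc n \<and> set xs \<subseteq> \<Delta> \<and> sorted_wrt (\<subset>) xs \<and> hd xs = {}"
  using empty\<Delta> unfolding chains_def lt_of_subset minimal_in_def by (cases xs) auto

lemma facet_key_inj: "inj_on (facet_key F) (\<Union>\<Delta>)"
  using key unfolding inj_on_def facet_key_def by auto

lemma facet_key_h: "facet_key F (h F) \<le> facet_key F w"
  by (simp add: facet_key_def)

lemma finite_vertices: "finite (\<Union>\<Delta>)"
proof -
  have "\<Union>\<Delta> = \<Union>(m ` \<Delta>)" using m_above m_face by auto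
  then show ?thesis using m_card fin\<Delta> by auto
qed

lemma sorted_last: "sorted_wrt (\<subset>) xs \<Longrightarrow> X \<in> set xs \<Longrightarrow> X \<subseteq> last xs"
  by (induction xs rule: rev_induct) (auto simp: sorted_wrt_append)

lemma ch_last: "xs \<in> ch n \<Longrightarrow> last xs \<in> \<Delta>"
  unfolding ch_iff by (cases xs rule: rev_cases) auto

lemma ch_Union: "xs \<in> ch n \<Longrightarrow> \<Union>(set xs) \<subseteq> \<Union>\<Delta>"
  unfolding ch_iff by blast

lemma face_match_shape:
  assumes "face_match k e v x z" "sorted_wrt (\<subset>) x"
  shows "sorted_wrt (\<subset>) z \<and> hd z = hd x \<and> length z = Suc (length x)
    \<and> (last z = last x \<or> e \<and> v \<notin> last x \<and> last z = insert v (last x))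
    \<and> (\<forall>Z\<in>set z. Z \<subseteq> last z) \<and> (\<exists>i\<ge>1. i < length z \<and> x = remove_nth i z)"
  using assms
proof (induction rule: face_match.induct)
  case (split v Y X r)
  have *: "\<And>Z. Z \<in> set r \<Longrightarrow> insert v X \<subset> Z" "\<And>Z. Z \<in> set r \<Longrightarrow> Y \<subset> Z" using split by auto
  have s: "sorted_wrt (\<subset>) (X # insert v X # Y # r)" using split * by auto
  have "X # Y # r = remove_nth 1 (X # insert v X # Y # r)" by (simp add: remove_nth_def)
  then have "\<exists>i\<ge>1. i < length (X # insert v X # Y # r) \<and> X # Y # r = remove_nth i (X # insert v X # Y # r)"
    by (intro exI[of _ 1]) simp
  then show ?case using s sorted_last[OF s] by (intro conjI) auto
next
  case (append X)
  have "[X] = remove_nth 1 [X, insert v X]" by (simp add: remove_nth_def)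
  then have "\<exists>i\<ge>1. i < length [X, insert v X] \<and> [X] = remove_nth i [X, insert v X]"
    by (intro exI[of _ 1]) simp
  then show ?case using append.hyps by (intro conjI) auto
next
  case (step Y r W t g X)
  have "sorted_wrt (\<subset>) (Y # r)" using step.prems by simp
  note IH = step.IH[OF this]
  obtain i where i: "i \<ge> 1" "i < length (Y # W # t)" "Y # r = remove_nth i (Y # W # t)"
    using IH by blast
  then have "X # Y # r = remove_nth (Suc i) (X # Y # W # t)" by (simp add: remove_nth_def)
  then have 1: "\<exists>i\<ge>1. i < length (X # Y # W # t) \<and> X # Y # r = remove_nth i (X # Y # W # t)"
    using i(2) by (intro exI[of _ "Suc i"]) auto
  have 2: "sorted_wrt (\<subset>) (X # Y # W # t)" 
  proof -
    have "sorted_wrt (\<subset>) (Y # W # t)" using IH by blast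
    moreover have "X \<subset> Y" using step.hyps(2,3) by auto
    ultimately show ?thesis by (auto dest: psubset_trans)
  qed
  have 3: "length (X # Y # W # t) = Suc (length (X # Y # r))"
    using conjunct1[OF conjunct2[OF conjunct2[OF IH]]] by simp
  have 4: "last (X # Y # W # t) = last (X # Y # r) \<or>
      e \<and> v \<notin> last (X # Y # r) \<and> last (X # Y # W # t) = insert v (last (X # Y # r))"
    using conjunct1[OF conjunct2[OF conjunct2[OF conjunct2[OF IH]]]] by (simp only: last_ConsR list.distinct simp_thms)
  show ?case using 1 2 3 4 sorted_last[OF 2] by (intro conjI ballI) (simp_all only: list.sel)
qed

lemma face_match_shape_left:
  assumes "face_match k e v x z" "sorted_wrt (\<subset>) z"
  shows "sorted_wrt (\<subset>) x"
  using assms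
proof (induction rule: face_match.induct)
  case (step Y r W t g X)
  have "sorted_wrt (\<subset>) (Y # W # t)" using step.prems by simp
  then have sYr: "sorted_wrt (\<subset>) (Y # r)" by (rule step.IH)
  have "\<forall>Z\<in>set (Y # r). X \<subset> Z"
  proof -
    have "\<forall>Z\<in>set (Y # r). Y \<subseteq> Z" using sYr by auto
    moreover have "X \<subset> Y" using step.hyps(2,3) by auto
    ultimately show ?thesis by (meson psubset_subset_trans)
  qed
  then show ?case using sYr by (simp only: sorted_wrt.simps(2)[of _ X] simp_thms)
qed auto

text \<open>The last face changes at most by \<open>h\<close>, so it stays between the old last face
  and its facet, and \<open>m_between\<close> keeps it in the same fibre.\<close>

lemma matched_right:
  assumes x: "x \<in> ch n" and M: "matched x z"
  shows "z \<in> ch (Suc n)" and "m (last z) = m (last x)"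
proof -
  let ?F = "m (last x)"
  have sx: "sorted_wrt (\<subset>) x" and lx: "length x = Suc n" "hd x = {}" "last x \<in> \<Delta>"
    using x ch_last unfolding ch_iff by auto
  note z = face_match_shape[OF M[unfolded matched_def] sx]
  have "last z = last x \<or> ?F \<noteq> F0 \<and> last z = insert (h ?F) (last x)" using z by blast
  then have lz: "last z \<subseteq> ?F" "last x \<subseteq> last z"
    using m_above[OF lx(3)] h_vertex[OF lx(3)] by (metis insert_subset subset_insertI subset_refl)+
  then show "m (last z) = ?F" using m_between lx(3) by blast
  have "last z \<in> \<Delta>" using down[OF m_face[OF lx(3)] lz(1)] .
  then show "z \<in> ch (Suc n)" using z lx down unfolding ch_iff by auto
qed

text \<open>Here the last face may lose \<open>h\<close>; \<open>h_remove\<close> keeps it in the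
  fibre. So the key and the flag taken from the larger chain are those that \<open>matched\<close>
  takes from the smaller one.\<close>

lemma face_match_left:
  assumes z: "z \<in> ch (Suc n)" and M: "face_match (facet_key (m (last z))) (m (last z) \<noteq> F0) (h (m (last z))) x z"
  shows "x \<in> ch n" and "matched x z"
proof -
  have sz: "sorted_wrt (\<subset>) z" and lz: "last z \<in> \<Delta>" and lenz: "length z = Suc (Suc n)"
    using z ch_last unfolding ch_iff by auto
  have sx: "sorted_wrt (\<subset>) x" using face_match_shape_left[OF M sz] .
  note sh = face_match_shape[OF M sx]
  obtain i where "i \<ge> 1" "i < length z" "x = remove_nth i z" using sh by blast
  then show "x \<in> ch n" using chains_remove_nth[OF z, of i] lenz by auto
  have "m (last x) = m (last z)"
  proof (cases "last z = last x")
    case False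
    then have "m (last z) \<noteq> F0 \<and> h (m (last z)) \<notin> last x \<and> last z = insert (h (m (last z))) (last x)"
      using sh by blast
    then have "last x = last z - {h (m (last z))}" "m (last z) \<noteq> F0" by blast+
    then show ?thesis using h_remove[OF lz] by simp
  qed simp
  then show "matched x z" using M by (simp add: matched_def)
qed

lemma matched_remove: 
  assumes "x \<in> ch n" "matched x z"
  shows "\<exists>i\<ge>1. i \<le> Suc n \<and> x = remove_nth i z"
proof -
  have "sorted_wrt (\<subset>) x" "length x = Suc n" using assms(1) unfolding ch_iff by auto
  then show ?thesis using face_match_shape[OF assms(2)[unfolded matched_def]] by auto
qed

lemma critical_chain:
  assumes z: "z \<in> ch n" and up: "\<nexists>z'. matched z z'" and dn: "\<nexists>x. x \<in> ch (n - 1) \<and> n > 0 \<and> matched x z"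
  shows "m (last z) = F0 \<and> last z = F0 \<and> face_critical (facet_key F0) False (h F0) z"
proof -
  let ?F = "m (last z)"
  have sz: "sorted_wrt (\<subset>) z" and lz: "last z \<in> \<Delta>" and lenz: "length z = Suc n" "hd z = {}"
    using z ch_last unfolding ch_iff by auto
  have FD: "?F \<in> \<Delta>" using m_face[OF lz] .
  have "(\<exists>zs. face_match (facet_key ?F) (?F \<noteq> F0) (h ?F) z zs) \<or> (\<exists>ys. face_match (facet_key ?F) (?F \<noteq> F0) (h ?F) ys z)
      \<or> face_critical (facet_key ?F) (?F \<noteq> F0) (h ?F) z"
  proof (rule face_match_total[where F = ?F, OF sz])
    show "z \<noteq> []" using lenz by auto
    show "\<Union>(set z) \<subseteq> ?F" using sorted_last[OF sz] m_above[OF lz] by auto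
    show "finite ?F" using m_card lz by auto
    show "inj_on (facet_key ?F) ?F" by (rule inj_on_subset[OF facet_key_inj]) (use FD in auto)
  qed (use h_vertex[OF lz] facet_key_h in auto)
  moreover have "\<not> face_match (facet_key ?F) (?F \<noteq> F0) (h ?F) ys z" for ys
  proof
    assume M: "face_match (facet_key ?F) (?F \<noteq> F0) (h ?F) ys z"
    have "n > 0" using face_match_nonempty[OF M] lenz by (cases n) auto
    then obtain n' where n: "n = Suc n'" using gr0_implies_Suc by blast
    then have "ys \<in> ch n'" "matched ys z" using face_match_left[of z n' ys] z M by auto
    then show False using dn n by auto
  qed
  ultimately have c: "face_critical (facet_key ?F) (?F \<noteq> F0) (h ?F) z"
    using up unfolding matched_def by blast
  \<comment> \<open>Over any other facet a critical chain would have \<open>h\<close> in its first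
    face, which is empty.\<close>
  have "?F = F0"
  proof (rule ccontr)
    assume "?F \<noteq> F0"
    with c show False using lenz by cases auto
  qed
  then show ?thesis using F0[OF lz] c by auto
qed

lemma critical_length:
  "face_critical k e v xs \<Longrightarrow> finite (last xs) \<Longrightarrow> card (last xs) = card (hd xs) + length xs - 1"
proof (induction rule: face_critical.induct)
  case (step Y r g X)
  have "finite X"
    using face_critical_top(1)[OF step.hyps(1) refl] step.prems step.hyps(2)
    by (auto intro: finite_subset)
  then have "card Y = Suc (card X)" using step.hyps by auto
  then show ?case using step by simp
qed simp

lemma sorted_card: "sorted_wrt (\<subset>) xs \<Longrightarrow> xs \<noteq> [] \<Longrightarrow> finite (last xs) \<Longrightarrow> length xs \<le> Suc (card (last xs))"
proof (induction xs rule: rev_induct)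
  case (snoc x xs)
  show ?case
  proof (cases "xs = []")
    case False
    then have "last xs \<subset> x" using snoc.prems by (auto simp: sorted_wrt_append)
    then have "card (last xs) < card x" "finite (last xs)"
      using snoc.prems by (auto intro: psubset_card_mono finite_subset)
    then show ?thesis using snoc False by (auto simp: sorted_wrt_append)
  qed simp
qed simp

lemma no_chains: "n > r \<Longrightarrow> ch n = {}"
proof (rule ccontr)
  assume n: "n > r" and "ch n \<noteq> {}"
  then obtain z where z: "z \<in> ch n" by auto
  note l = ch_last[OF z]
  have "card (last z) \<le> r" "finite (last z)"
    using m_above[OF l] m_card[OF l] card_mono finite_subset by metis+
  moreover have "length z \<le> Suc (card (last z))"
    by (rule sorted_card) (use z \<open>finite (last z)\<close> in \<open>auto simp: ch_iff\<close>)
  ultimately show False using z n unfolding ch_iff by auto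
qed

text \<open>The last face of \<open>x\<close> is contained in that of each coface \<open>z'\<close>.
  Hence either the weight of the facet goes up, or the facet is the same and
  \<open>face_match_acyclic\<close> yields a new inversion, while passing from \<open>x\<close> to
  its own partner adds none.\<close>

lemma acyclic_matching_chains:
  "acyclic_matching (ch n) (ch (Suc n)) (diff_sym \<Delta> (\<subseteq>) :: _ \<Rightarrow> _ \<Rightarrow> 'k::comm_ring_1)
     (\<lambda>x z. x \<in> ch n \<and> matched x z) chain_rank"
proof (unfold_locales, goal_cases)
  case (1) show ?case by (rule finite_chains[OF fin\<Delta>])
next
  case (2) show ?case by (rule finite_chains[OF fin\<Delta>])
next
  case (3 x z) then show ?case by blast
next
  case (4 x z) then show ?case using matched_right by blast
next
  case (5 x z)
  then have z: "z \<in> ch (Suc n)" using matched_right by blast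
  obtain i where "i \<ge> 1" "i \<le> Suc n" "x = remove_nth i z" using matched_remove 5 by blast
  then show ?case using diff_sym_remove[OF z, of i, where 'k='k] by (simp add: power_add[symmetric] mult_2[symmetric])
next
  case (6 x z x')
  then have "m (last x) = m (last x')" using matched_right(2)[of x n z] matched_right(2)[of x' n z] by simp
  then show ?case using 6 face_match_inj unfolding matched_def by metis
next
  case (7 x z x' z')
  let ?F = "m (last x)" and ?C = "Suc (card (\<Union>\<Delta> \<times> \<Union>\<Delta>))"
  let ?inv = "\<lambda>z. key_inv (facet_key ?F) (\<Union>\<Delta>) z"
  have z: "z \<in> ch (Suc n)" "m (last z) = ?F" and z': "z' \<in> ch (Suc n)" "m (last z') = m (last x')"
    using matched_right 7 by blast+
  obtain i where i: "1 \<le> i" "i \<le> Suc n" "remove_nth i z' = x"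
    using diff_sym_cases[of x n z', where 'k='k] 7 by blast
  have lz': "length z' = Suc (Suc n)" "sorted_wrt (\<subset>) z'" using z' unfolding ch_iff by auto
  have fin2: "finite (\<Union>\<Delta> \<times> \<Union>\<Delta>)" using finite_vertices by simp
  have bound: "card (key_inv k (\<Union>\<Delta>) y) < ?C" for k y
    by (rule le_imp_less_Suc[OF card_mono[OF fin2]]) (auto simp: key_inv_def)
  have "last x \<in> set z'" using i(3) set_remove_nth[of i z'] 7(1) unfolding ch_iff
    by (metis last_in_set length_0_conv nat.distinct(1) subsetD)
  then have "last x \<subseteq> last z'" using sorted_last lz' by blast
  then consider (eq) "m (last z') = ?F" | (lt) "wt ?F < wt (m (last z'))"
    using m_mono[of "last x" "last z'"] ch_last 7(1) z'(1) by metis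
  then show ?case
  proof cases
    case lt
    have "chain_rank z < Suc (wt ?F) * ?C" unfolding chain_rank_def z(2) using bound by simp
    also have "\<dots> \<le> wt (m (last z')) * ?C" using lt by (intro mult_right_mono) auto
    also have "\<dots> \<le> chain_rank z'" unfolding chain_rank_def by simp
    finally show ?thesis .
  next
    case eq
    have Mz: "face_match (facet_key ?F) (?F \<noteq> F0) (h ?F) x z" using 7 by (simp add: matched_def)
    have Mz': "face_match (facet_key ?F) (?F \<noteq> F0) (h ?F) x' z'" using 7 eq z'(2) by (simp add: matched_def)
    have hF: "?F \<noteq> F0 \<Longrightarrow> h ?F \<in> \<Union>\<Delta> \<and> (\<forall>w. facet_key ?F (h ?F) \<le> facet_key ?F w)"
      using h_vertex[of "last x"] m_face[of "last x"] ch_last 7(1) facet_key_h by blast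
    have kz: "key_inv (facet_key ?F) (\<Union>\<Delta>) z = key_inv (facet_key ?F) (\<Union>\<Delta>) x"
      by (rule key_inv_match[OF Mz ch_Union[OF z(1)] facet_key_inj hF])
    have "\<not> key_inv (facet_key ?F) (\<Union>\<Delta>) z' \<subseteq> key_inv (facet_key ?F) (\<Union>\<Delta>) x"
      using face_match_acyclic[OF Mz lz'(2) i(3) i(1) _ Mz' _ _ facet_key_inj] hF ch_Union z(1) z'(1) lz' i 7(3)
      by (metis Un_least less_Suc_eq_le)
    then obtain u w where uw: "(u, w) \<in> key_inv (facet_key ?F) (\<Union>\<Delta>) z'" "(u, w) \<notin> key_inv (facet_key ?F) (\<Union>\<Delta>) x" by auto
    have sub: "key_inv (facet_key ?F) (\<Union>\<Delta>) x \<subseteq> key_inv (facet_key ?F) (\<Union>\<Delta>) z'"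
      using set_remove_nth[of i z'] i unfolding key_inv_def by blast
    have "?inv x \<subset> ?inv z'" using sub uw by blast
    then have "card (?inv x) < card (?inv z')" by (intro psubset_card_mono) (rule finite_subset[OF _ fin2], auto simp: key_inv_def)
    then show ?thesis unfolding chain_rank_def z(2) eq using kz by simp
  qed
qed

text \<open>The reduction common to both degree ranges: after subtraction of \<open>b\<close>, a
  cochain vanishes on every chain that is the larger member of a pair.\<close>

lemma eliminate_matched:
  "\<exists>b\<in>coboundaries (c_check \<Delta> (\<subseteq>)) (diff \<Delta> (\<subseteq>)) n.
     (\<forall>z. z \<notin> ch n \<longrightarrow> b z = 0) \<and> diff \<Delta> (\<subseteq>) n b = (\<lambda>_. 0) \<and>
     (\<forall>z x. n > 0 \<and> x \<in> ch (n - 1) \<and> matched x z \<longrightarrow> c z = (b z :: 'k::comm_ring_1))"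
proof (cases n)
  case 0
  have "diff \<Delta> (\<subseteq>) n (\<lambda>_. 0) = (\<lambda>_. 0 :: 'k)" by (simp add: diff_apply fun_eq_iff)
  then show ?thesis using 0 by (auto simp: coboundaries_def)
next
  case (Suc n')
  interpret acyclic_matching "ch n'" "ch (Suc n')" "diff_sym \<Delta> (\<subseteq>) :: _ \<Rightarrow> _ \<Rightarrow> 'k"
    "\<lambda>x z. x \<in> ch n' \<and> matched x z" chain_rank by (rule acyclic_matching_chains)
  obtain b where b: "\<forall>x. x \<notin> ch n' \<longrightarrow> b x = 0"
    "\<And>x z. x \<in> ch n' \<Longrightarrow> matched x z \<Longrightarrow> c z = (\<Sum>x\<in>ch n'. b x * diff_sym \<Delta> (\<subseteq>) x z)"
    using eliminate[of c] by blast
  have "b \<in> c_check \<Delta> (\<subseteq>) n'" using b(1) by (simp add: c_check_def free_mod_def)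
  then have "diff \<Delta> (\<subseteq>) n' b \<in> coboundaries (c_check \<Delta> (\<subseteq>)) (diff \<Delta> (\<subseteq>)) n"
    using Suc by (auto simp: coboundaries_def)
  moreover have "diff \<Delta> (\<subseteq>) n (diff \<Delta> (\<subseteq>) n' b) = (\<lambda>_. 0)" unfolding Suc by (rule diff_diff)
  moreover have "diff \<Delta> (\<subseteq>) n' b z = 0" if "z \<notin> ch n" for z using that Suc by (simp add: diff_apply)
  moreover have "c z = diff \<Delta> (\<subseteq>) n' b z" if "x \<in> ch n'" "matched x z" for x z
    using b(2)[OF that] by (simp add: diff_def lin_ext_def)
  ultimately show ?thesis using Suc by (intro bexI[of _ "diff \<Delta> (\<subseteq>) n' b"]) auto
qed

lemma critical_degree:
  assumes "z \<in> ch n" "m (last z) = F0" "face_critical (facet_key F0) False (h F0) z"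
  shows "n = r"
proof -
  have "last z = F0" using F0 ch_last assms by auto
  then have "card (last z) = r" "finite (last z)" using m_card[OF ch_last[OF assms(1)]] assms(2) by auto
  then show ?thesis using critical_length[OF assms(3)] assms(1) unfolding ch_iff by auto
qed

text \<open>Below degree \<open>r\<close> there are no critical chains, so the reduced cocycle lives
  on the smaller members of pairs, and \<open>matched_support_trivial\<close> applies.\<close>

theorem acyclic_below:
  assumes n: "n < r" and c: "c \<in> c_check \<Delta> (\<subseteq>) n" and d: "diff \<Delta> (\<subseteq>) n c = (\<lambda>_. 0 :: 'k::comm_ring_1)"
  shows "c \<in> coboundaries (c_check \<Delta> (\<subseteq>)) (diff \<Delta> (\<subseteq>)) n"
proof -
  obtain b where b: "b \<in> coboundaries (c_check \<Delta> (\<subseteq>)) (diff \<Delta> (\<subseteq>)) n"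
    "\<And>z. z \<notin> ch n \<Longrightarrow> b z = 0" "diff \<Delta> (\<subseteq>) n b = (\<lambda>_. 0)"
    "\<And>z x. n > 0 \<Longrightarrow> x \<in> ch (n - 1) \<Longrightarrow> matched x z \<Longrightarrow> c z = b z"
    using eliminate_matched[of n c] by blast
  interpret acyclic_matching "ch n" "ch (Suc n)" "diff_sym \<Delta> (\<subseteq>) :: _ \<Rightarrow> _ \<Rightarrow> 'k"
    "\<lambda>x z. x \<in> ch n \<and> matched x z" chain_rank by (rule acyclic_matching_chains)
  have "c x - b x = 0" if x: "x \<in> ch n" for x
  proof (rule matched_support_trivial[OF _ _ x])
    fix x assume x: "x \<in> ch n" and ne: "c x - b x \<noteq> 0"
    show "\<exists>z. x \<in> ch n \<and> matched x z"
    proof (rule ccontr)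
      assume "\<nexists>z. x \<in> ch n \<and> matched x z"
      then have "\<nexists>z. matched x z" using x by blast
      moreover have "\<nexists>y. y \<in> ch (n - 1) \<and> n > 0 \<and> matched y x" using b(4)[of _ x] ne by auto
      ultimately show False using critical_chain[OF x] critical_degree[OF x] n by blast
    qed
  next
    fix z
    have "(\<Sum>x\<in>ch n. (c x - b x) * diff_sym \<Delta> (\<subseteq>) x z) = diff \<Delta> (\<subseteq>) n c z - diff \<Delta> (\<subseteq>) n b z"
      by (simp add: diff_def lin_ext_def left_diff_distrib sum_subtractf)
    then show "(\<Sum>x\<in>ch n. (c x - b x) * diff_sym \<Delta> (\<subseteq>) x z) = 0" using d b(3) by simp
  qed
  then have "c z = b z" for z using b(2)[of z] c by (cases "z \<in> ch n") (auto simp: c_check_def free_mod_def)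
  then have "c = b" by blast
  then show ?thesis using b(1) by simp
qed

text \<open>In degree \<open>r\<close> no chain is the smaller member of a pair, as there are no
  longer chains. The reduced cochain can only be nonzero on the critical chain.\<close>

theorem cyclic_top:
  "\<exists>t. \<forall>c\<in>c_check \<Delta> (\<subseteq>) r. \<exists>b\<in>coboundaries (c_check \<Delta> (\<subseteq>)) (diff \<Delta> (\<subseteq>)) r. \<exists>a.
     c = (\<lambda>z. a * symb t z + (b z :: 'k::comm_ring_1))"
proof -
  let ?crit = "\<lambda>z. z \<in> ch r \<and> last z = F0 \<and> face_critical (facet_key F0) False (h F0) z"
  have uniq: "z = z'" if "?crit z" "?crit z'" for z z'
  proof (rule face_critical_unique)
    show "hd z = hd z'" using that unfolding ch_iff by auto
    show "last z \<subseteq> \<Union>\<Delta>" using that ch_last by auto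
  qed (use that facet_key_inj in auto)
  \<comment> \<open>Only uniqueness of the critical chain enters: the claim bounds the number of
    generators by one and says nothing about the class of \<open>t\<close>.\<close>
  define t where "t = (SOME z. ?crit z)"
  have t: "?crit z \<Longrightarrow> z = t" for z using uniq someI[of ?crit z] unfolding t_def by blast
  have "\<exists>b\<in>coboundaries (c_check \<Delta> (\<subseteq>)) (diff \<Delta> (\<subseteq>)) r. \<exists>a. c = (\<lambda>z. a * symb t z + b z)"
    if c: "c \<in> c_check \<Delta> (\<subseteq>) r" for c :: "_ \<Rightarrow> 'k"
  proof -
    obtain b where b: "b \<in> coboundaries (c_check \<Delta> (\<subseteq>)) (diff \<Delta> (\<subseteq>)) r"
      "\<And>z. z \<notin> ch r \<Longrightarrow> b z = 0"
      "\<And>z x. r > 0 \<Longrightarrow> x \<in> ch (r - 1) \<Longrightarrow> matched x z \<Longrightarrow> c z = b z"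
      using eliminate_matched[of r c] by blast
    have "c z - b z = (c t - b t) * symb t z" for z
    proof (cases "z = t")
      case False
      have "c z - b z = 0"
      proof (rule ccontr)
        assume ne: "c z - b z \<noteq> 0"
        then have z: "z \<in> ch r" using b(2)[of z] c unfolding c_check_def free_mod_def by fastforce
        have "\<not> matched z z'" for z'
        proof
          assume M: "matched z z'"
          have "z' \<in> ch (Suc r)" using matched_right[OF z M] by blast
          then show False using no_chains[of "Suc r"] by auto
        qed
        moreover have "\<nexists>y. y \<in> ch (r - 1) \<and> r > 0 \<and> matched y z" using b(3)[of _ z] ne by auto
        ultimately show False using critical_chain[OF z] t[of z] z False by blast
      qed
      then show ?thesis using False by (simp add: symb_def)
    qed (simp add: symb_def)
    then have "c = (\<lambda>z. (c t - b t) * symb t z + b z)" by (auto simp: fun_eq_iff algebra_simps)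
    then show ?thesis using b(1) by blast
  qed
  then show ?thesis by blast
qed

end

section \<open>Ordered partitions as flags\<close>

text \<open>The empty union and the whole set are left out, so that \<open>[S]\<close> becomes the
  empty face.\<close>

definition cuts :: "'a set list \<Rightarrow> 'a set set" where
  "cuts x = (\<lambda>i. \<Union>(set (take i x))) ` {0<..<length x}"

lemma cuts_Nil [simp]: "cuts [] = {}" and cuts_single [simp]: "cuts [B] = {}"
  by (auto simp: cuts_def)

lemma cuts_Cons: "y \<noteq> [] \<Longrightarrow> cuts (B # y) = insert B ((\<union>) B ` cuts y)"
proof -
  assume "y \<noteq> []"
  then have n: "0 < length y" by simp
  have "{0<..<length (B # y)} = insert 1 (Suc ` {0<..<length y})"
  proof (rule set_eqI)
    fix i show "i \<in> {0<..<length (B # y)} \<longleftrightarrow> i \<in> insert 1 (Suc ` {0<..<length y})"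
      using n by (cases i) auto
  qed
  then show ?thesis by (auto simp: cuts_def image_image)
qed

lemma cuts_take: "0 < i \<Longrightarrow> i < length x \<Longrightarrow> \<Union>(set (take i x)) \<in> cuts x"
  by (auto simp: cuts_def)

lemma cutsE:
  assumes "U \<in> cuts x"
  obtains i where "0 < i" "i < length x" "U = \<Union>(set (take i x))"
  using assms by (auto simp: cuts_def)

lemma Union_take_mono: "i \<le> j \<Longrightarrow> \<Union>(set (take i x)) \<subseteq> \<Union>(set (take j x))"
  by (rule Union_mono) (rule set_take_subset_set_take)

lemma cuts_chain: "U \<in> cuts x \<Longrightarrow> V \<in> cuts x \<Longrightarrow> U \<subseteq> V \<or> V \<subseteq> U"
  by (elim cutsE) (metis Union_take_mono nat_le_linear)

lemma as_part_Nil: "[] \<in> as_part S \<longleftrightarrow> S = {}"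
  by (auto simp: as_part_def partition_on_def)

lemma as_part_Cons: "B # x \<in> as_part S \<longleftrightarrow> B \<noteq> {} \<and> B \<subseteq> S \<and> x \<in> as_part (S - B)"
proof
  assume "B # x \<in> as_part S"
  then have *: "distinct x" "B \<notin> set x" "\<Union>(set (B # x)) = S" "disjoint (insert B (set x))" "{} \<notin> set (B # x)"
    by (auto simp: as_part_def partition_on_def)
  have d: "disjoint (set x)" "\<forall>C\<in>set x. B \<inter> C = {}" using *(2,4) by (auto simp: disjoint_def)
  then have "\<Union>(set x) = S - B" using *(3) by auto
  then show "B \<noteq> {} \<and> B \<subseteq> S \<and> x \<in> as_part (S - B)"
    using * d by (auto simp: as_part_def partition_on_def)
next
  assume A: "B \<noteq> {} \<and> B \<subseteq> S \<and> x \<in> as_part (S - B)"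
  then have *: "distinct x" "\<Union>(set x) = S - B" "disjoint (set x)" "{} \<notin> set x"
    by (auto simp: as_part_def partition_on_def)
  have "\<forall>C\<in>set x. B \<inter> C = {}" using *(2) by auto
  moreover have "B \<notin> set x" using *(2) A by auto
  moreover have "\<Union>(set (B # x)) = S" using *(2) A by auto
  ultimately show "B # x \<in> as_part S"
    using * A by (auto simp: as_part_def partition_on_def disjoint_def)
qed

lemma as_part_empty: "x \<in> as_part {} \<longleftrightarrow> x = []"
  by (cases x) (auto simp: as_part_Cons as_part_Nil)

lemma as_part_append:
  "x @ y \<in> as_part S \<longleftrightarrow> \<Union>(set x) \<subseteq> S \<and> x \<in> as_part (\<Union>(set x)) \<and> y \<in> as_part (S - \<Union>(set x))"
proof (induction x arbitrary: S)
  case (Cons B x)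
  have 1: "S - B - \<Union>(set x) = S - \<Union>(set (B # x))" by auto
  show ?case
  proof (cases "B \<inter> \<Union>(set x) = {}")
    case True
    then have "\<Union>(set (B # x)) - B = \<Union>(set x)" by auto
    then show ?thesis using True Cons.IH[of "S - B"] 1 by (auto simp: as_part_Cons)
  next
    case False
    have "\<not> (x \<in> as_part (\<Union>(set (B # x)) - B))" using False by (auto simp: as_part_def partition_on_def)
    moreover have "\<not> \<Union>(set x) \<subseteq> S - B" using False by auto
    ultimately show ?thesis using Cons.IH[of "S - B"] by (auto simp: as_part_Cons)
  qed
qed (simp add: as_part_Nil)

lemma as_part_Union: "x \<in> as_part S \<Longrightarrow> \<Union>(set x) = S"
  by (auto simp: as_part_def partition_on_def)

lemma as_part_nonempty: "x \<in> as_part S \<Longrightarrow> B \<in> set x \<Longrightarrow> B \<noteq> {}"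
  by (auto simp: as_part_def partition_on_def)

lemma finite_as_part: "finite S \<Longrightarrow> finite (as_part S)"
  by (rule finite_subset[OF _ finite_subset_distinct[of "Pow S"]])
    (auto simp: as_part_def partition_on_def)

lemma cuts_bounds: "x \<in> as_part S \<Longrightarrow> U \<in> cuts x \<Longrightarrow> U \<noteq> {} \<and> U \<subset> S"
proof (induction x arbitrary: S U)
  case (Cons B x)
  show ?case
  proof (cases "x = []")
    case False
    have B: "B \<noteq> {}" "B \<subseteq> S" "x \<in> as_part (S - B)" using Cons.prems(1) by (auto simp: as_part_Cons)
    have "S - B \<noteq> {}" using B(3) False as_part_empty by metis
    then show ?thesis using Cons.prems(2) Cons.IH[OF B(3)] B False unfolding cuts_Cons[OF False] by blast
  qed (use Cons in auto)
qed auto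

lemma card_cuts: "x \<in> as_part S \<Longrightarrow> finite (cuts x) \<and> card (cuts x) = length x - 1"
proof (induction x arbitrary: S)
  case (Cons B x)
  show ?case
  proof (cases "x = []")
    case False
    have B: "B \<noteq> {}" "B \<subseteq> S" "x \<in> as_part (S - B)" using Cons.prems(1) by (auto simp: as_part_Cons)
    have b: "U \<noteq> {} \<and> U \<inter> B = {}" if "U \<in> cuts x" for U using cuts_bounds[OF B(3) that] by auto
    have "inj_on ((\<union>) B) (cuts x)" by (rule inj_onI) (use b in blast)
    then have "card ((\<union>) B ` cuts x) = length x - 1" using Cons.IH[OF B(3)] by (simp add: card_image)
    moreover have "B \<notin> (\<union>) B ` cuts x" using b by blast
    ultimately show ?thesis using Cons.IH[OF B(3)] False by (simp add: cuts_Cons card_insert_if Suc_leI)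
  qed simp
qed simp

lemma as_le_imp_cuts: "as_le x y \<Longrightarrow> cuts x \<subseteq> cuts y"
proof -
  assume "as_le x y"
  then obtain yss where y: "[] \<notin> set yss" "y = concat yss" "x = map (\<lambda>ys. \<Union>(set ys)) yss"
    by (auto simp: as_le_def)
  show "cuts x \<subseteq> cuts y"
    unfolding y(2,3) using y(1)
  proof (induction yss)
    case (Cons ys yss)
    show ?case
    proof (cases "yss = []")
      case False
      have ne: "map (\<lambda>ys. \<Union>(set ys)) yss \<noteq> []" "concat yss \<noteq> []" using Cons.prems False by (cases yss; auto)+
      have IH: "cuts (map (\<lambda>ys. \<Union>(set ys)) yss) \<subseteq> cuts (concat yss)" using Cons by auto
      have "\<Union>(set ys) \<in> cuts (ys @ concat yss)"
        using cuts_take[of "length ys" "ys @ concat yss"] Cons.prems ne(2) by auto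
      moreover have "\<Union>(set ys) \<union> U \<in> cuts (ys @ concat yss)" if U: "U \<in> cuts (concat yss)" for U
      proof -
        obtain i where "0 < i" "i < length (concat yss)" "U = \<Union>(set (take i (concat yss)))"
          using U by (rule cutsE)
        then show ?thesis using cuts_take[of "length ys + i" "ys @ concat yss"] by simp
      qed
      ultimately show ?thesis using IH by (auto simp: cuts_Cons[OF ne(1)])
    qed simp
  qed simp
qed

text \<open>The first block \<open>B\<close> of \<open>x\<close> is a cut of \<open>y\<close>, hence
  the union of an initial segment of \<open>y\<close>. The later cuts of \<open>x\<close> contain
  \<open>B\<close>; with \<open>B\<close> removed they are cuts of the rest of \<open>y\<close>, to
  which induction applies.\<close>

lemma cuts_imp_as_le: "x \<in> as_part S \<Longrightarrow> y \<in> as_part S \<Longrightarrow> cuts x \<subseteq> cuts y \<Longrightarrow> as_le x y"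
proof (induction x arbitrary: S y)
  case Nil
  then have "y = []" using as_part_Union as_part_nonempty by (cases y) (auto simp: as_part_Nil as_part_Cons)
  then show ?case by (auto simp: as_le_def intro!: exI[of _ "[]"])
next
  case (Cons B x)
  have B: "B \<noteq> {}" "B \<subseteq> S" "x \<in> as_part (S - B)" using Cons.prems(1) by (auto simp: as_part_Cons)
  have Un: "\<Union>(set y) = S" using Cons.prems(2) as_part_Union by blast
  show ?case
  proof (cases "x = []")
    case True
    then have "B = S" using B by (auto simp: as_part_Nil)
    then show ?thesis using True Un B by (auto simp: as_le_def intro!: exI[of _ "[y]"])
  next
    case False
    then have "B \<in> cuts y" using Cons.prems(3) by (auto simp: cuts_Cons)
    then obtain i where i: "0 < i" "i < length y" "B = \<Union>(set (take i y))" by (auto simp: cuts_def)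
    have yi: "take i y @ drop i y \<in> as_part S" using Cons.prems(2) by simp
    then have d: "drop i y \<in> as_part (S - B)" unfolding as_part_append i(3) by blast
    have "cuts x \<subseteq> cuts (drop i y)"
    proof
      fix U assume U: "U \<in> cuts x"
      then have Ub: "U \<noteq> {}" "U \<inter> B = {}" using cuts_bounds[OF B(3)] by auto
      have "B \<union> U \<in> cuts y" using U Cons.prems(3) False by (auto simp: cuts_Cons)
      then obtain j where j: "0 < j" "j < length y" "B \<union> U = \<Union>(set (take j y))" by (auto simp: cuts_def)
      have "\<not> j \<le> i"
      proof
        assume "j \<le> i"
        then have "B \<union> U \<subseteq> B" unfolding j(3) unfolding i(3) by (rule Union_take_mono)
        then show False using Ub by auto
      qed
      then have ij: "i < j" by simp
      have "take j y = take i y @ take (j - i) (drop i y)"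
        using ij by (metis less_imp_le take_add le_add_diff_inverse)
      then have "B \<union> U = B \<union> \<Union>(set (take (j - i) (drop i y)))" using j(3) i(3) by auto
      moreover have "\<Union>(set (take (j - i) (drop i y))) \<inter> B = {}"
        using as_part_Union[OF d] by (auto dest!: in_set_takeD)
      ultimately have "U = \<Union>(set (take (j - i) (drop i y)))" using Ub by blast
      then show "U \<in> cuts (drop i y)" using cuts_take[of "j - i" "drop i y"] ij j by auto
    qed
    then have "as_le x (drop i y)" using Cons.IH[OF B(3) d] by blast
    then obtain yss where yss: "[] \<notin> set yss" "drop i y = concat yss" "x = map (\<lambda>ys. \<Union>(set ys)) yss"
      by (auto simp: as_le_def)
    have "y = concat (take i y # yss)" using yss(2) by (metis append_take_drop_id concat.simps(2))
    then show ?thesis unfolding as_le_def using yss i by (intro exI[of _ "take i y # yss"]) auto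
  qed
qed

lemma as_le_iff: "x \<in> as_part S \<Longrightarrow> y \<in> as_part S \<Longrightarrow> as_le x y \<longleftrightarrow> cuts x \<subseteq> cuts y"
  using as_le_imp_cuts cuts_imp_as_le by blast

lemma length_concat_ge: "[] \<notin> set yss \<Longrightarrow> length yss \<le> length (concat yss)"
proof (induction yss)
  case (Cons a yss)
  then show ?case by (cases a) auto
qed simp

lemma as_le_length: "as_le x y \<Longrightarrow> length x \<le> length y"
  using length_concat_ge by (auto simp: as_le_def)

lemma as_le_length_eq: 
  assumes "as_le x y" "length x = length y"
  shows "x = y"
proof -
  obtain yss where y: "[] \<notin> set yss" "y = concat yss" "x = map (\<lambda>ys. \<Union>(set ys)) yss"
    using assms by (auto simp: as_le_def)
  have "map (\<lambda>ys. \<Union>(set ys)) yss = concat yss"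
    using y(1) assms(2)[unfolded y]
  proof (induction yss)
    case (Cons ys yss)
    have "length yss \<le> length (concat yss)" "length ys \<ge> 1"
      using Cons.prems length_concat_ge[of yss] by (auto simp: Suc_le_eq)
    then have "length ys = 1" "length yss = length (concat yss)" using Cons.prems by auto
    then show ?case using Cons by (auto simp: length_Suc_conv)
  qed simp
  then show ?thesis using y by simp
qed

lemma cuts_inj: "x \<in> as_part S \<Longrightarrow> y \<in> as_part S \<Longrightarrow> cuts x = cuts y \<Longrightarrow> x = y"
  using cuts_imp_as_le as_le_length as_le_length_eq by (metis le_antisym order_refl)

lemma as_le_refl: "as_le x x"
  by (auto simp: as_le_def o_def intro!: exI[of _ "map (\<lambda>B. [B]) x"])

lemma finite_order_as_part: "finite S \<Longrightarrow> finite_order (as_part S) as_le"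
  by unfold_locales
    (auto simp: finite_as_part as_le_iff[of _ S] intro: cuts_inj)

text \<open>Forgetting a cut merges two neighbouring blocks, so the sets of cuts form a simplicial
  complex. The induction hypothesis provides the tail with the prescribed cuts beyond
  \<open>B\<close>; if the cut \<open>B\<close> itself is to go, \<open>B\<close> is merged with the
  first block of that tail.\<close>

lemma cuts_down:
  assumes "y \<in> as_part S" "X \<subseteq> cuts y" "S \<noteq> {}"
  shows "\<exists>x\<in>as_part S. cuts x = X"
  using assms
proof (induction y arbitrary: S X)
  case (Cons B y)
  have B: "B \<noteq> {}" "B \<subseteq> S" "y \<in> as_part (S - B)" using Cons.prems(1) by (auto simp: as_part_Cons)
  show ?case
  proof (cases "y = []")
    case True
    then show ?thesis using Cons.prems by (intro bexI[of _ "[B]"]) auto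
  next
    case False
    have ne: "S - B \<noteq> {}" using B(3) False as_part_empty by metis
    let ?X = "{U \<in> cuts y. B \<union> U \<in> X}"
    obtain x where x: "x \<in> as_part (S - B)" "cuts x = ?X" using Cons.IH[OF B(3), of ?X] ne by auto
    have xne: "x \<noteq> []" using x(1) ne by (auto simp: as_part_Nil)
    have "B \<union> U \<noteq> B" if "U \<in> cuts y" for U using cuts_bounds[OF B(3) that] by blast
    then have img: "(\<union>) B ` ?X = X - {B}"
      using Cons.prems(2) unfolding cuts_Cons[OF False] by auto
    show ?thesis
    proof (cases "B \<in> X")
      case True
      then have "cuts (B # x) = X" using img x(2) xne by (auto simp: cuts_Cons)
      then show ?thesis using x B by (intro bexI[of _ "B # x"]) (auto simp: as_part_Cons)
    next
      case nB: False
      obtain C x' where C: "x = C # x'" using xne by (cases x) auto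
      have "(\<union>) B ` cuts (C # x') = cuts ((B \<union> C) # x')"
        by (cases "x' = []") (auto simp: cuts_Cons image_iff Un_assoc)
      then have "cuts ((B \<union> C) # x') = X" using img x(2) C nB by auto
      moreover have "(B \<union> C) # x' \<in> as_part S"
        using x(1) B unfolding C as_part_Cons by (auto simp: Diff_Diff_Int Un_commute Diff_Un[symmetric] set_diff_eq Collect_conj_eq cong: conj_cong) 
      ultimately show ?thesis by blast
    qed
  qed
qed (simp add: as_part_Nil)

lemma minimal_as_part: 
  assumes "S \<noteq> {}"
  shows "minimal_in (as_part S) as_le x \<longleftrightarrow> x = [S]"
proof -
  have S: "[S] \<in> as_part S" using assms by (simp add: as_part_Cons as_part_Nil)
  have le: "as_le [S] y" if "y \<in> as_part S" for y using cuts_imp_as_le[OF S that] by simp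
  have "y = [S]" if "y \<in> as_part S" "as_le y [S]" for y
    using as_le_imp_cuts[OF that(2)] by (intro cuts_inj[OF that(1) S]) simp
  then show ?thesis using S le unfolding minimal_in_def by metis
qed

lemma length_as_part: "x \<in> as_part S \<Longrightarrow> finite S \<Longrightarrow> length x \<le> card S"
proof (induction x arbitrary: S)
  case (Cons B x)
  then have B: "B \<noteq> {}" "B \<subseteq> S" "x \<in> as_part (S - B)" by (auto simp: as_part_Cons)
  then have "length x \<le> card S - card B" "card B > 0" "card B \<le> card S"
    using Cons.IH[OF B(3)] Cons.prems card_Diff_subset[of B S] by (auto simp: finite_subset card_gt_0_iff card_mono)
  then show ?case by simp
qed simp

section \<open>The shelling by sorted permutations\<close>

definition singles :: "'a list \<Rightarrow> 'a set list" where
  "singles l = map (\<lambda>a. {a}) l"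

definition sort_blocks :: "nat set list \<Rightarrow> nat list" where
  "sort_blocks x = concat (map sorted_list_of_set x)"

text \<open>For the flag of a permutation these are its inversions; for a coarser flag, the pairs
  that the order of the blocks already forces to be inverted.\<close>

definition inversions :: "nat set \<Rightarrow> nat set set \<Rightarrow> (nat \<times> nat) set" where
  "inversions S X = {(a, b). a \<in> S \<and> b \<in> S \<and> a < b \<and> (\<exists>U\<in>X. b \<in> U \<and> a \<notin> U)}"

fun before :: "'a list \<Rightarrow> ('a \<times> 'a) set" where
  "before [] = {}"
| "before (a # l) = {a} \<times> set l \<union> before l"

lemma before_append: "before (l @ l') = before l \<union> before l' \<union> set l \<times> set l'"
  by (induction l) auto

lemma before_set: "before l \<subseteq> set l \<times> set l"
  by (induction l) auto

lemma singles_as_part: "distinct l \<Longrightarrow> singles l \<in> as_part (set l)"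
proof (induction l)
  case (Cons a l)
  then have "set (a # l) - {a} = set l" by auto
  then show ?case using Cons by (auto simp: singles_def as_part_Cons)
qed (simp add: singles_def as_part_Nil)

lemma singles_Nil [simp]: "singles l = [] \<longleftrightarrow> l = []"
  by (simp add: singles_def)

lemma length_singles [simp]: "length (singles l) = length l"
  by (simp add: singles_def)

lemma before_iff_cut:
  "distinct l \<Longrightarrow> (b, a) \<in> before l \<longleftrightarrow> a \<in> set l \<and> (\<exists>U\<in>cuts (singles l). b \<in> U \<and> a \<notin> U)"
proof (induction l)
  case (Cons c l)
  show ?case
  proof (cases "l = []")
    case False
    then have *: "cuts (singles (c # l)) = insert {c} (insert c ` cuts (singles l))"
      using cuts_Cons[of "singles l" "{c}"] by (simp add: singles_def)
    have "U \<subseteq> set l" if "U \<in> cuts (singles l)" for U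
      using cuts_bounds[OF singles_as_part that] Cons.prems by auto
    then show ?thesis unfolding * using Cons before_set[of l] by auto
  qed (auto simp: singles_def)
qed auto

lemma before_antisym: "distinct l \<Longrightarrow> (a, b) \<in> before l \<Longrightarrow> (b, a) \<notin> before l"
  by (induction l) (auto dest: subsetD[OF before_set])

lemma before_total: "a \<in> set l \<Longrightarrow> b \<in> set l \<Longrightarrow> a \<noteq> b \<Longrightarrow> (a, b) \<in> before l \<or> (b, a) \<in> before l"
  by (induction l) auto

lemma before_irrefl: "distinct l \<Longrightarrow> (a, a) \<notin> before l"
  using before_antisym[of l a a] by auto

lemma before_determines: "distinct l \<Longrightarrow> distinct l' \<Longrightarrow> set l = set l' \<Longrightarrow> before l = before l' \<Longrightarrow> l = l'"
proof (induction l arbitrary: l')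
  case (Cons a l)
  obtain b k where l': "l' = b # k" using Cons.prems(3) by (cases l') auto
  have ab: "a = b"
  proof (rule ccontr)
    assume "a \<noteq> b"
    then have "b \<in> set l" "a \<in> set k" using Cons.prems(3) l' by auto
    then have "(a, b) \<in> before (a # l)" "(b, a) \<in> before l'" using l' by auto
    then show False using Cons.prems before_antisym by metis
  qed
  have "before l = before (a # l) \<inter> set l \<times> set l" using before_set[of l] Cons.prems(1) by auto
  moreover have "before k = before (b # k) \<inter> set k \<times> set k" using before_set[of k] Cons.prems(2) l' by auto
  moreover have "set l = set k" using Cons.prems l' ab by auto
  ultimately have "l = k" using Cons.prems l' by (intro Cons.IH) auto
  then show ?case using l' ab by simp
qed simp

lemma inversions_singles:
  assumes "l \<in> lin_orders S"
  shows "inversions S (cuts (singles l)) = {(a, b). a < b \<and> (b, a) \<in> before l}"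
  using assms before_iff_cut[of l] before_set[of l] unfolding inversions_def lin_orders_def by auto

lemma inversions_determine:
  assumes l: "l \<in> lin_orders S" "l' \<in> lin_orders S"
    and e: "inversions S (cuts (singles l)) = inversions S (cuts (singles l'))"
  shows "l = l'"
proof -
  have d: "distinct l" "set l = S" "distinct l'" "set l' = S" using l by (auto simp: lin_orders_def)
  have i: "a < b \<Longrightarrow> (b, a) \<in> before l \<longleftrightarrow> (b, a) \<in> before l'" for a b
    using e unfolding inversions_singles[OF l(1)] inversions_singles[OF l(2)] by auto
  have "(b, a) \<in> before l \<longleftrightarrow> (b, a) \<in> before l'" for a b
  proof -
    consider "a < b" | "a = b" | "b < a" by linarith
    then show ?thesis
    proof cases
      case 2 then show ?thesis using before_irrefl d by metis
    next
      case 3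
      then have "(a, b) \<in> before l \<longleftrightarrow> (a, b) \<in> before l'" using i by blast
      then show ?thesis using before_antisym before_total before_set d 3
        by (metis less_irrefl mem_Sigma_iff subsetD)
    qed (use i in blast)
  qed
  then have "before l = before l'" by auto
  then show ?thesis using before_determines d by metis
qed

lemma sort_blocks_lin: "x \<in> as_part S \<Longrightarrow> finite S \<Longrightarrow> sort_blocks x \<in> lin_orders S"
proof (induction x arbitrary: S)
  case (Cons B x)
  then have B: "B \<noteq> {}" "B \<subseteq> S" "x \<in> as_part (S - B)" by (auto simp: as_part_Cons)
  have "finite B" using B Cons.prems by (auto intro: finite_subset)
  then show ?case using Cons.IH[OF B(3)] B Cons.prems by (auto simp: sort_blocks_def lin_orders_def)
qed (simp add: sort_blocks_def lin_orders_def as_part_Nil)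

lemma as_le_sort_blocks: "x \<in> as_part S \<Longrightarrow> finite S \<Longrightarrow> as_le x (singles (sort_blocks x))"
  unfolding as_le_def
proof (intro exI[of _ "map (\<lambda>B. singles (sorted_list_of_set B)) x"] conjI)
  assume x: "x \<in> as_part S" "finite S"
  have f: "finite B" "B \<noteq> {}" if "B \<in> set x" for B
    using that x as_part_Union[OF x(1)] as_part_nonempty[OF x(1)] by (auto intro: finite_subset)
  then show "[] \<notin> set (map (\<lambda>B. singles (sorted_list_of_set B)) x)"
    by (auto simp: image_iff singles_def)
  show "singles (sort_blocks x) = concat (map (\<lambda>B. singles (sorted_list_of_set B)) x)"
    by (simp add: singles_def sort_blocks_def map_concat o_def)
  show "x = map (\<lambda>ys. \<Union> (set ys)) (map (\<lambda>B. singles (sorted_list_of_set B)) x)"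
    using f by (auto simp: singles_def o_def intro!: map_idI[symmetric])
qed

lemma before_sorted: "sorted_wrt (<) (l :: nat list) \<Longrightarrow> (b, a) \<in> before l \<Longrightarrow> b < a"
  by (induction l) auto

lemma before_sort_blocks:
  "x \<in> as_part S \<Longrightarrow> finite S \<Longrightarrow> (b, a) \<in> before (sort_blocks x) \<Longrightarrow> a < b \<Longrightarrow> \<exists>U\<in>cuts x. b \<in> U \<and> a \<notin> U"
proof (induction x arbitrary: S)
  case (Cons B x)
  then have B: "B \<noteq> {}" "B \<subseteq> S" "x \<in> as_part (S - B)" by (auto simp: as_part_Cons)
  have "finite B" using B Cons.prems by (auto intro: finite_subset)
  have sx: "set (sort_blocks x) = S - B" using sort_blocks_lin[OF B(3)] Cons.prems by (auto simp: lin_orders_def)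
  have "(b, a) \<in> before (sorted_list_of_set B) \<or> (b, a) \<in> before (sort_blocks x) \<or> b \<in> B \<and> a \<in> S - B"
    using Cons.prems(3) sx \<open>finite B\<close> by (auto simp: sort_blocks_def before_append)
  then consider "(b, a) \<in> before (sort_blocks x)" | "b \<in> B" "a \<in> S - B"
    using before_sorted[of "sorted_list_of_set B" b a] Cons.prems(4) by auto
  then show ?case
  proof cases
    case 1
    then obtain U where U: "U \<in> cuts x" "b \<in> U" "a \<notin> U" using Cons.IH[OF B(3)] Cons.prems by auto
    have "x \<noteq> []" using U by auto
    moreover have "a \<notin> B" using 1 before_set[of "sort_blocks x"] sx by auto
    ultimately show ?thesis using U by (auto simp: cuts_Cons)
  next
    case 2
    then have "x \<noteq> []" using sx by (auto simp: sort_blocks_def)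
    then show ?thesis using 2 by (auto simp: cuts_Cons)
  qed
qed (simp add: sort_blocks_def)

lemma inversions_mono: "X \<subseteq> Y \<Longrightarrow> inversions S X \<subseteq> inversions S Y"
  by (auto simp: inversions_def)

text \<open>Sorting inside a block creates no inversion, so passing to the facet preserves the
  inversion set. As this set determines a permutation, two faces lie in the same fibre exactly when
  their inversion sets agree.\<close>

lemma inversions_sort_blocks:
  assumes x: "x \<in> as_part S" "finite S"
  shows "inversions S (cuts (singles (sort_blocks x))) = inversions S (cuts x)"
proof
  show "inversions S (cuts x) \<subseteq> inversions S (cuts (singles (sort_blocks x)))"
    by (rule inversions_mono[OF as_le_imp_cuts[OF as_le_sort_blocks[OF x]]])
  show "inversions S (cuts (singles (sort_blocks x))) \<subseteq> inversions S (cuts x)"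
    unfolding inversions_singles[OF sort_blocks_lin[OF x]]
    using before_sort_blocks[OF x] before_set[of "sort_blocks x"] sort_blocks_lin[OF x]
    by (fastforce simp: inversions_def lin_orders_def)
qed

lemma cuts_singlesE:
  assumes "U \<in> cuts (singles l)"
  obtains l1 p q l2 where "l = l1 @ p # q # l2" "U = insert p (set l1)"
proof -
  obtain i where i: "0 < i" "i < length l" "U = \<Union>(set (take i (singles l)))"
    using assms by (elim cutsE) simp
  have U: "U = set (take i l)" using i(3) by (auto simp: singles_def take_map)
  have "l = take (i - 1) l @ l ! (i - 1) # l ! i # drop (Suc i) l"
    using i by (metis Cons_nth_drop_Suc One_nat_def Suc_diff_1 append_take_drop_id less_imp_diff_less)
  moreover have "take i l = take (i - 1) l @ [l ! (i - 1)]"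
    using i by (metis Suc_diff_1 less_imp_diff_less take_Suc_conv_app_nth)
  ultimately show ?thesis using that U by (metis Un_insert_right empty_set list.simps(15) set_append sup_bot.right_neutral)
qed

lemma cut_singles: "insert p (set l1) \<in> cuts (singles (l1 @ p # q # l2))"
proof -
  have "\<Union>(set (take (Suc (length l1)) (singles (l1 @ p # q # l2)))) = insert p (set l1)"
    by (auto simp: singles_def)
  then show ?thesis using cuts_take[of "Suc (length l1)" "singles (l1 @ p # q # l2)"] by simp
qed

lemma cut_downclosed:
  assumes "distinct l" "U \<in> cuts (singles l)" "(a, b) \<in> before l" "b \<in> U"
  shows "a \<in> U"
proof (rule ccontr)
  assume "a \<notin> U"
  moreover have "a \<in> set l" using assms(3) before_set[of l] by auto
  ultimately have "(b, a) \<in> before l"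
    using assms(1,2,4) by (auto simp: before_iff_cut)
  then show False using assms before_antisym by metis
qed

text \<open>At an ascent \<open>p < q\<close> the cut after \<open>p\<close> is redundant. Suppose
  that it separates \<open>b\<close> from a later \<open>a < b\<close>. If \<open>p < b\<close>, the
  inversion of \<open>b\<close> and \<open>p\<close> is witnessed by a smaller cut, which still
  misses \<open>a\<close>. Otherwise \<open>a < q\<close>, and the inversion of \<open>q\<close> and
  \<open>a\<close> is witnessed by a larger cut, which still contains \<open>b\<close>.\<close>

lemma inversions_remove_ascent:
  assumes l: "l \<in> lin_orders S" "l = l1 @ p # q # l2" and pq: "p < q"
    and X: "X \<subseteq> cuts (singles l)" "inversions S X = inversions S (cuts (singles l))"
  shows "inversions S (X - {insert p (set l1)}) = inversions S X"
proof
  let ?h = "insert p (set l1)"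
  have d: "distinct l" "set l = S" using l by (auto simp: lin_orders_def)
  have inv: "inversions S X = {(a, b). a < b \<and> (b, a) \<in> before l}" using X inversions_singles[OF l(1)] by simp
  have hF: "?h \<in> cuts (singles l)" using cut_singles l(2) by metis
  show "inversions S X \<subseteq> inversions S (X - {?h})"
  proof
    fix ab assume "ab \<in> inversions S X"
    then obtain a b U where ab: "ab = (a, b)" "a \<in> S" "b \<in> S" "a < b" "U \<in> X" "b \<in> U" "a \<notin> U"
      by (auto simp: inversions_def)
    show "ab \<in> inversions S (X - {?h})"
    proof (cases "U = ?h")
      case True
      have aq: "a = q \<or> a \<in> set l2" using ab True l(2) d by auto
      have "\<exists>V\<in>X - {?h}. b \<in> V \<and> a \<notin> V"
      proof (cases "p < b")
        case True
        then have "b \<in> set l1" using ab \<open>U = ?h\<close> by auto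
        then have "(p, b) \<in> inversions S X" using True inv l(2) by (auto simp: before_append)
        then obtain V where V: "V \<in> X" "b \<in> V" "p \<notin> V" by (auto simp: inversions_def)
        then have "V \<noteq> ?h" by auto
        have "V \<subseteq> ?h" using cuts_chain[OF hF, of V] V X(1) by auto
        then have "a \<notin> V" using ab \<open>U = ?h\<close> by auto
        then show ?thesis using V \<open>V \<noteq> ?h\<close> by auto
      next
        case False
        then have "a < q" using ab pq by simp
        then have "a \<in> set l2" using aq by auto
        then have "(a, q) \<in> inversions S X" using \<open>a < q\<close> inv l(2) by (auto simp: before_append)
        then obtain V where V: "V \<in> X" "q \<in> V" "a \<notin> V" by (auto simp: inversions_def)
        have "q \<notin> ?h" using d l(2) by auto
        then have "V \<noteq> ?h" "?h \<subseteq> V" using V cuts_chain[OF hF, of V] X(1) by auto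
        then show ?thesis using V ab \<open>U = ?h\<close> by auto
      qed
      then show ?thesis using ab by (auto simp: inversions_def)
    qed (use ab in \<open>auto simp: inversions_def\<close>)
  qed
qed (rule inversions_mono, auto)

lemma lin_orders_rev_sorted: "finite S \<Longrightarrow> rev (sorted_list_of_set S) \<in> lin_orders S"
  by (auto simp: lin_orders_def)

lemma no_ascent:
  assumes l: "l \<in> lin_orders S" and S: "finite S" and na: "\<And>l1 p q l2. l = l1 @ p # q # l2 \<Longrightarrow> \<not> p < q"
  shows "l = rev (sorted_list_of_set S)"
proof -
  have d: "distinct l" "set l = S" using l by (auto simp: lin_orders_def)
  have "sorted_wrt (>) l"
  proof -
    have "l ! Suc i < l ! i" if i: "Suc i < length l" for i
    proof -
      have "l = take i l @ l ! i # l ! Suc i # drop (Suc (Suc i)) l"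
        using i by (metis Cons_nth_drop_Suc Suc_lessD append_take_drop_id)
      then have "\<not> l ! i < l ! Suc i" using na by blast
      moreover have "l ! i \<noteq> l ! Suc i" using d i by (simp add: nth_eq_iff_index_eq)
      ultimately show ?thesis by simp
    qed
    then show ?thesis by (subst sorted_wrt_iff_nth_Suc_transp) (auto intro: transpI)
  qed
  then have "sorted_wrt (<) (rev l)" by (simp add: sorted_wrt_rev)
  moreover have "set (rev l) = S" using d by simp
  ultimately have "rev l = sorted_list_of_set S" using S
    by (metis sorted_list_of_set.idem_if_sorted_distinct strict_sorted_iff)
  then show ?thesis by (metis rev_rev_ident)
qed

text \<open>Adjacent entries \<open>p\<close>, \<open>q\<close> of a permutation are separated by
  one cut only. In the decreasing permutation all of them are inverted, so each cut is forced to lie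
  in \<open>X\<close>.\<close>

lemma full_inversions:
  assumes S: "finite S" and l: "l = rev (sorted_list_of_set S)"
    and X: "X \<subseteq> cuts (singles l)" "inversions S X = inversions S (cuts (singles l))"
  shows "X = cuts (singles l)"
proof
  have lin: "l \<in> lin_orders S" using lin_orders_rev_sorted[OF S] l by simp
  have d: "distinct l" "set l = S" using lin by (auto simp: lin_orders_def)
  show "cuts (singles l) \<subseteq> X"
  proof
    fix U assume U: "U \<in> cuts (singles l)"
    then obtain l1 p q l2 where l12: "l = l1 @ p # q # l2" "U = insert p (set l1)" by (rule cuts_singlesE)
    have "sorted_wrt (>) l" unfolding l by (simp add: sorted_wrt_rev)
    then have "q < p" using l12 by (simp add: sorted_wrt_append)
    then have "(q, p) \<in> inversions S X" unfolding X(2) inversions_singles[OF lin] using l12 by (auto simp: before_append)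
    then obtain V where V: "V \<in> X" "p \<in> V" "q \<notin> V" by (auto simp: inversions_def)
    then have VF: "V \<in> cuts (singles l)" using X by auto
    have "U \<subseteq> V"
      using cut_downclosed[OF d(1) VF _ V(2)] V l12 by (auto simp: before_append)
    moreover have "V \<subseteq> set l" using cuts_bounds[OF singles_as_part[OF d(1)] VF] by auto
    moreover have "b \<notin> V" if "b \<in> set l2" for b
      using cut_downclosed[OF d(1) VF, of q b] V that l12 by (auto simp: before_append)
    ultimately have "V = U" using l12 V by auto
    then show "U \<in> X" using V by simp
  qed
qed (use X in simp)

section \<open>The ordered partitions of one set as a shelled complex\<close>

locale ordered_partitions =
  fixes S :: "nat set"
  assumes finS: "finite S" and S: "S \<noteq> {}"
begin

definition part_of :: "nat set set \<Rightarrow> nat set list" where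
  "part_of X = inv_into (as_part S) cuts X"

definition facet :: "nat set set \<Rightarrow> nat set set" where
  "facet X = cuts (singles (sort_blocks (part_of X)))"

definition top_facet :: "nat set set" where
  "top_facet = cuts (singles (rev (sorted_list_of_set S)))"

text \<open>A single vertex has to be removable from every face of the fibre, hence the quantifier
  over all of them. The cut at an ascent qualifies, and the decreasing permutation is the only one
  without an ascent.\<close>

definition free_vertex :: "nat set set \<Rightarrow> nat set" where
  "free_vertex F = (SOME h. h \<in> F \<and> (\<forall>X\<in>cuts ` as_part S. facet X = F \<longrightarrow> facet (X - {h}) = F))"

lemma part_of_cuts: "x \<in> as_part S \<Longrightarrow> part_of (cuts x) = x"
  unfolding part_of_def by (rule inv_into_f_f) (auto intro: inj_onI cuts_inj)

lemma face_down: "X \<in> cuts ` as_part S \<Longrightarrow> Y \<subseteq> X \<Longrightarrow> Y \<in> cuts ` as_part S"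
  using cuts_down[OF _ _ S, of _ Y] by (elim imageE) (metis image_eqI)

lemma facet_eq: "x \<in> as_part S \<Longrightarrow> facet (cuts x) = cuts (singles (sort_blocks x))"
  by (simp add: facet_def part_of_cuts)

lemma facetE:
  assumes "X \<in> cuts ` as_part S"
  obtains l where "l \<in> lin_orders S" "facet X = cuts (singles l)" "X \<subseteq> facet X"
    "inversions S (facet X) = inversions S X"
proof -
  obtain x where x: "x \<in> as_part S" "X = cuts x" using assms by auto
  show ?thesis
    by (rule that[OF sort_blocks_lin[OF x(1) finS]])
      (simp_all add: x facet_eq as_le_imp_cuts[OF as_le_sort_blocks[OF x(1) finS]]
        inversions_sort_blocks[OF x(1) finS])
qed

lemma lin_orders_as_part: "l \<in> lin_orders S \<Longrightarrow> singles l \<in> as_part S"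
  using singles_as_part by (auto simp: lin_orders_def)

lemma facet_cong:
  assumes "X \<in> cuts ` as_part S" "Y \<in> cuts ` as_part S" "inversions S X = inversions S Y"
  shows "facet X = facet Y"
  using facetE[OF assms(1)] facetE[OF assms(2)] inversions_determine assms(3) by metis

lemma finite_inversions: "finite (inversions S X)"
  by (rule finite_subset[of _ "S \<times> S"]) (use finS in \<open>auto simp: inversions_def\<close>)

lemma free_vertex:
  assumes X: "X \<in> cuts ` as_part S" and ne: "facet X \<noteq> top_facet"
  shows "free_vertex (facet X) \<in> facet X \<and> facet (X - {free_vertex (facet X)}) = facet X"
proof -
  obtain l where l: "l \<in> lin_orders S" "facet X = cuts (singles l)" using facetE[OF X] by metis
  obtain l1 p q l2 where a: "l = l1 @ p # q # l2" "p < q"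
    using no_ascent[OF l(1) finS] ne l(2) unfolding top_facet_def by metis
  have "facet (Y - {insert p (set l1)}) = facet X" if Y: "Y \<in> cuts ` as_part S" "facet Y = facet X" for Y
  proof -
    have "Y \<subseteq> cuts (singles l)" "inversions S Y = inversions S (cuts (singles l))"
      using facetE[OF Y(1)] Y(2) l(2) by metis+
    then have "inversions S (Y - {insert p (set l1)}) = inversions S Y"
      by (rule inversions_remove_ascent[OF l(1) a])
    then show ?thesis using facet_cong[OF face_down[OF Y(1)] Y(1)] Y(2) by auto
  qed
  moreover have "insert p (set l1) \<in> facet X" using cut_singles l(2) a(1) by metis
  ultimately have "\<exists>h. h \<in> facet X \<and> (\<forall>Y\<in>cuts ` as_part S. facet Y = facet X \<longrightarrow> facet (Y - {h}) = facet X)"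
    by blast
  from someI_ex[OF this] X show ?thesis unfolding free_vertex_def by blast
qed

text \<open>The weight is the length of the permutation: enlarging a face only adds inversions, so
  its facet changes exactly when their number goes up. The key is merely an injective numbering of
  the cuts.\<close>

sublocale shell: shelled_complex "cuts ` as_part S" facet "\<lambda>X. card (inversions S X)" free_vertex top_facet
  "card S - 1" set_encode
proof (unfold_locales, goal_cases)
  case 1 show ?case using finite_as_part[OF finS] by simp
next
  case 2
  have "[S] \<in> as_part S" using S by (simp add: as_part_Cons as_part_Nil)
  then show ?case by (metis cuts_single image_eqI)
next
  case 3 then show ?case by (rule face_down)
next
  case 4 then show ?case using facetE lin_orders_as_part by (metis image_eqI)
next
  case 5 then show ?case using facetE by metis
next
  case (6 x)
  then obtain l where l: "l \<in> lin_orders S" "facet x = cuts (singles l)" using facetE by metis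
  then show ?case using card_cuts[OF lin_orders_as_part[OF l(1)]] by (auto simp: lin_orders_def distinct_card)
next
  case (7 x y)
  then obtain l where l: "l \<in> lin_orders S" "facet x = cuts (singles l)" "inversions S (facet x) = inversions S x"
    using facetE by metis
  then have "y \<in> cuts ` as_part S" using 7 face_down lin_orders_as_part by (metis image_eqI)
  moreover have "inversions S x = inversions S y"
    using inversions_mono[OF 7(2)] inversions_mono[OF 7(3)] l(3) by blast
  ultimately show ?case using facet_cong 7 by metis
next
  case (8 x y)
  have e: "inversions S (facet x) = inversions S x" "inversions S (facet y) = inversions S y"
    using facetE 8 by metis+
  show ?case
  proof (cases "inversions S x = inversions S y")
    case True
    then show ?thesis using facet_cong 8 by metis
  next
    case False
    then have "card (inversions S x) < card (inversions S y)"
      using inversions_mono[OF 8(3)] finite_inversions by (intro psubset_card_mono) auto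
    then show ?thesis using e by simp
  qed
next
  case 9 then show ?case using free_vertex by blast
next
  case 10 then show ?case using free_vertex by blast
next
  case (11 x)
  then show ?case unfolding top_facet_def using full_inversions[OF finS refl, of x] facetE[OF 11(1)] by metis
next
  case 12
  have "finite U" if "x \<in> as_part S" "U \<in> cuts x" for x U
    using cuts_bounds[OF that] finS by (auto intro: finite_subset)
  then have "\<Union>(cuts ` as_part S) \<subseteq> Collect finite" by auto
  then show ?case using inj_on_set_encode inj_on_subset by blast
qed

end

section \<open>Transport along an isomorphism of posets\<close>

text \<open>The cut-off at \<open>X\<close> matters: outside the carrier \<open>g\<close> is
  uncontrolled, and \<open>map g\<close> might hit chains by accident.\<close>

definition transport :: "'q list set \<Rightarrow> ('q \<Rightarrow> 'p) \<Rightarrow> ('p list \<Rightarrow> 'k::comm_ring_1) \<Rightarrow> 'q list \<Rightarrow> 'k" where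
  "transport X g c z = (if z \<in> X then c (map g z) else 0)"

lemma map_remove_nth: "map g (remove_nth i z) = remove_nth i (map g z)"
  by (simp add: remove_nth_def take_map drop_map)

text \<open>Brings the cohomology of the shelled complex, which is ordered by inclusion of sets of
  cuts, back to ordered partitions.\<close>

locale poset_iso = P: finite_order P le + Q: finite_order Q le'
  for P :: "'p set" and le and Q :: "'q set" and le' +
  fixes f :: "'p \<Rightarrow> 'q" and g :: "'q \<Rightarrow> 'p"
  assumes f_Q: "x \<in> P \<Longrightarrow> f x \<in> Q" and g_P: "y \<in> Q \<Longrightarrow> g y \<in> P"
    and gf: "x \<in> P \<Longrightarrow> g (f x) = x" and fg: "y \<in> Q \<Longrightarrow> f (g y) = y"
    and f_le: "x \<in> P \<Longrightarrow> x' \<in> P \<Longrightarrow> le' (f x) (f x') \<longleftrightarrow> le x x'"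
begin

lemma f_lt: "x \<in> P \<Longrightarrow> y \<in> P \<Longrightarrow> lt_of le' (f x) (f y) \<longleftrightarrow> lt_of le x y"
proof -
  assume xy: "x \<in> P" "y \<in> P"
  have "f x = f y \<longleftrightarrow> x = y"
  proof
    assume "f x = f y"
    then have "g (f x) = g (f y)" by simp
    then show "x = y" using gf xy by simp
  qed simp
  then show ?thesis using f_le[OF xy] by (simp add: lt_of_def)
qed

lemma map_f_chain: 
  assumes "z \<in> chains P le n"
  shows "map f z \<in> chains Q le' n"
proof -
  have z: "length z = Suc n" "set z \<subseteq> P" "sorted_wrt (lt_of le) z" "minimal_in P le (hd z)"
    using assms by (auto simp: chains_def)
  have "sorted_wrt (lt_of le') (map f z)"
    unfolding sorted_wrt_map
    by (rule sorted_wrt_mono_rel[OF _ z(3)]) (use z(2) in \<open>simp add: f_lt subset_iff\<close>)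
  moreover have "minimal_in Q le' (hd (map f z))"
  proof -
    have "hd (map f z) = f (hd z)" using z by (cases z) auto
    moreover have "y = f (hd z)" if y: "y \<in> Q" "le' y (f (hd z))" for y
    proof -
      have hz: "hd z \<in> P" using z(4) by (simp add: minimal_in_def)
      have "le (g y) (hd z)" using f_le[OF g_P[OF y(1)] hz] fg[OF y(1)] y(2) by simp
      then have "g y = hd z" using z(4) g_P[OF y(1)] by (simp add: minimal_in_def)
      then show ?thesis using fg[OF y(1)] by simp
    qed
    ultimately show ?thesis using z(4) f_Q by (simp add: minimal_in_def)
  qed
  ultimately show ?thesis using z f_Q by (auto simp: chains_def)
qed

lemma map_gf_chain: "z \<in> chains P le n \<Longrightarrow> map g (map f z) = z"
  by (auto simp: chains_def gf intro!: map_idI)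

lemma sym: "poset_iso Q le' P le g f"
  by unfold_locales (simp_all add: f_Q g_P gf fg f_le[OF g_P g_P, symmetric])

lemma diff_transport:
  assumes "\<And>z. z \<notin> chains P le n \<Longrightarrow> c z = 0"
  shows "diff Q le' n (transport (chains Q le' n) g c) = transport (chains Q le' (Suc n)) g (diff P le n c)"
proof
  interpret s: poset_iso Q le' P le g f by (rule sym)
  fix z
  show "diff Q le' n (transport (chains Q le' n) g c) z = transport (chains Q le' (Suc n)) g (diff P le n c) z"
  proof (cases "z \<in> chains Q le' (Suc n)")
    case True
    then have "map g z \<in> chains P le (Suc n)" by (rule s.map_f_chain)
    moreover have "remove_nth i z \<in> chains Q le' n" if "i \<in> {1..Suc n}" for i
      using chains_remove_nth[OF True, of i] that by auto
    ultimately show ?thesis unfolding Q.diff_apply transport_def P.diff_apply using True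
      by (auto simp: map_remove_nth simp del: sum.cl_ivl_Suc intro!: sum.cong)
  qed (simp add: Q.diff_apply transport_def)
qed

lemma transport_transport:
  assumes "\<And>z. z \<notin> chains P le n \<Longrightarrow> c z = 0"
  shows "transport (chains P le n) f (transport (chains Q le' n) g c) = c"
  using assms map_f_chain map_gf_chain by (auto simp: transport_def fun_eq_iff)

lemma transport_coboundary:
  assumes c: "c \<in> coboundaries (c_check P le) (diff P le) n"
  shows "transport (chains Q le' n) g c \<in> coboundaries (c_check Q le') (diff Q le') n"
proof (cases n)
  case 0
  then show ?thesis using c by (auto simp: coboundaries_def transport_def)
next
  case (Suc m)
  then obtain b where b: "b \<in> c_check P le m" "c = diff P le m b" using c by (auto simp: coboundaries_def)
  then have "transport (chains Q le' n) g c = diff Q le' m (transport (chains Q le' m) g b)"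
    using diff_transport[of m b] Suc by (simp add: c_check_def free_mod_def)
  moreover have "transport (chains Q le' m) g b \<in> c_check Q le' m"
    by (simp add: c_check_def free_mod_def transport_def)
  ultimately show ?thesis using Suc by (auto simp: coboundaries_def)
qed

end

context ordered_partitions
begin

sublocale po: finite_order "as_part S" as_le
  by (rule finite_order_as_part[OF finS])

sublocale cut_iso: poset_iso "as_part S" as_le "cuts ` as_part S" "(\<subseteq>)" cuts part_of
  by unfold_locales (auto simp: part_of_cuts as_le_iff)

sublocale iso_cut: poset_iso "cuts ` as_part S" "(\<subseteq>)" "as_part S" as_le part_of cuts
  by (rule cut_iso.sym)

lemma check_acyclic:
  assumes n: "n < card S - 1" and c: "c \<in> as_check S n" and d: "as_diff S n c = (\<lambda>_. 0 :: 'k::comm_ring_1)"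
  shows "c \<in> coboundaries (as_check S) (as_diff S) n"
proof -
  let ?c = "transport (chains (cuts ` as_part S) (\<subseteq>) n) part_of c"
  have supp: "\<And>z. z \<notin> chains (as_part S) as_le n \<Longrightarrow> c z = 0" using c by (simp add: c_check_def free_mod_def)
  have "diff (cuts ` as_part S) (\<subseteq>) n ?c = (\<lambda>_. 0)"
    by (subst cut_iso.diff_transport[of n c, OF supp]) (simp_all add: d transport_def fun_eq_iff)
  moreover have "?c \<in> c_check (cuts ` as_part S) (\<subseteq>) n" by (simp add: c_check_def free_mod_def transport_def)
  ultimately have "?c \<in> coboundaries (c_check (cuts ` as_part S) (\<subseteq>)) (diff (cuts ` as_part S) (\<subseteq>)) n"
    using shell.acyclic_below[OF n] by blast
  from iso_cut.transport_coboundary[OF this] show ?thesis using cut_iso.transport_transport[of n c, OF supp] by simp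
qed

lemma check_cyclic:
  "\<exists>t. \<forall>c\<in>as_check S (card S - 1). \<exists>b\<in>coboundaries (as_check S) (as_diff S) (card S - 1). \<exists>a.
     c = (\<lambda>z. a * t z + (b z :: 'k::comm_ring_1))"
proof -
  let ?r = "card S - 1"
  obtain t where t: "\<forall>c\<in>c_check (cuts ` as_part S) (\<subseteq>) ?r.
      \<exists>b\<in>coboundaries (c_check (cuts ` as_part S) (\<subseteq>)) (diff (cuts ` as_part S) (\<subseteq>)) ?r. \<exists>a.
     c = (\<lambda>z. a * symb t z + (b z :: 'k))" using shell.cyclic_top by blast
  have "\<exists>b\<in>coboundaries (as_check S) (as_diff S) ?r. \<exists>a.
      c = (\<lambda>z. a * transport (chains (as_part S) as_le ?r) cuts (symb t) z + b z)"
    if c: "c \<in> as_check S ?r" for c :: "_ \<Rightarrow> 'k"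
  proof -
    let ?c = "transport (chains (cuts ` as_part S) (\<subseteq>) ?r) part_of c"
    have supp: "\<And>z. z \<notin> chains (as_part S) as_le ?r \<Longrightarrow> c z = 0" using c by (simp add: c_check_def free_mod_def)
    have "?c \<in> c_check (cuts ` as_part S) (\<subseteq>) ?r" by (simp add: c_check_def free_mod_def transport_def)
    then obtain b a where b: "b \<in> coboundaries (c_check (cuts ` as_part S) (\<subseteq>)) (diff (cuts ` as_part S) (\<subseteq>)) ?r"
      "?c = (\<lambda>z. a * symb t z + b z)" using t by blast
    have "c z = a * transport (chains (as_part S) as_le ?r) cuts (symb t) z
        + transport (chains (as_part S) as_le ?r) cuts b z" for z
      using fun_cong[OF cut_iso.transport_transport[of ?r c, OF supp], of z] unfolding b(2) by (simp add: transport_def split: if_splits)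
    then show ?thesis using iso_cut.transport_coboundary[OF b(1)] by blast
  qed
  then show ?thesis by blast
qed

lemma check_no_chains: "n > card S - 1 \<Longrightarrow> chains (as_part S) as_le n = {}"
  using shell.no_chains[of n] cut_iso.map_f_chain by fastforce

end

section \<open>Composition with the chains of a two-element block\<close>

lemma listset_iff: "xs \<in> listset Xs \<longleftrightarrow> length xs = length Xs \<and> (\<forall>i<length Xs. xs ! i \<in> Xs ! i)"
proof (induction Xs arbitrary: xs)
  case (Cons A Xs)
  show ?case by (cases xs) (auto simp: set_Cons_def Cons.IH All_less_Suc2)
qed simp

lemma finite_listset: "(\<And>A. A \<in> set Xs \<Longrightarrow> finite A) \<Longrightarrow> finite (listset Xs)"
proof (induction Xs)
  case (Cons A Xs)
  have "listset (A # Xs) = (\<lambda>(a, as). a # as) ` (A \<times> listset Xs)" by (auto simp: set_Cons_def)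
  then show ?case using Cons by simp
qed simp

lemma pullback_apply:
  assumes "finite X" "finite Y"
  shows "pullback X Y f c z = (if z \<in> X \<and> map f z \<in> Y then c (map f z) else 0)"
proof -
  have 1: "(\<Sum>xs\<in>{xs \<in> X. map f xs = ys}. symb xs z) = (if z \<in> X \<and> map f z = ys then 1 else 0)" for ys
  proof -
    have "(\<Sum>xs\<in>{xs \<in> X. map f xs = ys}. symb xs z) = (\<Sum>xs\<in>{xs \<in> X. map f xs = ys}. if xs = z then 1 else 0)"
      by (rule sum.cong) (auto simp: symb_def)
    also have "\<dots> = (if z \<in> X \<and> map f z = ys then 1 else 0)" using assms(1) by (subst sum.delta) auto
    finally show ?thesis .
  qed
  have "pullback X Y f c z = (\<Sum>ys\<in>Y. if ys = map f z then (if z \<in> X then c (map f z) else 0) else 0)"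
    unfolding pullback_def lin_ext_def 1 by (rule sum.cong) auto
  also have "\<dots> = (if z \<in> X \<and> map f z \<in> Y then c (map f z) else 0)" using assms(2) by (subst sum.delta) auto
  finally show ?thesis .
qed

lemma as_le_coarsen: "as_le x y \<Longrightarrow> y \<in> as_part S \<Longrightarrow> x \<in> as_part S"
proof -
  assume "as_le x y" "y \<in> as_part S"
  then obtain yss where y: "[] \<notin> set yss" "y = concat yss" "x = map (\<lambda>ys. \<Union>(set ys)) yss"
    by (auto simp: as_le_def)
  have "map (\<lambda>ys. \<Union>(set ys)) yss \<in> as_part S" using y(1) \<open>y \<in> as_part S\<close>[unfolded y(2)]
  proof (induction yss arbitrary: S)
    case (Cons ys yss)
    have "\<Union>(set ys) \<subseteq> S" "ys \<in> as_part (\<Union>(set ys))" "concat yss \<in> as_part (S - \<Union>(set ys))"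
      using Cons.prems by (auto simp: as_part_append)
    moreover have "\<Union>(set ys) \<noteq> {}"
      using Cons.prems(1) as_part_nonempty[OF \<open>ys \<in> as_part _\<close>] by (cases ys) auto
    ultimately show ?case using Cons.IH Cons.prems(1) by (auto simp: as_part_Cons)
  qed simp
  then show ?thesis using y by simp
qed

lemma as_le_block: "as_le w x \<Longrightarrow> T \<in> set x \<Longrightarrow> \<exists>B\<in>set w. T \<subseteq> B"
  by (auto simp: as_le_def) (metis Union_upper)

lemma as_le_union: "as_le w x \<Longrightarrow> B \<in> set w \<Longrightarrow> B = \<Union>{T \<in> set x. T \<subseteq> B}"
  by (auto simp: as_le_def) (metis Union_upper)

lemma as_part_disjoint: "x \<in> as_part S \<Longrightarrow> A \<in> set x \<Longrightarrow> B \<in> set x \<Longrightarrow> a \<in> A \<Longrightarrow> a \<in> B \<Longrightarrow> A = B"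
  by (auto simp: as_part_def partition_on_def disjoint_def)

lemma as_part_nth_eq: "x \<in> as_part S \<Longrightarrow> i < length x \<Longrightarrow> j < length x \<Longrightarrow> a \<in> x ! i \<Longrightarrow> a \<in> x ! j \<Longrightarrow> i = j"
  using as_part_disjoint[of x S "x ! i" "x ! j" a] by (auto simp: as_part_def nth_eq_iff_index_eq)

lemma as_part_singleton: "x \<in> as_part B \<Longrightarrow> card B = 1 \<Longrightarrow> x = [B]"
proof -
  assume x: "x \<in> as_part B" "card B = 1"
  have "length x \<le> 1" using length_as_part[OF x(1)] x(2) card_ge_0_finite[of B] by simp
  moreover have "x \<noteq> []" using x by (auto simp: as_part_Nil)
  ultimately obtain C where "x = [C]" by (cases x) auto
  then show ?thesis using as_part_Union[OF x(1)] by simp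
qed

text \<open>Blocks of different segments are nonempty and disjoint. Hence \<open>psi\<close> takes a
  refinement apart into the very segments from which it was concatenated.\<close>

lemma filter_segment:
  assumes "concat yss \<in> as_part S" "[] \<notin> set yss" "ys \<in> set yss"
  shows "filter (\<lambda>B. B \<subseteq> \<Union>(set ys)) (concat yss) = ys"
proof -
  have U: "map (\<lambda>ys. \<Union>(set ys)) yss \<in> as_part S"
    using as_le_coarsen[OF _ assms(1), of "map (\<lambda>ys. \<Union>(set ys)) yss"] assms(2) by (auto simp: as_le_def)
  obtain us vs where s: "yss = us @ ys # vs" using assms(3) by (meson split_list)
  have ne: "B \<noteq> {}" if "zs \<in> set yss" "B \<in> set zs" for zs B
    using as_part_nonempty[OF assms(1)] that by auto
  have dis: "\<not> B \<subseteq> \<Union>(set ys)" if zs: "zs \<in> set us \<union> set vs" "B \<in> set zs" for zs B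
  proof
    assume "B \<subseteq> \<Union>(set ys)"
    have "zs \<in> set yss" using zs(1) s by auto
    then obtain b where b: "b \<in> B" using ne[OF _ zs(2)] by auto
    have "distinct (map (\<lambda>ys. \<Union>(set ys)) yss)" using U by (simp add: as_part_def)
    then have "\<Union>(set ys) \<notin> (\<lambda>ys. \<Union>(set ys)) ` (set us \<union> set vs)" unfolding s by auto
    then have "\<Union>(set zs) \<noteq> \<Union>(set ys)" using zs(1) by (metis image_eqI)
    moreover have "\<Union>(set zs) = \<Union>(set ys)"
      by (rule as_part_disjoint[OF U, of _ _ b]) (use zs s b \<open>B \<subseteq> \<Union>(set ys)\<close> in auto)
    ultimately show False by simp
  qed
  have "filter (\<lambda>B. B \<subseteq> \<Union>(set ys)) (concat us) = []" "filter (\<lambda>B. B \<subseteq> \<Union>(set ys)) (concat vs) = []"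
    using dis by (auto simp: filter_empty_conv)
  moreover have "filter (\<lambda>B. B \<subseteq> \<Union>(set ys)) ys = ys" by (auto intro: filter_True)
  ultimately show ?thesis unfolding s by simp
qed

lemma segment_as_part:
  assumes "concat yss \<in> as_part S" "ys \<in> set yss"
  shows "ys \<in> as_part (\<Union>(set ys))"
proof -
  obtain us vs where s: "yss = us @ ys # vs" using assms(2) by (meson split_list)
  have "concat us @ ys @ concat vs \<in> as_part S" using assms(1) s by simp
  then show ?thesis using as_part_append by metis
qed

lemma sum_card_blocks: "x \<in> as_part S \<Longrightarrow> finite S \<Longrightarrow> (\<Sum>i<length x. card (x ! i)) = card S"
proof (induction x arbitrary: S)
  case (Cons B x)
  then have B: "B \<subseteq> S" "x \<in> as_part (S - B)" by (auto simp: as_part_Cons)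
  then have "card S = card B + card (S - B)" using Cons.prems card_Diff_subset[of B S] card_mono[of S B]
    by (auto simp: finite_subset)
  then show ?case using Cons.IH[OF B(2)] Cons.prems by (simp add: sum.lessThan_Suc_shift del: sum.lessThan_Suc)
qed (simp add: as_part_Nil)

text \<open>The sum of all top chains. On a one-element block it is the operadic unit, on a
  two-element block the sum of the two maximal chains; these are the only cases in which its class
  is needed.\<close>

definition full_cochain :: "nat set \<Rightarrow> nat set list list \<Rightarrow> 'k::comm_ring_1" where
  "full_cochain B z = (if z \<in> chains (as_part B) as_le (card B - 1) then 1 else 0)"

lemma finite_listset_as_part:
  assumes "\<And>B. B \<in> set x \<Longrightarrow> finite B"
  shows "finite (listset (map as_part x))"
  by (rule finite_listset) (use assms in \<open>auto simp: finite_as_part\<close>)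

text \<open>At a given chain \<open>w\<close> of the product only one tuple of chains contributes,
  the tuple of projected segments of \<open>w\<close>, and all its coefficients are 1.\<close>

lemma kuenneth_full:
  assumes fin: "\<And>B. B \<in> set x \<Longrightarrow> finite B"
    and w: "w \<in> chains (listset (map as_part x)) (list_all2 as_le) (\<Sum>i<length x. card (x ! i) - 1)"
    and seg: "\<And>i. i < length x \<Longrightarrow> map (\<lambda>v. v ! i) (take (Suc (card (x ! i) - 1)) (drop (\<Sum>j<i. card (x ! j) - 1) w))
        \<in> chains (as_part (x ! i)) as_le (card (x ! i) - 1)"
  shows "kuenneth (map as_part x) as_le (map (\<lambda>B. card B - 1) x) (map full_cochain x) w = (1 :: 'k::comm_ring_1)"
proof -
  let ?L = "listset (map2 (\<lambda>P q. chains P as_le q) (map as_part x) (map (\<lambda>B. card B - 1) x))"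
  let ?n = "length x"
  define seg0 where "seg0 i = map (\<lambda>v. v ! i) (take (Suc (card (x ! i) - 1)) (drop (\<Sum>j<i. card (x ! j) - 1) w))" for i
  have L: "xss \<in> ?L \<longleftrightarrow> length xss = ?n \<and> (\<forall>i<?n. xss ! i \<in> chains (as_part (x ! i)) as_le (card (x ! i) - 1))" for xss
    unfolding listset_iff by simp
  have finL: "finite ?L"
    by (rule finite_listset) (auto simp: set_zip intro!: finite_chains finite_as_part fin)
  have finC: "finite (chains (listset (map as_part x)) (list_all2 as_le) m)" for m
    by (rule finite_chains[OF finite_listset_as_part[OF fin]])
  have st: "seg_start xss i = (\<Sum>j<i. card (x ! j) - 1)" if "xss \<in> ?L" "i \<le> ?n" for xss i
    unfolding seg_start_def using that L by (auto simp: chains_def intro!: sum.cong)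
  have one: "(\<Prod>i<length (map as_part x). (map full_cochain x ! i) (xss ! i))
      * kuenneth_sym (map as_part x) as_le xss w = (if xss = map seg0 [0..<?n] then 1 else (0 :: 'k))"
    if xss: "xss \<in> ?L" for xss
  proof -
    have p: "(\<Prod>i<length (map as_part x). (map full_cochain x ! i) (xss ! i)) = (1 :: 'k)"
      by (rule prod.neutral) (use xss L in \<open>auto simp: full_cochain_def\<close>)
    have lx: "length (xss ! i) = Suc (card (x ! i) - 1)" if "i < ?n" for i
      using xss that unfolding L by (auto simp: chains_def)
    have e: "(\<forall>i<length xss. map (\<lambda>v. v ! i) (take (length (xss ! i)) (drop (seg_start xss i) w)) = xss ! i)
      \<longleftrightarrow> xss = map seg0 [0..<?n]"
    proof -
      have l: "length xss = ?n" using xss L by blast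
      have eqi: "map (\<lambda>v. v ! i) (take (length (xss ! i)) (drop (seg_start xss i) w)) = seg0 i" if i: "i < ?n" for i
        unfolding seg0_def lx[OF i] st[OF xss less_imp_le[OF i]] by (rule refl)
      have "(\<forall>i<length xss. map (\<lambda>v. v ! i) (take (length (xss ! i)) (drop (seg_start xss i) w)) = xss ! i)
        \<longleftrightarrow> (\<forall>i<?n. seg0 i = xss ! i)"
        unfolding l
      proof (intro iffI allI impI)
        fix i assume a: "\<forall>i<?n. map (\<lambda>v. v ! i) (take (length (xss ! i)) (drop (seg_start xss i) w)) = xss ! i" and i: "i < ?n"
        show "seg0 i = xss ! i" unfolding eqi[OF i, symmetric] using a i by blast
      next
        fix i assume a: "\<forall>i<?n. seg0 i = xss ! i" and i: "i < ?n"
        show "map (\<lambda>v. v ! i) (take (length (xss ! i)) (drop (seg_start xss i) w)) = xss ! i"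
          unfolding eqi[OF i] using a i by blast
      qed
      also have "\<dots> \<longleftrightarrow> xss = map seg0 [0..<?n]"
      proof
        assume "\<forall>i<?n. seg0 i = xss ! i"
        then show "xss = map seg0 [0..<?n]" using l by (intro nth_equalityI) (auto simp del: upt_Suc)
      qed simp
      finally show ?thesis .
    qed
    have "kuenneth_sym (map as_part x) as_le xss w
        = (\<Sum>w'\<in>{w' \<in> chains (listset (map as_part x)) (list_all2 as_le) (seg_start xss (length xss)).
           \<forall>i<length xss. map (\<lambda>v. v ! i) (take (length (xss ! i)) (drop (seg_start xss i) w')) = xss ! i}.
            if w' = w then 1 else (0 :: 'k))"
      unfolding kuenneth_sym_def by (rule sum.cong) (auto simp: symb_def)
    also have "\<dots> = (if xss = map seg0 [0..<?n] then 1 else 0)"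
      using w st[OF xss, of ?n] xss L finC e by (subst sum.delta) auto
    finally show ?thesis using p by simp
  qed
  have mem: "map seg0 [0..<?n] \<in> ?L" using seg unfolding L seg0_def by simp
  have "(\<Sum>xss\<in>?L. (\<Prod>i<length (map as_part x). (map full_cochain x ! i) (xss ! i))
      * kuenneth_sym (map as_part x) as_le xss w) = (\<Sum>xss\<in>?L. if xss = map seg0 [0..<?n] then 1 else (0 :: 'k))"
    by (rule sum.cong[OF refl one])
  also have "\<dots> = 1" unfolding sum.delta[OF finL] by (rule if_P[OF mem])
  finally show ?thesis unfolding kuenneth_def .
qed

lemma chains_nonempty: "z \<in> chains P le n \<Longrightarrow> z \<noteq> []"
  by (auto simp: chains_def)

section \<open>Pulling chains back along \<open>phi\<close> and \<open>psi\<close>\<close>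

context ordered_partitions
begin

lemma lt_length: "lt_of as_le x y \<Longrightarrow> length x < length y"
  using as_le_length as_le_length_eq unfolding lt_of_def by (metis le_neq_implies_less)

lemma chain_length:
  assumes "z \<in> chains (as_part S) as_le n"
  shows "Suc n \<le> length (last z)"
proof -
  have z: "length z = Suc n" "set z \<subseteq> as_part S" "sorted_wrt (lt_of as_le) z" using assms by (auto simp: chains_def)
  have "Suc i \<le> length (z ! i)" if "i < length z" for i
    using that
  proof (induction i)
    case 0
    then have "z ! 0 \<in> as_part S" using z by auto
    then show ?case using S as_part_Nil[of S] by (cases "z ! 0") auto
  next
    case (Suc i)
    then have "lt_of as_le (z ! i) (z ! Suc i)" using z(3) by (simp add: sorted_wrt_iff_nth_less)
    then show ?case using lt_length Suc by fastforce
  qed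
  from this[of n] show ?thesis using z chains_nonempty[OF assms] by (simp add: last_conv_nth)
qed

lemma full_maximal:
  assumes "x \<in> as_part S" "length x = card S"
  shows "maximal_in (as_part S) as_le x"
  using assms as_le_length as_le_length_eq length_as_part[OF _ finS] unfolding maximal_in_def
  by (metis le_antisym)

text \<open>Every step of a chain adds a block. A chain of degree \<open>card S - 1\<close> thus
  ends with all blocks singletons, which is why the two complexes share their top cochains.\<close>

lemma top_chains_max: "chains (as_part S) as_le (card S - 1) = max_chains (as_part S) as_le (card S - 1)"
proof -
  have "maximal_in (as_part S) as_le (last z)" if z: "z \<in> chains (as_part S) as_le (card S - 1)" for z
  proof -
    have "last z \<in> as_part S" using z by (cases z rule: rev_cases) (auto simp: chains_def)
    moreover have "card S > 0" using finS S by (simp add: card_gt_0_iff)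
    ultimately show ?thesis using chain_length[OF z] length_as_part[OF _ finS, of "last z"] full_maximal by simp
  qed
  then show ?thesis by (auto simp: max_chains_def)
qed

lemma finite_block: "x \<in> as_part S \<Longrightarrow> T \<in> set x \<Longrightarrow> finite T"
  using as_part_Union finS by (metis Union_upper finite_subset)

lemma phi_self:
  assumes x: "x \<in> as_part S"
  shows "phi x x = singles (map set_encode x)"
proof -
  have "{T' \<in> set x. T' \<subseteq> T} = {T}" if "T \<in> set x" for T
    using as_part_disjoint[OF x _ that] as_part_nonempty[OF x] that by blast
  then show ?thesis by (simp add: phi_def singles_def)
qed

lemma phi_mono:
  assumes x: "x \<in> as_part S" and w: "as_le w' x" "as_le w w'"
  shows "as_le (phi x w) (phi x w')"
proof -
  let ?f = "\<lambda>B. set_encode ` {T \<in> set x. T \<subseteq> B}"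
  obtain zss where z: "[] \<notin> set zss" "w' = concat zss" "w = map (\<lambda>ys. \<Union>(set ys)) zss"
    using w(2) by (auto simp: as_le_def)
  have w': "w' \<in> as_part S" using as_le_coarsen[OF w(1) x] .
  have "?f (\<Union>(set zs)) = \<Union>(?f ` set zs)" if zs: "zs \<in> set zss" for zs
  proof -
    have "\<exists>B\<in>set zs. T \<subseteq> B" if T: "T \<in> set x" "T \<subseteq> \<Union>(set zs)" for T
    proof -
      obtain t where t: "t \<in> T" using as_part_nonempty[OF x T(1)] by auto
      obtain B where B: "B \<in> set zs" "t \<in> B" using T t by auto
      obtain B' where B': "B' \<in> set w'" "T \<subseteq> B'" using as_le_block[OF w(1) T(1)] by auto
      have "B = B'" by (rule as_part_disjoint[OF w' _ _ B(2)]) (use B B' t z zs in auto)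
      then show ?thesis using B B' by auto
    qed
    then show ?thesis by (auto simp: image_iff) blast+
  qed
  then have "phi x w = map (\<lambda>ys. \<Union>(set ys)) (map (map ?f) zss)" unfolding phi_def z(3) by simp
  moreover have "phi x w' = concat (map (map ?f) zss)" unfolding phi_def z(2) by (simp add: map_concat)
  moreover have "[] \<notin> set (map (map ?f) zss)" using z(1) by auto
  ultimately show ?thesis unfolding as_le_def by blast
qed

text \<open>The blocks of a coarsening are unions of blocks of \<open>x\<close>, so decoding the
  names inverts \<open>phi\<close>. The statement allows a reordering \<open>x'\<close> because
  \<open>rho\<close> sums over all orders of the blocks.\<close>

lemma phi_recover:
  assumes x: "x \<in> as_part S" and w: "as_le w x'" "set x' = set x"
  shows "map (\<lambda>C. \<Union>(set_decode ` C)) (phi x' w) = w"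
proof -
  have "\<Union>(set_decode ` set_encode ` {T \<in> set x'. T \<subseteq> B}) = B" if B: "B \<in> set w" for B
  proof -
    have "set_decode ` set_encode ` {T \<in> set x'. T \<subseteq> B} = {T \<in> set x'. T \<subseteq> B}"
      using finite_block[OF x] w(2) by (auto simp: image_image image_iff)
    then show ?thesis using as_le_union[OF w(1) B] by simp
  qed
  then show ?thesis by (simp add: phi_def map_idI)
qed

lemma inj_encode: "x \<in> as_part S \<Longrightarrow> inj_on set_encode (set x)"
  using finite_block by (intro inj_on_subset[OF inj_on_set_encode]) auto

lemma card_blocks: "x \<in> as_part S \<Longrightarrow> card (blocks x) = length x"
  unfolding blocks_def using inj_encode by (simp add: card_image distinct_card as_part_def)

lemma phi_self_part: "x \<in> as_part S \<Longrightarrow> phi x x \<in> as_part (blocks x)"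
  using singles_as_part[of "map set_encode x"] inj_encode
  by (simp add: phi_self blocks_def distinct_map as_part_def)

lemma chain_below_last:
  assumes z: "z \<in> chains (as_part S) as_le n" and w: "w \<in> set z"
  shows "as_le w (last z)"
proof -
  obtain i where i: "i < length z" "w = z ! i" using w by (auto simp: in_set_conv_nth)
  have l: "last z = z ! n" "length z = Suc n" using z chains_nonempty[OF z] by (auto simp: chains_def last_conv_nth)
  show ?thesis
  proof (cases "i = n")
    case True then show ?thesis using i l as_le_refl by simp
  next
    case False
    then have "lt_of as_le (z ! i) (z ! n)" using z i l by (auto simp: chains_def sorted_wrt_iff_nth_less)
    then show ?thesis using i l by (simp add: lt_of_def)
  qed
qed

lemma chain_max_below:
  assumes z: "z \<in> chains (as_part S) as_le n" and x: "x = last z"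
  shows "z \<in> max_chains (below S x) as_le n"
proof -
  have lz: "last z \<in> set z" using chains_nonempty[OF z] by simp
  have "set z \<subseteq> below S x" using z chain_below_last[OF z] x by (auto simp: below_def chains_def)
  moreover have "minimal_in (below S x) as_le (hd z)"
    using z chain_below_last[OF z, of "hd z"] x unfolding chains_def minimal_in_def below_def
    by (cases z) auto
  moreover have "maximal_in (below S x) as_le (last z)"
    using lz calculation(1) x po.antisym unfolding maximal_in_def below_def by auto
  ultimately show ?thesis using z by (auto simp: max_chains_def chains_def)
qed

lemma phi_chain:
  assumes z: "z \<in> chains (as_part S) as_le n" and x: "x = last z"
  shows "map (phi x) z \<in> max_chains (as_part (blocks x)) as_le n"
proof -
  have lz: "last z \<in> set z" "z \<noteq> []" using chains_nonempty[OF z] by auto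
  have zS: "set z \<subseteq> as_part S" "sorted_wrt (lt_of as_le) z" "length z = Suc n" using z by (auto simp: chains_def)
  have xS: "x \<in> as_part S" using lz zS x by auto
  have le: "as_le w x" if "w \<in> set z" for w using chain_below_last[OF z that] x by simp
  have part: "phi x w \<in> as_part (blocks x)" if "w \<in> set z" for w
    using as_le_coarsen[OF phi_mono[OF xS as_le_refl le[OF that]] phi_self_part[OF xS]] .
  have "sorted_wrt (lt_of as_le) (map (phi x) z)"
    unfolding sorted_wrt_map
  proof (rule sorted_wrt_mono_rel[OF _ zS(2)])
    fix v w assume vw: "v \<in> set z" "w \<in> set z" "lt_of as_le v w"
    have "phi x v \<noteq> phi x w" using phi_recover[OF xS le[OF vw(1)] refl] phi_recover[OF xS le[OF vw(2)] refl] vw(3)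
      by (auto simp: lt_of_def)
    then show "lt_of as_le (phi x v) (phi x w)" using phi_mono[OF xS le[OF vw(2)]] vw(3) by (auto simp: lt_of_def)
  qed
  moreover have "minimal_in (as_part (blocks x)) as_le (hd (map (phi x) z))"
  proof -
    have "hd z = [S]" using z minimal_as_part[OF S] by (simp add: chains_def)
    moreover have "{T \<in> set x. T \<subseteq> S} = set x" using as_part_Union[OF xS] by auto
    moreover have "blocks x \<noteq> {}" using xS S by (auto simp: blocks_def as_part_Nil)
    ultimately show ?thesis using lz(2) by (simp add: hd_map phi_def blocks_def minimal_as_part)
  qed
  moreover have "maximal_in (as_part (blocks x)) as_le (last (map (phi x) z))"
  proof -
    interpret b: ordered_partitions "blocks x" 
      by unfold_locales (use xS S in \<open>auto simp: blocks_def as_part_Nil\<close>)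
    have "last (map (phi x) z) = phi x x" using lz(2) x by (simp add: last_map)
    then show ?thesis using b.full_maximal[OF phi_self_part[OF xS]] card_blocks[OF xS] by (simp add: phi_def)
  qed
  ultimately show ?thesis using part zS by (auto simp: max_chains_def chains_def)
qed

text \<open>Decoding gives \<open>u = z\<close>. Moreover \<open>u\<close> ends in
  \<open>x'\<close>, the largest element of its lower set. So only one order of the blocks survives
  in the sum that defines \<open>rho\<close>.\<close>

lemma phi_chain_unique:
  assumes z: "z \<in> chains (as_part S) as_le n" and x: "x = last z"
    and x': "x' \<in> as_part S" "set x' = set x" and u: "u \<in> max_chains (below S x') as_le n"
    and e: "map (phi x') u = map (phi x) z"
  shows "u = z \<and> x' = x"
proof -
  have lz: "last z \<in> set z" using chains_nonempty[OF z] by simp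
  have xS: "x \<in> as_part S" using lz z x by (auto simp: chains_def)
  let ?r = "map (\<lambda>C. \<Union>(set_decode ` C))"
  have "map ?r (map (phi x') u) = u"
    using u phi_recover[OF xS _ x'(2)] by (auto simp: max_chains_def chains_def below_def o_def intro!: map_idI)
  moreover have "map ?r (map (phi x) z) = z"
    using phi_recover[OF xS _ refl] chain_below_last[OF z] x by (auto simp: o_def intro!: map_idI)
  ultimately have "u = z" using e by metis
  have "x' \<in> below S x'" using x' as_le_refl by (auto simp: below_def)
  moreover have "as_le (last u) x'" "maximal_in (below S x') as_le (last u)"
    using u by (auto simp: max_chains_def maximal_in_def below_def)
  ultimately have "x' = last u" by (auto simp: maximal_in_def)
  then show ?thesis using \<open>u = z\<close> x by simp
qed

text \<open>The excesses \<open>card T - 1\<close> over the blocks add up to one.\<close>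

lemma two_block:
  assumes x: "x \<in> as_part S" and l: "Suc (length x) = card S"
  obtains j where "j < length x" "card (x ! j) = 2" "\<And>i. i < length x \<Longrightarrow> i \<noteq> j \<Longrightarrow> card (x ! i) = 1"
proof -
  have pos: "card (x ! i) \<ge> 1" if "i < length x" for i
    using finite_block[OF x] as_part_nonempty[OF x] that by (simp add: Suc_le_eq card_gt_0_iff)
  have "(\<Sum>i<length x. card (x ! i)) = (\<Sum>i<length x. card (x ! i) - 1) + (\<Sum>i<length x. 1)"
    unfolding sum.distrib[symmetric] by (rule sum.cong) (use pos in fastforce)+
  then have "(\<Sum>i<length x. card (x ! i) - 1) = Suc 0" using sum_card_blocks[OF x finS] l by simp
  then obtain j where j: "j < length x" "card (x ! j) - 1 = Suc 0"
      "\<forall>i<length x. j \<noteq> i \<longrightarrow> card (x ! i) - 1 = 0" by (auto simp: sum_eq_Suc0_iff)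
  show ?thesis by (rule that[OF j(1)]) (use j pos in \<open>force intro: le_antisym\<close>)+
qed

text \<open>In the product of the posets of the blocks, the step from \<open>x\<close> to
  \<open>y\<close> moves only the coordinate of the two-element block. Every coordinate therefore
  traverses a top chain of its block, where the full cochain has value 1.\<close>

lemma psi_chain:
  assumes x: "x \<in> as_part S" "Suc (length x) = card S" and y: "y \<in> as_part S" "lt_of as_le x y"
  shows "map (psi x) [x, y] \<in> chains (listset (map as_part x)) (list_all2 as_le) 1"
    and "kuenneth (map as_part x) as_le (map (\<lambda>B. card B - 1) x) (map full_cochain x) (map (psi x) [x, y])
       = (1 :: 'k::comm_ring_1)"
proof -
  obtain j where j: "j < length x" "card (x ! j) = 2" "\<And>i. i < length x \<Longrightarrow> i \<noteq> j \<Longrightarrow> card (x ! i) = 1"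
    using two_block[OF x] by blast
  obtain yss where yss: "[] \<notin> set yss" "y = concat yss" "x = map (\<lambda>ys. \<Union>(set ys)) yss"
    using y(2) by (auto simp: lt_of_def as_le_def)
  have len: "length yss = length x" using yss by simp
  have px: "psi x x = map (\<lambda>B. [B]) x"
  proof -
    have "filter (\<lambda>B. B \<subseteq> T) x = [T]" if T: "T \<in> set x" for T
      using filter_segment[of "map (\<lambda>B. [B]) x" S "[T]"] T x(1) by (auto simp: o_def)
    then show ?thesis by (simp add: psi_def)
  qed
  have py: "psi x y = yss"
  proof -
    have "filter (\<lambda>B. B \<subseteq> \<Union>(set ys)) (concat yss) = ys" if "ys \<in> set yss" for ys
      using filter_segment that yss y(1) by metis
    then show ?thesis unfolding psi_def yss(2) by (subst yss(3)) (simp add: map_idI)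
  qed
  have part: "yss ! i \<in> as_part (x ! i)" if "i < length x" for i
  proof -
    have "yss ! i \<in> set yss" using that len by simp
    moreover have "x ! i = \<Union>(set (yss ! i))" using yss(3) that by simp
    ultimately show ?thesis using segment_as_part[of yss S "yss ! i"] y(1) yss(2) by simp
  qed
  have one: "[B] \<in> as_part B" if "B \<in> set x" for B
    using that as_part_nonempty[OF x(1)] by (simp add: as_part_Cons as_part_Nil)
  have le1: "as_le [B] v" if "v \<in> as_part B" "B \<in> set x" for v B
    using cuts_imp_as_le[OF one[OF that(2)] that(1)] by simp
  have single: "yss ! i = [x ! i]" if "i < length x" "i \<noteq> j" for i
    using as_part_singleton[OF part] j(3) that by simp
  have nej: "yss ! j \<noteq> [x ! j]"
  proof
    assume "yss ! j = [x ! j]"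
    then have "yss ! i = [x ! i]" if "i < length x" for i using single that by (cases "i = j") simp_all
    then have "yss = map (\<lambda>B. [B]) x" using len by (intro nth_equalityI) simp_all
    then have "y = x" using yss(2) by simp
    then show False using y(2) by (simp add: lt_of_def)
  qed
  have w0: "map (\<lambda>B. [B]) x \<in> listset (map as_part x)" using one by (simp add: listset_iff)
  have w1: "yss \<in> listset (map as_part x)" using part len by (simp add: listset_iff)
  have lt: "lt_of (list_all2 as_le) (map (\<lambda>B. [B]) x) yss"
  proof -
    have "list_all2 as_le (map (\<lambda>B. [B]) x) yss" using part le1 len by (simp add: list_all2_conv_all_nth)
    moreover have "map (\<lambda>B. [B]) x \<noteq> yss" using nej j(1) by auto
    ultimately show ?thesis by (simp add: lt_of_def)
  qed
  have min: "v = map (\<lambda>B. [B]) x" if "v \<in> listset (map as_part x)" "list_all2 as_le v (map (\<lambda>B. [B]) x)" for v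
  proof (rule nth_equalityI)
    show "length v = length (map (\<lambda>B. [B]) x)" using that by (simp add: listset_iff)
    fix i assume "i < length v"
    then have i: "i < length x" using that by (simp add: listset_iff)
    then have "as_le (v ! i) [x ! i]" "v ! i \<in> as_part (x ! i)" using that by (auto simp: listset_iff list_all2_conv_all_nth)
    then show "v ! i = map (\<lambda>B. [B]) x ! i"
      using i minimal_as_part[of "x ! i" "[x ! i]"] as_part_nonempty[OF x(1)] unfolding minimal_in_def by simp
  qed
  show c: "map (psi x) [x, y] \<in> chains (listset (map as_part x)) (list_all2 as_le) 1"
    using w0 w1 lt min by (auto simp: chains_def px py minimal_in_def)
  \<comment> \<open>One-element blocks have segments of length one. Up to and including block
    \<open>j\<close> a segment starts at position 0, afterwards at position 1.\<close>
  have st: "(\<Sum>l<i. card (x ! l) - 1) = (if j < i then 1 else 0)" if "i \<le> length x" for i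
  proof -
    have "(\<Sum>l<i. card (x ! l) - 1) = (\<Sum>l<i. if l = j then 1 else 0)"
      by (rule sum.cong) (use j that in auto)
    then show ?thesis by (simp add: sum.delta)
  qed
  show "kuenneth (map as_part x) as_le (map (\<lambda>B. card B - 1) x) (map full_cochain x) (map (psi x) [x, y]) = (1 :: 'k)"
  proof (rule kuenneth_full)
    show "finite B" if "B \<in> set x" for B using finite_block[OF x(1) that] .
    show "map (psi x) [x, y] \<in> chains (listset (map as_part x)) (list_all2 as_le) (\<Sum>i<length x. card (x ! i) - 1)"
      using c st[of "length x"] j(1) by simp
    fix i assume i: "i < length x"
    have xi: "x ! i \<in> set x" "x ! i \<noteq> {}" using i as_part_nonempty[OF x(1)] by auto
    have m: "minimal_in (as_part (x ! i)) as_le [x ! i]" using minimal_as_part xi by blast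
    consider "i < j" | "i = j" | "j < i" by linarith
    then show "map (\<lambda>v. v ! i) (take (Suc (card (x ! i) - 1)) (drop (\<Sum>j<i. card (x ! j) - 1) (map (psi x) [x, y])))
        \<in> chains (as_part (x ! i)) as_le (card (x ! i) - 1)"
    proof cases
      case 1
      then show ?thesis using i j(3)[of i] st[of i] m one[OF xi(1)] by (simp add: px py chains_def)
    next
      case 2
      then have "lt_of as_le [x ! j] (yss ! j)" using nej le1[OF part] xi i by (auto simp: lt_of_def)
      then show ?thesis using 2 i j(2) st[of i] m one[OF xi(1)] part[OF i] by (simp add: px py chains_def numeral_2_eq_2)
    next
      case 3
      then show ?thesis using i j(3)[of i] st[of i] m one[OF xi(1)] single[of i] by (simp add: px py chains_def)
    qed
  qed
qed

lemma chains_above: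
  assumes x: "x \<in> as_part S"
  shows "chains (above S x) as_le 1 = (\<lambda>y. [x, y]) ` {y \<in> as_part S. lt_of as_le x y}"
proof -
  have xx: "x \<in> above S x" using x as_le_refl by (auto simp: above_def)
  have m: "minimal_in (above S x) as_le u \<longleftrightarrow> u = x" for u
  proof
    assume "minimal_in (above S x) as_le u"
    then show "u = x" using xx by (auto simp: minimal_in_def above_def)
  next
    assume "u = x"
    moreover have "y = x" if "y \<in> above S x" "as_le y x" for y
      using that po.antisym[of y x] x by (simp add: above_def)
    ultimately show "minimal_in (above S x) as_le u" using xx by (simp add: minimal_in_def)
  qed
  show ?thesis
  proof (intro equalityI subsetI)
    fix z assume "z \<in> chains (above S x) as_le 1"
    then obtain u y where "z = [u, y]" "u = x" "y \<in> above S x" "lt_of as_le u y"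
      by (auto simp: chains_def length_Suc_conv m)
    then show "z \<in> (\<lambda>y. [x, y]) ` {y \<in> as_part S. lt_of as_le x y}" by (simp add: above_def)
  next
    fix z assume "z \<in> (\<lambda>y. [x, y]) ` {y \<in> as_part S. lt_of as_le x y}"
    then obtain y where "z = [x, y]" "y \<in> as_part S" "lt_of as_le x y" by auto
    then show "z \<in> chains (above S x) as_le 1" using xx m[of x] by (auto simp: chains_def lt_of_def above_def)
  qed
qed

text \<open>Nothing can be inserted in the middle of \<open>z\<close>: a chain of degree \<open>n - 1\<close> ends in a maximal element.
  So both sides run over the refinements of \<open>x\<close>, which split its unique two-element block.\<close>

lemma rho_two_block:
  assumes n: "card S = Suc (Suc p)" and z: "z \<in> chains (as_part S) as_le p" and x: "x = last z"
    and nm: "\<not> maximal_in (as_part S) as_le x"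
  shows "as_diff S p (symb z) = (\<lambda>u. (- 1) ^ Suc p *
     (rho x p (map (\<lambda>B. card B - 1) x) (symb (map (phi x) z)) (map full_cochain x) u :: 'k::comm_ring_1))"
    and "x \<in> as_part S" and "Suc (length x) = card S"
proof -
  have lz: "last z \<in> set z" "length z = Suc p" "z \<noteq> []" using z chains_nonempty[OF z] by (auto simp: chains_def)
  show xS: "x \<in> as_part S" using lz z x by (auto simp: chains_def)
  have "length x \<le> card S" "length x \<noteq> card S" "Suc p \<le> length x"
    using length_as_part[OF xS finS] full_maximal[OF xS] nm chain_length[OF z] x by auto
  then show lx: "Suc (length x) = card S" using n by simp
  let ?q = "map (\<lambda>B. card B - 1) x"
  have sq: "sum_list ?q = 1"
  proof -
    obtain j where j: "j < length x" "card (x ! j) = 2" "\<And>i. i < length x \<Longrightarrow> i \<noteq> j \<Longrightarrow> card (x ! i) = 1"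
      using two_block[OF xS lx] by blast
    have "sum_list ?q = (\<Sum>i<length x. card (x ! i) - 1)"
      unfolding sum_list_sum_nth by (simp add: atLeast0LessThan)
    also have "\<dots> = (\<Sum>i<length x. if i = j then 1 else 0)" by (rule sum.cong) (use j in auto)
    finally show ?thesis using j(1) by simp
  qed
  have UN: "\<Union>(set x) = S" using as_part_Union[OF xS] .
  have finb: "finite (blocks x)" by (simp add: blocks_def)
  have fin1: "finite (max_chains (below S x') as_le p)" for x'
    by (rule finite_subset[OF _ finite_chains[of "below S x'" as_le p]])
      (auto simp: max_chains_def below_def finite_as_part[OF finS])
  have fin2: "finite (max_chains (as_part (blocks x)) as_le p)"
    by (rule finite_subset[OF _ finite_chains[OF finite_as_part[OF finb]]]) (auto simp: max_chains_def)
  have fin3: "finite (chains (above S x') as_le m)" for x' m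
    by (rule finite_chains) (auto simp: above_def finite_as_part[OF finS])
  have fin4: "finite (chains (listset (map as_part x)) (list_all2 as_le) m)" for m
    using finite_chains[OF finite_listset_as_part] finite_block[OF xS] by blast
  let ?A = "\<lambda>x'. pullback (max_chains (below S x') as_le p) (max_chains (as_part (blocks x)) as_le p)
            (phi x') (symb (map (phi x) z)) :: _ \<Rightarrow> 'k"
  let ?B = "\<lambda>x'. pullback (chains (above S x') as_le 1) (chains (listset (map as_part x)) (list_all2 as_le) 1)
            (psi x) (kuenneth (map as_part x) as_le ?q (map full_cochain x)) :: _ \<Rightarrow> 'k"
  \<comment> \<open>A chain below \<open>x'\<close> is recovered from its image under
    \<open>phi x'\<close>, so the pullback of one symbol is again one symbol, and it occurs for one
    order of the blocks only.\<close>
  have A: "?A x' u = (if x' = x \<and> u = z then 1 else 0)"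
    if "x' \<in> as_part S" "set x' = set x" "u \<in> max_chains (below S x') as_le p" for x' u
    using phi_chain_unique[OF z x that] phi_chain[OF z x] chain_max_below[OF z x] that
    unfolding pullback_apply[OF fin1 fin2] by (auto simp: symb_def)
  have B: "?B x u = 1" if "u \<in> chains (above S x) as_le 1" for u
    using that psi_chain(1)[OF xS lx] psi_chain(2)[OF xS lx, where 'k='k] unfolding pullback_apply[OF fin3 fin4]
    unfolding chains_above[OF xS] by auto
  have cc: "concat_chains (max_chains (below S x') as_le p) (chains (above S x') as_le 1) (?A x') (?B x') u
      = (if x' = x then \<Sum>v\<in>chains (above S x) as_le 1. symb (z @ tl v) u else 0)"
    if x': "x' \<in> as_part S" "set x' = set x" for x' u
  proof (cases "x' = x")
    case True
    have zb: "z \<in> max_chains (below S x) as_le p" by (rule chain_max_below[OF z x])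
    have "concat_chains (max_chains (below S x') as_le p) (chains (above S x') as_le 1) (?A x') (?B x') u
      = (\<Sum>xs\<in>max_chains (below S x) as_le p. if xs = z then \<Sum>v\<in>chains (above S x) as_le 1. symb (z @ tl v) u else 0)"
      unfolding concat_chains_def True by (rule sum.cong[OF refl]) (use A[OF xS refl] B in simp)
    then show ?thesis using True zb fin1 by simp
  next
    case False
    then show ?thesis unfolding concat_chains_def using A[OF x'] by (auto intro!: sum.neutral)
  qed
  have fx: "finite {x' \<in> as_part S. set x' = set x}" using finite_as_part[OF finS] by simp
  have "rho x p ?q (symb (map (phi x) z)) (map full_cochain x) u
      = (\<Sum>x'\<in>{x' \<in> as_part S. set x' = set x}. if x' = x then \<Sum>v\<in>chains (above S x) as_le 1. symb (z @ tl v) u else (0::'k))" for u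
    unfolding rho_def Let_def UN sq by (rule sum.cong[OF refl]) (use cc in auto)
  then have r1: "rho x p ?q (symb (map (phi x) z)) (map full_cochain x) u
      = (\<Sum>v\<in>chains (above S x) as_le 1. symb (z @ tl v) u :: 'k)" for u
    using fx xS by simp
  have r2: "(\<Sum>v\<in>chains (above S x) as_le 1. symb (z @ tl v) u :: 'k)
      = (\<Sum>y\<in>{y \<in> as_part S. lt_of as_le x y}. symb (z @ [y]) u)" for u
    unfolding chains_above[OF xS] by (subst sum.reindex) (auto simp: inj_on_def)
  have d: "as_diff S p (symb z) u = (- 1) ^ Suc p * (\<Sum>y\<in>{y \<in> as_part S. lt_of as_le x y}. symb (z @ [y]) u :: 'k)" for u
  proof -
    have "as_diff S p (symb z) u = (\<Sum>w\<in>chains (as_part S) as_le p. if w = z then diff_sym (as_part S) as_le z u else (0::'k))"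
      unfolding diff_def lin_ext_def by (rule sum.cong) (auto simp: symb_def)
    also have "\<dots> = diff_sym (as_part S) as_le z u" using z finite_chains[OF finite_as_part[OF finS]] by simp
    also have "\<dots> = (\<Sum>i = 1..length z - 1. (- 1) ^ i * (\<Sum>y\<in>{y \<in> as_part S. lt_of as_le (z ! (i - 1)) y \<and> lt_of as_le y (z ! i)}.
           symb (take i z @ y # drop i z) u)) + (- 1) ^ Suc p * (\<Sum>y\<in>{y \<in> as_part S. lt_of as_le x y}. symb (z @ [y]) u)"
      unfolding diff_sym_def using lz x by simp
    also have "(\<Sum>i = 1..length z - 1. (- 1) ^ i * (\<Sum>y\<in>{y \<in> as_part S. lt_of as_le (z ! (i - 1)) y \<and> lt_of as_le y (z ! i)}.
           symb (take i z @ y # drop i z) u)) = (0::'k)"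
    proof (rule sum.neutral, rule ballI)
      fix i assume i: "i \<in> {1..length z - 1}"
      have "{y \<in> as_part S. lt_of as_le (z ! (i - 1)) y \<and> lt_of as_le y (z ! i)} = {}"
      proof (rule ccontr)
        assume "\<not> ?thesis"
        then obtain y where y: "y \<in> as_part S" "lt_of as_le (z ! (i - 1)) y" "lt_of as_le y (z ! i)" by blast
        have "take i z @ y # drop i z \<in> chains (as_part S) as_le (Suc p)"
          by (rule po.chains_insert[OF z]) (use y i lz in auto)
        then have "take i z @ y # drop i z \<in> max_chains (as_part S) as_le (card S - 1)"
          unfolding top_chains_max[symmetric] using n by simp
        then have "maximal_in (as_part S) as_le (last (take i z @ y # drop i z))"
          by (simp add: max_chains_def)
        moreover have "last (take i z @ y # drop i z) = x"
        proof -
          have "drop i z \<noteq> []" using i lz(2) by simp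
          then have "last (y # drop i z) = last z" using last_drop[of i z] lz(2) i by simp
          then show ?thesis using x by simp
        qed
        ultimately show False using nm by simp
      qed
      then show "(- 1) ^ i * (\<Sum>y\<in>{y \<in> as_part S. lt_of as_le (z ! (i - 1)) y \<and> lt_of as_le y (z ! i)}.
           symb (take i z @ y # drop i z) u) = (0::'k)" by (simp only: sum.empty mult_zero_right)
    qed
    finally show ?thesis by simp
  qed
  show "as_diff S p (symb z) = (\<lambda>u. (- 1) ^ Suc p *
     (rho x p ?q (symb (map (phi x) z)) (map full_cochain x) u :: 'k))"
    unfolding r1 r2 by (rule ext) (rule d)
qed

end

section \<open>Signs of reorderings\<close>

lemma before_nth: "(a, b) \<in> before l \<longleftrightarrow> (\<exists>i j. i < j \<and> j < length l \<and> l ! i = a \<and> l ! j = b)"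
proof (induction l)
  case (Cons c l)
  show ?case
  proof
    assume "(a, b) \<in> before (c # l)"
    then consider "a = c" "b \<in> set l" | "(a, b) \<in> before l" by auto
    then show "\<exists>i j. i < j \<and> j < length (c # l) \<and> (c # l) ! i = a \<and> (c # l) ! j = b"
    proof cases
      case 1
      then obtain j where "j < length l" "l ! j = b" by (auto simp: in_set_conv_nth)
      then show ?thesis using 1 by (intro exI[of _ 0] exI[of _ "Suc j"]) simp
    next
      case 2
      then obtain i j where "i < j" "j < length l" "l ! i = a" "l ! j = b" using Cons by blast
      then show ?thesis by (intro exI[of _ "Suc i"] exI[of _ "Suc j"]) simp
    qed
  next
    assume "\<exists>i j. i < j \<and> j < length (c # l) \<and> (c # l) ! i = a \<and> (c # l) ! j = b"
    then obtain i j where ij: "i < Suc j" "j < length l" "(c # l) ! i = a" "l ! j = b"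
      by (metis gr_implies_not_zero length_Cons less_Suc_eq_0_disj nth_Cons_Suc Suc_less_eq)
    then show "(a, b) \<in> before (c # l)" using Cons by (cases i) auto
  qed
qed simp

definition swapped :: "nat list \<Rightarrow> nat list \<Rightarrow> (nat \<times> nat) set" where
  "swapped v w = {(a, b). (a, b) \<in> before v \<and> (b, a) \<in> before w}"

lemma finite_before: "finite (before l)"
  by (rule finite_subset[OF before_set]) simp

lemma finite_swapped: "finite (swapped v w)"
  by (rule finite_subset[OF _ finite_before[of v]]) (auto simp: swapped_def)

text \<open>Counting pairs of entries instead of pairs of positions makes the sign additive over
  disjoint blocks and comparable with inversion sets.\<close>

lemma reorder_sign_swapped:
  assumes "distinct v"
  shows "reorder_sign v w = (- 1) ^ card (swapped v w)"
proof -
  let ?I = "{(i, j). i < j \<and> j < length v \<and> (\<exists>k l. k < l \<and> l < length w \<and> w ! k = v ! j \<and> w ! l = v ! i)}"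
  have I: "(i, j) \<in> ?I \<longleftrightarrow> i < j \<and> j < length v \<and> (v ! j, v ! i) \<in> before w" for i j
    by (auto simp: before_nth)
  have "bij_betw (\<lambda>(i, j). (v ! i, v ! j)) ?I (swapped v w)"
    unfolding bij_betw_def
  proof
    show "inj_on (\<lambda>(i, j). (v ! i, v ! j)) ?I"
      by (rule inj_onI) (use assms in \<open>auto simp: nth_eq_iff_index_eq\<close>)
    show "(\<lambda>(i, j). (v ! i, v ! j)) ` ?I = swapped v w"
    proof (intro equalityI subsetI)
      fix p assume "p \<in> (\<lambda>(i, j). (v ! i, v ! j)) ` ?I"
      then obtain i j where "(i, j) \<in> ?I" "p = (v ! i, v ! j)" by auto
      then show "p \<in> swapped v w" unfolding I swapped_def before_nth[of _ _ v] by blast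
    next
      fix p assume "p \<in> swapped v w"
      then obtain i j where "i < j" "j < length v" "p = (v ! i, v ! j)" "(v ! j, v ! i) \<in> before w"
        unfolding swapped_def before_nth[of _ _ v] by blast
      then have "(i, j) \<in> ?I" unfolding I by blast
      then show "p \<in> (\<lambda>(i, j). (v ! i, v ! j)) ` ?I" using \<open>p = _\<close> by (metis (no_types, lifting) case_prod_conv image_eqI)
    qed
  qed
  then show ?thesis unfolding reorder_sign_def by (simp add: bij_betw_same_card)
qed

definition order_sign :: "nat list \<Rightarrow> 'k::comm_ring_1" where
  "order_sign v = (- 1) ^ card {(a, b). a < b \<and> (b, a) \<in> before v}"

lemma order_sign_square: "order_sign v * order_sign v = (1 :: 'k::comm_ring_1)"
  by (simp add: order_sign_def power_add[symmetric] mult_2[symmetric])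

lemma neg_one_symdiff:
  assumes "finite A" "finite B"
  shows "(- 1) ^ card ((A - B) \<union> (B - A)) = ((- 1) ^ card A * (- 1) ^ card B :: 'k::comm_ring_1)"
proof -
  have "card ((A - B) \<union> (B - A)) = card (A - B) + card (B - A)"
    using assms by (intro card_Un_disjoint) auto
  moreover have "card A = card (A - B) + card (A \<inter> B)" "card B = card (B - A) + card (A \<inter> B)"
    using assms card_Int_Diff[of A B] card_Int_Diff[of B A] by (simp_all add: Int_commute)
  ultimately have e: "card A + card B = card ((A - B) \<union> (B - A)) + 2 * card (A \<inter> B)" by simp
  show ?thesis unfolding power_add[symmetric] e by (simp add: power_add power_mult)
qed

text \<open>The pairs on which \<open>v\<close> and \<open>w\<close> disagree, written increasingly,
  form the symmetric difference of the two inversion sets. As \<open>order_sign\<close> squares to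
  one, this factorisation makes \<open>reorder_sign\<close> multiplicative along a sequence of
  enumerations.\<close>

lemma reorder_sign_eq:
  assumes v: "v \<in> lin_orders S" and w: "w \<in> lin_orders S"
  shows "reorder_sign v w = (order_sign v * order_sign w :: 'k::comm_ring_1)"
proof -
  have d: "distinct v" "set v = S" "distinct w" "set w = S" using v w by (auto simp: lin_orders_def)
  define D where "D v = {(a, b). a < b \<and> (b, a) \<in> before v}" for v :: "nat list"
  have finD: "finite (D v)" for v
    by (rule finite_subset[of _ "(\<lambda>(a, b). (b, a)) ` before v"]) (auto simp: D_def finite_before image_iff)
  let ?m = "\<lambda>(a, b). (min a b, max a b) :: nat \<times> nat"
  have asym: "(a, b) \<in> before v \<Longrightarrow> (b, a) \<notin> before v" "(a, b) \<in> before w \<Longrightarrow> (b, a) \<notin> before w" for a b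
    using before_antisym[OF d(1), of a b] before_antisym[OF d(3), of a b] by simp_all
  have tot: "a \<in> S \<Longrightarrow> b \<in> S \<Longrightarrow> a \<noteq> b \<Longrightarrow> (a, b) \<in> before v \<or> (b, a) \<in> before v"
      "a \<in> S \<Longrightarrow> b \<in> S \<Longrightarrow> a \<noteq> b \<Longrightarrow> (a, b) \<in> before w \<or> (b, a) \<in> before w" for a b
    using before_total[of a v b] before_total[of a w b] d by auto
  have inS: "(a, b) \<in> before v \<Longrightarrow> a \<in> S \<and> b \<in> S" "(a, b) \<in> before w \<Longrightarrow> a \<in> S \<and> b \<in> S" for a b
    using before_set[of v] before_set[of w] d by auto
  have img: "?m ` swapped v w = (D v - D w) \<union> (D w - D v)"
  proof (intro equalityI subsetI)
    fix p assume "p \<in> ?m ` swapped v w"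
    then obtain a b where ab: "(a, b) \<in> before v" "(b, a) \<in> before w" "p = (min a b, max a b)"
      by (auto simp: swapped_def)
    then have "a \<noteq> b" using asym(1)[of a b] by auto
    then show "p \<in> (D v - D w) \<union> (D w - D v)"
      using ab asym[of a b] asym[of b a] by (cases "a < b") (auto simp: D_def min_def max_def)
  next
    fix p assume p: "p \<in> (D v - D w) \<union> (D w - D v)"
    then obtain a b where ab: "p = (a, b)" "a < b" by (auto simp: D_def)
    then have sw: "(b, a) \<in> swapped v w \<or> (a, b) \<in> swapped v w"
      using p inS[of b a] tot[of a b] asym[of a b] asym[of b a] unfolding swapped_def D_def by auto
    have m: "p = ?m (b, a)" "p = ?m (a, b)" using ab by auto
    from sw show "p \<in> ?m ` swapped v w"
    proof
      assume "(b, a) \<in> swapped v w"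
      then show ?thesis by (rule image_eqI[where f = ?m, OF m(1)])
    next
      assume "(a, b) \<in> swapped v w"
      then show ?thesis by (rule image_eqI[where f = ?m, OF m(2)])
    qed
  qed
  have inj: "inj_on ?m (swapped v w)"
  proof (rule inj_onI)
    fix p q assume pq: "p \<in> swapped v w" "q \<in> swapped v w" "?m p = ?m q"
    obtain a b c e where e: "p = (a, b)" "q = (c, e)" by fastforce
    then have "(c, e) = (a, b) \<or> (c, e) = (b, a)" using pq(3) by (auto simp: min_def max_def split: if_splits)
    then show "p = q" using pq e asym(1)[of a b] by (auto simp: swapped_def)
  qed
  have "card (swapped v w) = card ((D v - D w) \<union> (D w - D v))"
    unfolding img[symmetric] by (rule card_image[OF inj, symmetric])
  then show ?thesis
    using neg_one_symdiff[OF finD finD] by (simp add: reorder_sign_swapped[OF d(1)] order_sign_def D_def)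
qed

lemma swapped_append:
  assumes "set v1 = set w1" "set v2 = set w2" "set v1 \<inter> set v2 = {}"
  shows "swapped (v1 @ v2) (w1 @ w2) = swapped v1 w1 \<union> swapped v2 w2"
proof (rule set_eqI)
  fix p :: "nat \<times> nat"
  obtain a b where p: "p = (a, b)" by (cases p)
  have m: "(x, y) \<in> before v1 \<Longrightarrow> x \<in> set v1 \<and> y \<in> set v1" "(x, y) \<in> before w1 \<Longrightarrow> x \<in> set v1 \<and> y \<in> set v1"
    "(x, y) \<in> before v2 \<Longrightarrow> x \<in> set v2 \<and> y \<in> set v2" "(x, y) \<in> before w2 \<Longrightarrow> x \<in> set v2 \<and> y \<in> set v2" for x y
    using before_set[of v1] before_set[of w1] before_set[of v2] before_set[of w2] assms(1,2) by auto
  have d: "x \<in> set v1 \<Longrightarrow> x \<notin> set v2" for x using assms(3) by auto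
  show "p \<in> swapped (v1 @ v2) (w1 @ w2) \<longleftrightarrow> p \<in> swapped v1 w1 \<union> swapped v2 w2"
    unfolding p swapped_def before_append assms(1,2)[symmetric] using m d by blast
qed

lemma reorder_sign_append:
  assumes "set v1 = set w1" "set v2 = set w2" "set v1 \<inter> set v2 = {}" "distinct v1" "distinct v2"
  shows "reorder_sign (v1 @ v2) (w1 @ w2) = (reorder_sign v1 w1 * reorder_sign v2 w2 :: 'k::comm_ring_1)"
proof -
  have "swapped v1 w1 \<inter> swapped v2 w2 = {}"
    using assms(3) before_set[of v1] before_set[of v2] unfolding swapped_def by blast
  then have "card (swapped (v1 @ v2) (w1 @ w2)) = card (swapped v1 w1) + card (swapped v2 w2)"
    unfolding swapped_append[OF assms(1-3)] by (intro card_Un_disjoint finite_swapped)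
  then show ?thesis using assms by (simp add: reorder_sign_swapped power_add)
qed

lemma reorder_sign_concat:
  assumes "Ts \<in> as_part S" "\<And>T. T \<in> set Ts \<Longrightarrow> f T \<in> lin_orders T \<and> g T \<in> lin_orders T"
  shows "reorder_sign (concat (map f Ts)) (concat (map g Ts)) = (\<Prod>i<length Ts. reorder_sign (f (Ts ! i)) (g (Ts ! i)) :: 'k::comm_ring_1)
     \<and> concat (map f Ts) \<in> lin_orders S"
  using assms
proof (induction Ts arbitrary: S)
  case Nil
  then show ?case by (auto simp: as_part_Nil lin_orders_def reorder_sign_def)
next
  case (Cons T Ts)
  have T: "T \<subseteq> S" "Ts \<in> as_part (S - T)" using Cons.prems(1) by (auto simp: as_part_Cons)
  have IH: "reorder_sign (concat (map f Ts)) (concat (map g Ts)) = (\<Prod>i<length Ts. reorder_sign (f (Ts ! i)) (g (Ts ! i)) :: 'k)"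
     "concat (map f Ts) \<in> lin_orders (S - T)" using Cons.IH[OF T(2)] Cons.prems(2) by auto
  have sets: "set (f T) = T" "set (g T) = T" "distinct (f T)" using Cons.prems(2)[of T] by (auto simp: lin_orders_def)
  have "set (g U) = set (f U)" if "U \<in> set Ts" for U using Cons.prems(2)[of U] that by (auto simp: lin_orders_def)
  then have "set (concat (map g Ts)) = S - T" using IH(2) by (auto simp: lin_orders_def)
  then have "reorder_sign (f T @ concat (map f Ts)) (g T @ concat (map g Ts))
      = (reorder_sign (f T) (g T) * reorder_sign (concat (map f Ts)) (concat (map g Ts)) :: 'k)"
    using IH(2) sets by (intro reorder_sign_append) (auto simp: lin_orders_def)
  moreover have "f T @ concat (map f Ts) \<in> lin_orders S" using IH(2) sets T(1) by (auto simp: lin_orders_def)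
  ultimately show ?case using IH(1) by (simp add: prod.lessThan_Suc_shift del: prod.lessThan_Suc)
qed

lemma reorder_sign_map:
  assumes "inj_on \<sigma> A" "set v \<subseteq> A" "set w \<subseteq> A"
  shows "reorder_sign (map \<sigma> v) (map \<sigma> w) = reorder_sign v w"
proof -
  have *: "map \<sigma> w ! k = map \<sigma> v ! j \<longleftrightarrow> w ! k = v ! j" if "k < length w" "j < length v" for k j
    using assms that by (simp add: inj_on_eq_iff subset_iff)
  have P: "(i < j \<and> j < length (map \<sigma> v) \<and> (\<exists>k l. k < l \<and> l < length (map \<sigma> w) \<and> map \<sigma> w ! k = map \<sigma> v ! j \<and> map \<sigma> w ! l = map \<sigma> v ! i))
     \<longleftrightarrow> (i < j \<and> j < length v \<and> (\<exists>k l. k < l \<and> l < length w \<and> w ! k = v ! j \<and> w ! l = v ! i))" for i j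
    unfolding length_map
  proof (intro conj_cong refl ex_cong1)
    fix k l assume "i < j" "j < length v" "k < l" "l < length w"
    then show "map \<sigma> w ! k = map \<sigma> v ! j \<longleftrightarrow> w ! k = v ! j" "map \<sigma> w ! l = map \<sigma> v ! i \<longleftrightarrow> w ! l = v ! i"
      using *[of k j] *[of l i] by auto
  qed
  show ?thesis unfolding reorder_sign_def P ..
qed

section \<open>The operads \<open>\<Lambda>\<^sup>-\<^sup>1As\<close> and \<open>\<Lambda>\<^sup>-\<^sup>1Com\<close>\<close>

lemma finite_lin_orders: "finite S \<Longrightarrow> finite (lin_orders S)"
  by (rule finite_subset[OF _ finite_subset_distinct[of S]]) (auto simp: lin_orders_def)

lemma lin_orders_nonempty: "finite S \<Longrightarrow> lin_orders S \<noteq> {}"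
  using finite_distinct_list[of S] by (auto simp: lin_orders_def)

lemma As_simps:
  "scale As S n k a = (\<lambda>l. k * a l)" "zero_elt As S n = (\<lambda>_. 0)" "relabel As S n \<sigma> = lin_ext (lin_orders S) (\<lambda>l. symb (map \<sigma> l))"
  "add As S n a b = (\<lambda>l. a l + b l)"
  by (simp_all add: As_def)

lemma Com_simps:
  "scale Com S n k a = k * a" "zero_elt Com S n = 0" "relabel Com S n \<sigma> a = a"
  "add Com S n a b = a + b" "compose Com Ts p qs a bs = a * prod_list bs"
  by (simp_all add: Com_def)

lemma desusp_As_piece:
  "F \<in> piece (desusp As) S n \<longleftrightarrow> (if n = card S - 1
     then (\<forall>w. w \<notin> lin_orders S \<longrightarrow> F w = (\<lambda>_. 0)) \<and> (\<forall>w\<in>lin_orders S. F w \<in> free_mod (lin_orders S))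
        \<and> (\<forall>v\<in>lin_orders S. \<forall>w\<in>lin_orders S. F v = (\<lambda>l. reorder_sign v w * F w l))
     else F = (\<lambda>_ _. 0 :: 'k::comm_ring_1))"
  by (simp add: desusp_def As_def)

lemma desusp_Com_piece:
  "F \<in> piece (desusp Com) S n \<longleftrightarrow> (if n = card S - 1
     then (\<forall>w. w \<notin> lin_orders S \<longrightarrow> F w = 0)
        \<and> (\<forall>v\<in>lin_orders S. \<forall>w\<in>lin_orders S. F v = reorder_sign v w * F w)
     else F = (\<lambda>_. 0 :: 'k::comm_ring_1))"
  by (simp add: desusp_def Com_def)

lemma desusp_AsI:
  assumes "\<And>w. w \<notin> lin_orders S \<Longrightarrow> F w = (\<lambda>_. 0)" "\<And>w. w \<in> lin_orders S \<Longrightarrow> F w \<in> free_mod (lin_orders S)"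
    "\<And>v w. v \<in> lin_orders S \<Longrightarrow> w \<in> lin_orders S \<Longrightarrow> F v = (\<lambda>l. reorder_sign v w * F w l)"
  shows "F \<in> piece (desusp As) S (card S - 1)"
  unfolding desusp_As_piece if_P[OF refl] using assms by blast

lemma desusp_AsD:
  assumes "F \<in> piece (desusp As) S (card S - 1)"
  shows "w \<notin> lin_orders S \<Longrightarrow> F w = (\<lambda>_. 0)" "w \<in> lin_orders S \<Longrightarrow> F w \<in> free_mod (lin_orders S)"
    "v \<in> lin_orders S \<Longrightarrow> w \<in> lin_orders S \<Longrightarrow> F v = (\<lambda>l. reorder_sign v w * F w l)"
  using assms unfolding desusp_As_piece if_P[OF refl] by blast+

lemma desusp_ComI:
  assumes "\<And>w. w \<notin> lin_orders S \<Longrightarrow> F w = 0"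
    "\<And>v w. v \<in> lin_orders S \<Longrightarrow> w \<in> lin_orders S \<Longrightarrow> F v = reorder_sign v w * F w"
  shows "F \<in> piece (desusp Com) S (card S - 1)"
  unfolding desusp_Com_piece if_P[OF refl] using assms by blast

lemma desusp_ComD:
  assumes "F \<in> piece (desusp Com) S (card S - 1)"
  shows "w \<notin> lin_orders S \<Longrightarrow> F w = 0"
    "v \<in> lin_orders S \<Longrightarrow> w \<in> lin_orders S \<Longrightarrow> F v = reorder_sign v w * F w"
  using assms unfolding desusp_Com_piece if_P[OF refl] by blast+

lemma As_to_Com_scale: "As_to_Com S n (\<lambda>l. k * a l) = k * As_to_Com S n a"
  by (simp add: As_to_Com_def sum_distrib_left)

lemma As_to_Com_zero: "As_to_Com S n (\<lambda>_. 0) = 0"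
  by (simp add: As_to_Com_def)

lemma As_to_Com_add: "As_to_Com S n (\<lambda>l. a l + b l) = As_to_Com S n a + As_to_Com S n b"
  by (simp add: As_to_Com_def sum.distrib)

lemma desusp_map_piece:
  assumes F: "F \<in> piece (desusp As) S (card S - 1)"
  shows "desusp_map As_to_Com S n F \<in> piece (desusp Com) S (card S - 1)"
proof -
  have eq: "As_to_Com S 0 (F v) = reorder_sign v w * As_to_Com S 0 (F w)"
    if "v \<in> lin_orders S" "w \<in> lin_orders S" for v w
  proof -
    show ?thesis by (subst desusp_AsD(3)[OF F that]) (rule As_to_Com_scale)
  qed
  show ?thesis unfolding desusp_map_def
  proof (rule desusp_ComI)
    show "As_to_Com S 0 (F w) = 0" if "w \<notin> lin_orders S" for w
      by (simp only: desusp_AsD(1)[OF F that] As_to_Com_zero)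
  qed (rule eq)
qed

lemma desusp_map_surj:
  assumes S: "finite S" and G: "G \<in> piece (desusp Com) S (card S - 1)"
  shows "\<exists>F\<in>piece (desusp As) S (card S - 1). desusp_map As_to_Com S n F = (G :: _ \<Rightarrow> 'k::comm_ring_1)"
proof -
  obtain l where l: "l \<in> lin_orders S" using lin_orders_nonempty[OF S] by auto
  \<comment> \<open>All values are placed on one fixed linear order \<open>l\<close>; the sign rule
    for \<open>F\<close> is then the one for \<open>G\<close>.\<close>
  define F where "F w = (\<lambda>z. G w * symb l z)" for w
  have "F \<in> piece (desusp As) S (card S - 1)"
  proof (rule desusp_AsI)
    show "F v = (\<lambda>z. reorder_sign v w * F w z)" if "v \<in> lin_orders S" "w \<in> lin_orders S" for v w
      unfolding F_def by (subst desusp_ComD(2)[OF G that]) (simp only: mult.assoc)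
    show "F w \<in> free_mod (lin_orders S)" for w using l by (auto simp: F_def free_mod_def symb_def)
  qed (simp add: F_def desusp_ComD(1)[OF G])
  moreover have "As_to_Com S 0 (F w) = G w" for w
    using l finite_lin_orders[OF S] by (simp add: As_to_Com_def F_def symb_def if_distrib[of "\<lambda>t. _ * t"] cong: if_cong)
  ultimately show ?thesis by (intro bexI[of _ F]) (auto simp: desusp_map_def)
qed

lemma desusp_As_add:
  assumes "F \<in> piece (desusp As) S (card S - 1)" "G \<in> piece (desusp As) S (card S - 1)"
  shows "add (desusp As) S n F G \<in> piece (desusp As) S (card S - 1)"
    and "desusp_map As_to_Com S m (add (desusp As) S n F G)
      = (\<lambda>w. desusp_map As_to_Com S m F w + desusp_map As_to_Com S m G w)"
proof -
  have e: "add (desusp As) S n F G = (\<lambda>w l. F w l + G w l)" by (simp add: desusp_def As_def)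
  have eq: "(\<lambda>l. F v l + G v l) = (\<lambda>l. reorder_sign v w * (F w l + G w l))"
    if "v \<in> lin_orders S" "w \<in> lin_orders S" for v w
  proof -
    show ?thesis unfolding distrib_left
      by (subst desusp_AsD(3)[OF assms(1) that], subst desusp_AsD(3)[OF assms(2) that]) (rule refl)
  qed
  have fr: "(\<lambda>l. F w l + G w l) \<in> free_mod (lin_orders S)" if "w \<in> lin_orders S" for w
    using desusp_AsD(2)[OF assms(1) that] desusp_AsD(2)[OF assms(2) that] by (simp add: free_mod_def)
  show "add (desusp As) S n F G \<in> piece (desusp As) S (card S - 1)"
    unfolding e by (rule desusp_AsI, simp add: desusp_AsD(1)[OF assms(1)] desusp_AsD(1)[OF assms(2)], erule fr, rule eq)
  show "desusp_map As_to_Com S m (add (desusp As) S n F G)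
      = (\<lambda>w. desusp_map As_to_Com S m F w + desusp_map As_to_Com S m G w)"
    unfolding e by (simp add: desusp_map_def As_to_Com_add)
qed

lemma desusp_As_scale:
  assumes "F \<in> piece (desusp As) S (card S - 1)"
  shows "scale (desusp As) S n k F \<in> piece (desusp As) S (card S - 1)"
    and "desusp_map As_to_Com S m (scale (desusp As) S n k F) = (\<lambda>w. k * desusp_map As_to_Com S m F w)"
proof -
  have e: "scale (desusp As) S n k F = (\<lambda>w l. k * F w l)" by (simp add: desusp_def As_def)
  have eq: "(\<lambda>l. k * F v l) = (\<lambda>l. reorder_sign v w * (k * F w l))"
    if "v \<in> lin_orders S" "w \<in> lin_orders S" for v w
  proof -
    show ?thesis by (subst desusp_AsD(3)[OF assms that]) (simp only: mult.left_commute)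
  qed
  have fr: "(\<lambda>l. k * F w l) \<in> free_mod (lin_orders S)" if "w \<in> lin_orders S" for w
    using desusp_AsD(2)[OF assms that] by (simp add: free_mod_def)
  show "scale (desusp As) S n k F \<in> piece (desusp As) S (card S - 1)"
    unfolding e by (rule desusp_AsI, simp add: desusp_AsD(1)[OF assms], erule fr, rule eq)
  show "desusp_map As_to_Com S m (scale (desusp As) S n k F) = (\<lambda>w. k * desusp_map As_to_Com S m F w)"
    unfolding e by (simp add: desusp_map_def As_to_Com_scale)
qed

lemma lin_orders_map: "inj_on \<sigma> S \<Longrightarrow> l \<in> lin_orders S \<Longrightarrow> map \<sigma> l \<in> lin_orders (\<sigma> ` S)"
  by (auto simp: lin_orders_def distinct_map)

lemma lin_orders_map_inv: "inj_on \<sigma> S \<Longrightarrow> w \<in> lin_orders (\<sigma> ` S) \<Longrightarrow> map (inv_into S \<sigma>) w \<in> lin_orders S"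
  using lin_orders_map[of "inv_into S \<sigma>" "\<sigma> ` S" w] by (simp add: inj_on_inv_into)

lemma desusp_As_relabel:
  assumes S: "finite S" and \<sigma>: "inj_on \<sigma> S" and F: "F \<in> piece (desusp As) S (card S - 1)"
  shows "relabel (desusp As) S n \<sigma> F \<in> piece (desusp As) (\<sigma> ` S) (card S - 1)"
    and "desusp_map As_to_Com (\<sigma> ` S) n' (relabel (desusp As) S n \<sigma> F)
       = relabel (desusp Com) S n (\<sigma>) (desusp_map As_to_Com S n' F :: _ \<Rightarrow> 'k::comm_ring_1)"
proof -
  let ?L = "lin_ext (lin_orders S) (\<lambda>l. symb (map \<sigma> l)) :: (nat list \<Rightarrow> 'k) \<Rightarrow> _"
  have e: "relabel (desusp As) S n \<sigma> F = (\<lambda>w. if w \<in> lin_orders (\<sigma> ` S) then ?L (F (map (inv_into S \<sigma>) w)) else (\<lambda>_. 0))"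
    by (simp add: desusp_def As_simps cong: if_cong)
  have L0: "?L c \<in> free_mod (lin_orders (\<sigma> ` S))" for c
    using lin_orders_map[OF \<sigma>] by (auto simp: free_mod_def lin_ext_def symb_def intro!: sum.neutral)
  have Ls: "?L (\<lambda>l. k * c l) = (\<lambda>l. k * ?L c l)" for k c
    by (simp add: lin_ext_def sum_distrib_left mult.assoc)
  have inv: "?L (F (map (inv_into S \<sigma>) v)) = (\<lambda>l. reorder_sign v w * ?L (F (map (inv_into S \<sigma>) w)) l)"
    if v: "v \<in> lin_orders (\<sigma> ` S)" and w: "w \<in> lin_orders (\<sigma> ` S)" for v w
  proof -
    have "F (map (inv_into S \<sigma>) v) = (\<lambda>l. reorder_sign (map (inv_into S \<sigma>) v) (map (inv_into S \<sigma>) w) * F (map (inv_into S \<sigma>) w) l)"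
      by (rule desusp_AsD(3)[OF F lin_orders_map_inv[OF \<sigma> v] lin_orders_map_inv[OF \<sigma> w]])
    moreover have "reorder_sign (map (inv_into S \<sigma>) v) (map (inv_into S \<sigma>) w) = (reorder_sign v w :: 'k)"
      by (rule reorder_sign_map[OF inj_on_inv_into[of "\<sigma> ` S"]]) (use v w in \<open>auto simp: lin_orders_def\<close>)
    ultimately show ?thesis by (simp only: Ls)
  qed
  have "(\<lambda>w. if w \<in> lin_orders (\<sigma> ` S) then ?L (F (map (inv_into S \<sigma>) w)) else (\<lambda>_. 0))
      \<in> piece (desusp As) (\<sigma> ` S) (card (\<sigma> ` S) - 1)"
  proof (rule desusp_AsI)
    fix v w assume vw: "v \<in> lin_orders (\<sigma> ` S)" "w \<in> lin_orders (\<sigma> ` S)"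
    show "(if v \<in> lin_orders (\<sigma> ` S) then ?L (F (map (inv_into S \<sigma>) v)) else (\<lambda>_. 0))
      = (\<lambda>l. reorder_sign v w * (if w \<in> lin_orders (\<sigma> ` S) then ?L (F (map (inv_into S \<sigma>) w)) else (\<lambda>_. 0)) l)"
      unfolding if_P[OF vw(1)] if_P[OF vw(2)] by (rule inv[OF vw])
  qed (simp_all add: L0)
  then show "relabel (desusp As) S n \<sigma> F \<in> piece (desusp As) (\<sigma> ` S) (card S - 1)"
    unfolding e card_image[OF \<sigma>] .
  have sum: "As_to_Com (\<sigma> ` S) 0 (?L c) = As_to_Com S 0 c" for c
  proof -
    have "As_to_Com (\<sigma> ` S) 0 (?L c) = (\<Sum>l\<in>lin_orders S. \<Sum>z\<in>lin_orders (\<sigma> ` S). c l * symb (map \<sigma> l) z)"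
      unfolding As_to_Com_def lin_ext_def by (rule sum.swap)
    also have "\<dots> = (\<Sum>l\<in>lin_orders S. c l)"
    proof (rule sum.cong[OF refl])
      fix l assume "l \<in> lin_orders S"
      then show "(\<Sum>z\<in>lin_orders (\<sigma> ` S). c l * symb (map \<sigma> l) z) = c l"
        using lin_orders_map[OF \<sigma>] finite_lin_orders[of "\<sigma> ` S"] S
        by (simp add: symb_def if_distrib[of "\<lambda>t. _ * t"] cong: if_cong)
    qed
    finally show ?thesis by (simp add: As_to_Com_def)
  qed
  show "desusp_map As_to_Com (\<sigma> ` S) n' (relabel (desusp As) S n \<sigma> F)
       = relabel (desusp Com) S n (\<sigma>) (desusp_map As_to_Com S n' F)"
    unfolding e using sum by (auto simp: desusp_map_def desusp_def Com_simps As_to_Com_zero fun_eq_iff)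
qed

lemma prod_list_map2: "length xs = length ys \<Longrightarrow> prod_list (map2 f xs ys) = (\<Prod>i<length xs. f (xs ! i) (ys ! i) :: 'k::comm_ring_1)"
proof (induction xs ys rule: list_induct2)
  case (Cons x xs y ys)
  then show ?case by (simp add: prod.lessThan_Suc_shift del: prod.lessThan_Suc)
qed simp

lemma sum_listset_prod:
  fixes f :: "nat \<Rightarrow> 'a \<Rightarrow> 'k::comm_ring_1"
  assumes "\<And>A. A \<in> set Xs \<Longrightarrow> finite A"
  shows "(\<Sum>xs\<in>listset Xs. \<Prod>i<length Xs. f i (xs ! i)) = (\<Prod>i<length Xs. \<Sum>x\<in>Xs ! i. f i x)"
  using assms
proof (induction Xs arbitrary: f)
  case (Cons A Xs)
  have e: "listset (A # Xs) = (\<lambda>(a, as). a # as) ` (A \<times> listset Xs)" by (auto simp: set_Cons_def)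
  have "(\<Sum>xs\<in>listset (A # Xs). \<Prod>i<length (A # Xs). f i (xs ! i))
      = (\<Sum>(a, as)\<in>A \<times> listset Xs. \<Prod>i<length (A # Xs). f i ((a # as) ! i))"
    unfolding e by (subst sum.reindex) (auto simp: inj_on_def intro!: sum.cong)
  also have "\<dots> = (\<Sum>(a, as)\<in>A \<times> listset Xs. f 0 a * (\<Prod>i<length Xs. f (Suc i) (as ! i)))"
    by (rule sum.cong) (auto simp: prod.lessThan_Suc_shift simp del: prod.lessThan_Suc)
  also have "\<dots> = (\<Sum>a\<in>A. f 0 a) * (\<Sum>as\<in>listset Xs. \<Prod>i<length Xs. f (Suc i) (as ! i))"
    by (simp add: sum.cartesian_product[symmetric] sum_product)
  also have "\<dots> = (\<Sum>a\<in>A. f 0 a) * (\<Prod>i<length Xs. \<Sum>x\<in>Xs ! i. f (Suc i) x)"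
    using Cons.IH[of "\<lambda>i. f (Suc i)"] Cons.prems by simp
  also have "\<dots> = (\<Prod>i<length (A # Xs). \<Sum>x\<in>(A # Xs) ! i. f i x)"
    by (simp add: prod.lessThan_Suc_shift del: prod.lessThan_Suc)
  finally show ?case .
qed simp

context ordered_partitions
begin

lemma subst_orders_lin:
  assumes Ts: "Ts \<in> as_part S" and xi: "\<xi> \<in> lin_orders (blocks Ts)" and ls: "ls \<in> listset (map lin_orders Ts)"
  shows "subst_orders Ts \<xi> ls \<in> lin_orders S"
proof -
  define f where "f t = the (map_of (zip (map set_encode Ts) ls) t)" for t
  have so: "subst_orders Ts \<xi> ls = concat (map f \<xi>)" by (simp add: subst_orders_def f_def[abs_def])
  have dk: "distinct (map set_encode Ts)" using inj_encode[OF Ts] Ts by (simp add: distinct_map as_part_def)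
  have len: "length ls = length Ts" using ls by (simp add: listset_iff)
  have f: "f (set_encode (Ts ! i)) = ls ! i" if "i < length Ts" for i
    unfolding f_def using map_of_zip_nth[of "map set_encode Ts" ls i] dk len that by simp
  have li: "distinct (ls ! i)" "set (ls ! i) = Ts ! i" if "i < length Ts" for i
    using ls that by (auto simp: listset_iff lin_orders_def)
  have xiT: "t \<in> set \<xi> \<longleftrightarrow> (\<exists>i<length Ts. t = set_encode (Ts ! i))" for t
  proof -
    have "set \<xi> = set_encode ` set Ts" using xi by (simp add: lin_orders_def blocks_def)
    then show ?thesis unfolding set_conv_nth[of Ts] by auto
  qed
  have ft: "\<exists>i<length Ts. t = set_encode (Ts ! i) \<and> distinct (f t) \<and> set (f t) = Ts ! i" if "t \<in> set \<xi>" for t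
    using that xiT f li by metis
  have dis: "set (f t) \<inter> set (f u) = {}" if tu: "t \<in> set \<xi>" "u \<in> set \<xi>" "t \<noteq> u" for t u
  proof -
    obtain i j where ij: "i < length Ts" "t = set_encode (Ts ! i)" "set (f t) = Ts ! i"
        "j < length Ts" "u = set_encode (Ts ! j)" "set (f u) = Ts ! j" using ft tu by metis
    then have "i \<noteq> j" using tu by auto
    then show ?thesis using as_part_nth_eq[OF Ts ij(1) ij(4)] ij by auto
  qed
  have ne: "f t \<noteq> []" if t: "t \<in> set \<xi>" for t
  proof -
    obtain i where "i < length Ts" "set (f t) = Ts ! i" using ft[OF t] by blast
    then show ?thesis using as_part_nonempty[OF Ts, of "Ts ! i"] by auto
  qed
  have "distinct (map f \<xi>)"
    unfolding distinct_map
  proof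
    show "inj_on f (set \<xi>)"
    proof (rule inj_onI, rule ccontr)
      fix t u assume "t \<in> set \<xi>" "u \<in> set \<xi>" "f t = f u" "t \<noteq> u"
      then show False using dis[of t u] ne[of t] by simp
    qed
  qed (use xi in \<open>simp add: lin_orders_def\<close>)
  then have "distinct (subst_orders Ts \<xi> ls)"
    unfolding so
  proof (rule distinct_concat)
    show "distinct ys" if ys: "ys \<in> set (map f \<xi>)" for ys
    proof -
      obtain t where "t \<in> set \<xi>" "ys = f t" using ys by auto
      then show ?thesis using ft[of t] by blast
    qed
    show "set ys \<inter> set zs = {}" if yz: "ys \<in> set (map f \<xi>)" "zs \<in> set (map f \<xi>)" "ys \<noteq> zs" for ys zs
    proof -
      obtain t u where "t \<in> set \<xi>" "u \<in> set \<xi>" "ys = f t" "zs = f u" using yz by auto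
      then show ?thesis using dis[of t u] yz(3) by auto
    qed
  qed
  moreover have "set (subst_orders Ts \<xi> ls) = S"
  proof -
    have "set (subst_orders Ts \<xi> ls) = (\<Union>t\<in>set \<xi>. set (f t))" by (simp add: so)
    also have "\<dots> = (\<Union>i<length Ts. Ts ! i)"
    proof (intro equalityI subsetI)
      fix a assume "a \<in> (\<Union>t\<in>set \<xi>. set (f t))"
      then show "a \<in> (\<Union>i<length Ts. Ts ! i)" using ft by blast
    next
      fix a assume "a \<in> (\<Union>i<length Ts. Ts ! i)"
      then obtain i where i: "i < length Ts" "a \<in> Ts ! i" by auto
      then have "set_encode (Ts ! i) \<in> set \<xi>" "a \<in> set (f (set_encode (Ts ! i)))" using xiT f li by auto
      then show "a \<in> (\<Union>t\<in>set \<xi>. set (f t))" by blast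
    qed
    also have "\<dots> = \<Union>(set Ts)" by (auto simp: set_conv_nth)
    also have "\<dots> = S" by (rule as_part_Union[OF Ts])
    finally show ?thesis .
  qed
  ultimately show ?thesis by (simp add: lin_orders_def)
qed

lemma compose_As_free:
  assumes "Ts \<in> as_part S"
  shows "compose As Ts p qs a bs \<in> (free_mod (lin_orders S) :: (nat list \<Rightarrow> 'k::comm_ring_1) set)"
proof -
  have "(\<Sum>\<xi>\<in>lin_orders (blocks Ts). \<Sum>ls\<in>listset (map lin_orders Ts).
        a \<xi> * (\<Prod>i<length Ts. (bs ! i) (ls ! i)) * symb (subst_orders Ts \<xi> ls) z) = (0::'k)"
    if "z \<notin> lin_orders S" for z
    by (intro sum.neutral ballI) (use that subst_orders_lin[OF assms] in \<open>auto simp: symb_def\<close>)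
  then show ?thesis by (simp add: As_def free_mod_def)
qed

text \<open>Substituting linear orders yields one linear order, so the sum of coefficients is
  multiplicative.\<close>

lemma As_to_Com_compose:
  assumes Ts: "Ts \<in> as_part S"
  shows "As_to_Com S n (compose As Ts p qs a bs)
     = As_to_Com (blocks Ts) n a * (\<Prod>i<length Ts. As_to_Com (Ts ! i) n (bs ! i) :: 'k::comm_ring_1)"
proof -
  let ?X = "lin_orders (blocks Ts)" and ?Y = "listset (map lin_orders Ts)"
  have fT: "finite T" if "T \<in> set Ts" for T using finite_block[OF Ts that] .
  have one: "(\<Sum>z\<in>lin_orders S. symb (subst_orders Ts \<xi> ls) z) = (1::'k)" if "\<xi> \<in> ?X" "ls \<in> ?Y" for \<xi> ls
    using subst_orders_lin[OF Ts that] finite_lin_orders[OF finS] by (simp add: symb_def)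
  have "As_to_Com S n (compose As Ts p qs a bs) = (\<Sum>z\<in>lin_orders S. \<Sum>\<xi>\<in>?X. \<Sum>ls\<in>?Y.
        a \<xi> * (\<Prod>i<length Ts. (bs ! i) (ls ! i)) * symb (subst_orders Ts \<xi> ls) z)"
    by (simp add: As_to_Com_def As_def)
  also have "\<dots> = (\<Sum>\<xi>\<in>?X. \<Sum>z\<in>lin_orders S. \<Sum>ls\<in>?Y.
        a \<xi> * (\<Prod>i<length Ts. (bs ! i) (ls ! i)) * symb (subst_orders Ts \<xi> ls) z)" by (rule sum.swap)
  also have "\<dots> = (\<Sum>\<xi>\<in>?X. \<Sum>ls\<in>?Y. \<Sum>z\<in>lin_orders S.
        a \<xi> * (\<Prod>i<length Ts. (bs ! i) (ls ! i)) * symb (subst_orders Ts \<xi> ls) z)"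
    by (intro sum.cong refl sum.swap)
  also have "\<dots> = (\<Sum>\<xi>\<in>?X. \<Sum>ls\<in>?Y. a \<xi> * (\<Prod>i<length Ts. (bs ! i) (ls ! i)))"
    by (intro sum.cong refl) (simp add: sum_distrib_left[symmetric] one)
  also have "\<dots> = (\<Sum>\<xi>\<in>?X. a \<xi>) * (\<Sum>ls\<in>?Y. \<Prod>i<length Ts. (bs ! i) (ls ! i))"
    by (simp add: sum_product)
  also have "(\<Sum>ls\<in>?Y. \<Prod>i<length Ts. (bs ! i) (ls ! i)) = (\<Prod>i<length Ts. \<Sum>l\<in>lin_orders (Ts ! i). (bs ! i) l)"
    using sum_listset_prod[of "map lin_orders Ts" "\<lambda>i. bs ! i"] fT finite_lin_orders by auto
  finally show ?thesis by (simp add: As_to_Com_def)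
qed

definition block_words :: "nat set list \<Rightarrow> nat list \<Rightarrow> nat list list" where
  "block_words Ts v = map (\<lambda>T. filter (\<lambda>s. s \<in> T) v) Ts"

lemma block_word_lin:
  assumes "Ts \<in> as_part S" "v \<in> lin_orders S" "T \<in> set Ts"
  shows "filter (\<lambda>s. s \<in> T) v \<in> lin_orders T"
  using assms as_part_Union[OF assms(1)] by (auto simp: lin_orders_def)

text \<open>Replacing \<open>v\<close> by \<open>w\<close> changes the sign that sorts into blocks
  and the sign inside each block. The product of the latter compares the two sorted enumerations, so
  the total change is \<open>reorder_sign v w\<close>; \<open>koszul_sign\<close> does not depend on
  the enumeration. For the second claim all signs agree on both sides, which leaves
  \<open>As_to_Com_compose\<close>.\<close>

lemma desusp_As_compose:
  assumes Ts: "Ts \<in> as_part S" and lG: "length Gs = length Ts"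
    and G: "\<And>i. i < length Ts \<Longrightarrow> Gs ! i \<in> piece (desusp As) (Ts ! i) (card (Ts ! i) - 1)"
  shows "compose (desusp As) Ts p qs F Gs \<in> piece (desusp As) S (card S - 1)"
    and "length qs = length Ts \<Longrightarrow> desusp_map As_to_Com S n (compose (desusp As) Ts p qs F Gs)
      = compose (desusp Com) Ts p qs (desusp_map As_to_Com (blocks Ts) n' F) (apply_blocks (desusp_map As_to_Com) Ts qs (Gs :: (nat list \<Rightarrow> nat list \<Rightarrow> 'k::comm_ring_1) list))"
proof -
  have UN: "\<Union>(set Ts) = S" using as_part_Union[OF Ts] .
  let ?C = "\<lambda>v. compose As Ts 0 (map (\<lambda>_. 0) Ts) (F (map set_encode Ts)) (map2 (\<lambda>G w. G w) Gs (block_words Ts v)) :: _ \<Rightarrow> 'k"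
  have e: "compose (desusp As) Ts p qs F Gs = (\<lambda>v. if v \<in> lin_orders S
      then (\<lambda>l. reorder_sign v (concat (block_words Ts v)) * koszul_sign Ts * ?C v l) else (\<lambda>_. 0))"
    by (simp add: desusp_def As_simps Let_def UN block_words_def cong: if_cong)
  have nthw: "map2 (\<lambda>G w. G w) Gs (block_words Ts v) ! i = (Gs ! i) (filter (\<lambda>s. s \<in> Ts ! i) v)" if "i < length Ts" for i v
    using that lG by (simp add: block_words_def)
  have cw: "concat (block_words Ts v) \<in> lin_orders S"
    "reorder_sign (concat (block_words Ts v)) (concat (block_words Ts w))
      = (\<Prod>i<length Ts. reorder_sign (filter (\<lambda>s. s \<in> Ts ! i) v) (filter (\<lambda>s. s \<in> Ts ! i) w) :: 'k)"
    if "v \<in> lin_orders S" "w \<in> lin_orders S" for v w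
    using reorder_sign_concat[OF Ts, of "\<lambda>T. filter (\<lambda>s. s \<in> T) v" "\<lambda>T. filter (\<lambda>s. s \<in> T) w", where 'k='k]
      block_word_lin[OF Ts] that unfolding block_words_def by auto
  have C: "?C v = (\<lambda>l. (\<Prod>i<length Ts. reorder_sign (filter (\<lambda>s. s \<in> Ts ! i) v) (filter (\<lambda>s. s \<in> Ts ! i) w)) * ?C w l)"
    if v: "v \<in> lin_orders S" and w: "w \<in> lin_orders S" for v w
  proof
    fix z
    have g: "(Gs ! i) (filter (\<lambda>s. s \<in> Ts ! i) v) l = reorder_sign (filter (\<lambda>s. s \<in> Ts ! i) v) (filter (\<lambda>s. s \<in> Ts ! i) w)
        * (Gs ! i) (filter (\<lambda>s. s \<in> Ts ! i) w) l" if i: "i < length Ts" for i l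
    proof -
      have "(Gs ! i) (filter (\<lambda>s. s \<in> Ts ! i) v) = (\<lambda>l. reorder_sign (filter (\<lambda>s. s \<in> Ts ! i) v) (filter (\<lambda>s. s \<in> Ts ! i) w)
        * (Gs ! i) (filter (\<lambda>s. s \<in> Ts ! i) w) l)"
        by (rule desusp_AsD(3)[OF G[OF i]]) (use block_word_lin[OF Ts v, of "Ts ! i"] block_word_lin[OF Ts w, of "Ts ! i"] i in simp_all)
      then show ?thesis by (rule fun_cong)
    qed
    have "(\<Prod>i<length Ts. (map2 (\<lambda>G w. G w) Gs (block_words Ts v) ! i) (ls ! i))
      = (\<Prod>i<length Ts. reorder_sign (filter (\<lambda>s. s \<in> Ts ! i) v) (filter (\<lambda>s. s \<in> Ts ! i) w))
        * (\<Prod>i<length Ts. (map2 (\<lambda>G w. G w) Gs (block_words Ts w) ! i) (ls ! i))" for ls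
      unfolding prod.distrib[symmetric] by (rule prod.cong[OF refl]) (use nthw g in simp)
    then show "?C v z = (\<Prod>i<length Ts. reorder_sign (filter (\<lambda>s. s \<in> Ts ! i) v) (filter (\<lambda>s. s \<in> Ts ! i) w)) * ?C w z"
      by (simp add: As_def sum_distrib_left ac_simps)
  qed
  have sgn: "reorder_sign v (concat (block_words Ts v)) * koszul_sign Ts * ?C v l
      = reorder_sign v w * (reorder_sign w (concat (block_words Ts w)) * koszul_sign Ts * ?C w l)"
    if v: "v \<in> lin_orders S" and w: "w \<in> lin_orders S" for v w l
  proof -
    let ?v = "concat (block_words Ts v)" and ?w = "concat (block_words Ts w)"
    \<comment> \<open>Both sides are the sign of passing from \<open>v\<close> to the sorted form of
      \<open>w\<close>, once through the sorted form of \<open>v\<close> and once through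
      \<open>w\<close>.\<close>
    have s: "reorder_sign v ?v * reorder_sign ?v ?w = (reorder_sign v w * reorder_sign w ?w :: 'k)"
    proof -
      have "reorder_sign v ?v * reorder_sign ?v ?w = (order_sign v * (order_sign ?v * order_sign ?v) * order_sign ?w :: 'k)"
        using reorder_sign_eq[OF v cw(1)[OF v w], where 'k='k] reorder_sign_eq[OF cw(1)[OF v w] cw(1)[OF w v], where 'k='k]
        by (simp add: mult.assoc)
      also have "\<dots> = order_sign v * (order_sign w * order_sign w) * order_sign ?w" by (simp add: order_sign_square)
      also have "\<dots> = reorder_sign v w * reorder_sign w ?w"
        using reorder_sign_eq[OF v w, where 'k='k] reorder_sign_eq[OF w cw(1)[OF w v], where 'k='k] by (simp add: mult.assoc)
      finally show ?thesis .
    qed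
    have "reorder_sign v ?v * koszul_sign Ts * ?C v l = reorder_sign v ?v * reorder_sign ?v ?w * (koszul_sign Ts * ?C w l)"
      unfolding fun_cong[OF C[OF v w], of l] cw(2)[OF v w] by (simp add: ac_simps)
    then show ?thesis unfolding s by (simp add: ac_simps)
  qed
  show "compose (desusp As) Ts p qs F Gs \<in> piece (desusp As) S (card S - 1)"
  proof (unfold e, rule desusp_AsI)
    fix v w assume vw: "v \<in> lin_orders S" "w \<in> lin_orders S"
    show "(if v \<in> lin_orders S then (\<lambda>l. reorder_sign v (concat (block_words Ts v)) * koszul_sign Ts * ?C v l) else (\<lambda>_. 0))
      = (\<lambda>l. reorder_sign v w * (if w \<in> lin_orders S then (\<lambda>l. reorder_sign w (concat (block_words Ts w)) * koszul_sign Ts * ?C w l) else (\<lambda>_. 0)) l)"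
      unfolding if_P[OF vw(1)] if_P[OF vw(2)] by (rule ext) (rule sgn[OF vw])
  next
    fix w assume w: "w \<in> lin_orders S"
    show "(if w \<in> lin_orders S then (\<lambda>l. reorder_sign w (concat (block_words Ts w)) * koszul_sign Ts * ?C w l) else (\<lambda>_. 0)) \<in> free_mod (lin_orders S)"
      unfolding if_P[OF w] using compose_As_free[OF Ts, where 'k='k] by (simp add: free_mod_def)
  qed simp
  assume lq: "length qs = length Ts"
  show "desusp_map As_to_Com S n (compose (desusp As) Ts p qs F Gs)
      = compose (desusp Com) Ts p qs (desusp_map As_to_Com (blocks Ts) n' F) (apply_blocks (desusp_map As_to_Com) Ts qs Gs)"
  proof
    fix v
    show "desusp_map As_to_Com S n (compose (desusp As) Ts p qs F Gs) v
      = compose (desusp Com) Ts p qs (desusp_map As_to_Com (blocks Ts) n' F) (apply_blocks (desusp_map As_to_Com) Ts qs Gs) v"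
    proof (cases "v \<in> lin_orders S")
      case True
      have "As_to_Com S 0 (\<lambda>l. reorder_sign v (concat (block_words Ts v)) * koszul_sign Ts * ?C v l)
        = reorder_sign v (concat (block_words Ts v)) * koszul_sign Ts * (As_to_Com (blocks Ts) 0 (F (map set_encode Ts))
          * (\<Prod>i<length Ts. As_to_Com (Ts ! i) 0 ((Gs ! i) (filter (\<lambda>s. s \<in> Ts ! i) v))))"
        unfolding As_to_Com_scale As_to_Com_compose[OF Ts] using nthw by simp
      moreover have "prod_list (map2 (\<lambda>G w. G w) (apply_blocks (desusp_map As_to_Com) Ts qs Gs) (block_words Ts v))
        = (\<Prod>i<length Ts. As_to_Com (Ts ! i) 0 ((Gs ! i) (filter (\<lambda>s. s \<in> Ts ! i) v)))"
        by (subst prod_list_map2) (use lq lG in \<open>auto simp: apply_blocks_def block_words_def desusp_map_def\<close>)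
      moreover have "compose (desusp Com) Ts p qs (desusp_map As_to_Com (blocks Ts) n' F) (apply_blocks (desusp_map As_to_Com) Ts qs Gs) v
        = reorder_sign v (concat (block_words Ts v)) * koszul_sign Ts * (As_to_Com (blocks Ts) 0 (F (map set_encode Ts)) *
          prod_list (map2 (\<lambda>G w. G w) (apply_blocks (desusp_map As_to_Com) Ts qs Gs) (block_words Ts v)))"
        using True by (simp add: desusp_def Com_simps Let_def UN block_words_def[symmetric] desusp_map_def)
      ultimately show ?thesis using True unfolding e desusp_map_def by simp
    next
      case False
      then show ?thesis unfolding e by (simp add: desusp_map_def As_to_Com_zero desusp_def Com_simps Let_def UN)
    qed
  qed
qed

end

section \<open>Cohomology classes\<close>

lemma diff_zero: "diff P le n (\<lambda>_. 0) = (\<lambda>_. 0)"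
  by (simp add: diff_def lin_ext_def)

lemma diff_add: "diff P le n (\<lambda>z. a z + b z) = (\<lambda>z. diff P le n a z + diff P le n b z)"
  by (simp add: diff_def lin_ext_def distrib_right sum.distrib)

lemma diff_scale: "diff P le n (\<lambda>z. k * a z) = (\<lambda>z. k * diff P le n a z)"
  by (simp add: diff_def lin_ext_def sum_distrib_left mult.assoc)

text \<open>Isolates the closure properties shared by \<open>as_check\<close> and
  \<open>as_max\<close>, so that the calculus of classes is done once for both.\<close>

definition submodules :: "('b, 'k::comm_ring_1) cochain_complex \<Rightarrow> bool" where
  "submodules C \<longleftrightarrow> (\<forall>n. (\<lambda>_. 0) \<in> C n \<and> (\<forall>a\<in>C n. \<forall>b\<in>C n. (\<lambda>z. a z + b z) \<in> C n) \<and> (\<forall>k. \<forall>a\<in>C n. (\<lambda>z. k * a z) \<in> C n))"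

lemma submodules_zero: "submodules C \<Longrightarrow> (\<lambda>_. 0) \<in> C n"
  and submodules_add: "submodules C \<Longrightarrow> a \<in> C n \<Longrightarrow> b \<in> C n \<Longrightarrow> (\<lambda>z. a z + b z) \<in> C n"
  and submodules_scale: "submodules C \<Longrightarrow> a \<in> C n \<Longrightarrow> (\<lambda>z. k * a z) \<in> C n"
  by (simp_all add: submodules_def)

lemma submodules_check: "submodules (as_check S)" and submodules_max: "submodules (as_max S)"
  by (simp_all add: submodules_def c_check_def c_max_def free_mod_def)

lemma coboundary_zero: "submodules C \<Longrightarrow> (\<lambda>_. 0) \<in> coboundaries C (diff P le) n"
  unfolding submodules_def coboundaries_def by (cases n) (auto simp: diff_zero intro!: image_eqI[of _ _ "\<lambda>_. 0"])

lemma coboundary_add: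
  assumes "submodules C" "a \<in> coboundaries C (diff P le) n" "b \<in> coboundaries C (diff P le) n"
  shows "(\<lambda>z. a z + b z) \<in> coboundaries C (diff P le) n"
proof (cases n)
  case (Suc m)
  obtain a' b' where ab: "a' \<in> C m" "a = diff P le m a'" "b' \<in> C m" "b = diff P le m b'"
    using assms(2,3) Suc by (auto simp: coboundaries_def)
  then have "(\<lambda>z. a' z + b' z) \<in> C m" using assms(1) by (simp add: submodules_def)
  moreover have "(\<lambda>z. a z + b z) = diff P le m (\<lambda>z. a' z + b' z)" using ab by (simp add: diff_add)
  ultimately show ?thesis using Suc by (simp add: coboundaries_def)
qed (use assms in \<open>simp add: coboundaries_def\<close>)

lemma coboundary_scale:
  assumes "submodules C" "a \<in> coboundaries C (diff P le) n"
  shows "(\<lambda>z. k * a z) \<in> coboundaries C (diff P le) n"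
proof (cases n)
  case (Suc m)
  obtain a' where a: "a' \<in> C m" "a = diff P le m a'" using assms(2) Suc by (auto simp: coboundaries_def)
  then have "(\<lambda>z. k * a' z) \<in> C m" using assms(1) by (simp add: submodules_def)
  moreover have "(\<lambda>z. k * a z) = diff P le m (\<lambda>z. k * a' z)" using a by (simp add: diff_scale)
  ultimately show ?thesis using Suc by (simp add: coboundaries_def)
qed (use assms in \<open>simp add: coboundaries_def\<close>)

lemma coh_class_self: "submodules C \<Longrightarrow> c \<in> coh_class C (diff P le) n c"
  using coboundary_zero[of C P le n] by (force simp: coh_class_def)

lemma coh_class_iff: "x \<in> coh_class C d n c \<longleftrightarrow> (\<lambda>z. x z - c z) \<in> coboundaries C d n"
proof
  assume "(\<lambda>z. x z - c z) \<in> coboundaries C d n"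
  then show "x \<in> coh_class C d n c" unfolding coh_class_def
    by (intro CollectI exI[of _ "\<lambda>z. x z - c z"]) simp
next
  assume "x \<in> coh_class C d n c"
  then obtain b where b: "b \<in> coboundaries C d n" "x = (\<lambda>z. c z + b z)" by (auto simp: coh_class_def)
  then have "(\<lambda>z. x z - c z) = b" by simp
  then show "(\<lambda>z. x z - c z) \<in> coboundaries C d n" using b(1) by simp
qed

lemma coh_class_eq:
  assumes C: "submodules C" and x: "x \<in> coh_class C (diff P le) n c"
  shows "coh_class C (diff P le) n x = coh_class C (diff P le) n c"
proof -
  have x: "(\<lambda>z. x z - c z) \<in> coboundaries C (diff P le) n" using x by (simp add: coh_class_iff)
  have x': "(\<lambda>z. - 1 * (x z - c z)) \<in> coboundaries C (diff P le) n" by (rule coboundary_scale[OF C x])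
  have "(\<lambda>z. y z - x z) \<in> coboundaries C (diff P le) n \<longleftrightarrow> (\<lambda>z. y z - c z) \<in> coboundaries C (diff P le) n" for y
    using coboundary_add[OF C _ x, of "\<lambda>z. y z - x z"] coboundary_add[OF C _ x', of "\<lambda>z. y z - c z"] by auto
  then show ?thesis by (auto simp: coh_class_iff)
qed

lemma h_operad_simps:
  "piece h_operad S n = cohomology (as_max S) (as_diff S) n"
  "add h_operad S n A B = (\<Union>a\<in>A. \<Union>b\<in>B. coh_class (as_max S) (as_diff S) n (\<lambda>z. a z + b z))"
  "scale h_operad S n k A = (\<Union>a\<in>A. coh_class (as_max S) (as_diff S) n (\<lambda>z. k * a z))"
  "relabel h_operad S n \<sigma> A = (\<Union>a\<in>A. coh_class (as_max (\<sigma> ` S)) (as_diff (\<sigma> ` S)) n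
        (lin_ext (chains (as_part S) as_le n) (\<lambda>xs. symb (map (map ((`) \<sigma>)) xs)) a))"
  "compose h_operad = rho_class as_max"
  by (simp_all add: h_operad_def coh_species_def species.defs operad.defs)

lemma check_module_simps:
  "piece (restrict_module f h_check_module) = (\<lambda>S. cohomology (as_check S) (as_diff S))"
  "add (restrict_module f h_check_module) S n A B = (\<Union>a\<in>A. \<Union>b\<in>B. coh_class (as_check S) (as_diff S) n (\<lambda>z. a z + b z))"
  "scale (restrict_module f h_check_module) S n k A = (\<Union>a\<in>A. coh_class (as_check S) (as_diff S) n (\<lambda>z. k * a z))"
  "relabel (restrict_module f h_check_module) S n \<sigma> A = (\<Union>a\<in>A. coh_class (as_check (\<sigma> ` S)) (as_diff (\<sigma> ` S)) n
        (lin_ext (chains (as_part S) as_le n) (\<lambda>xs. symb (map (map ((`) \<sigma>)) xs)) a))"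
  "act (restrict_module f h_check_module) Ts p qs a ms = rho_class as_check Ts p qs (f (blocks Ts) p a) ms"
  by (simp_all add: restrict_module_def h_check_module_def coh_species_def species.defs left_module.defs)

lemma Com_module_simps:
  "piece (restrict_module f (regular_module P)) = piece P"
  "add (restrict_module f (regular_module P)) = add P"
  "scale (restrict_module f (regular_module P)) = scale P"
  "relabel (restrict_module f (regular_module P)) = relabel P"
  "act (restrict_module f (regular_module P)) Ts p qs a ms = compose P Ts p qs (f (blocks Ts) p a) ms"
  by (simp_all add: restrict_module_def regular_module_def)

lemma desusp_Com_simps:
  "add (desusp Com) S n F G = (\<lambda>w. F w + G w)"
  "scale (desusp Com) S n k F = (\<lambda>w. k * F w)"
  "relabel (desusp Com) S n \<sigma> F = (\<lambda>w. if w \<in> lin_orders (\<sigma> ` S) then F (map (inv_into S \<sigma>) w) else 0)"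
  by (simp_all add: desusp_def Com_simps cong: if_cong)

lemma desusp_Com_compose_zero:
  assumes "F = (\<lambda>_. 0) \<or> (\<exists>i<length Ts. Gs ! i = (\<lambda>_. 0))" "length Gs = length Ts"
  shows "compose (desusp Com) Ts p qs F Gs = (\<lambda>_. 0 :: 'k::comm_ring_1)"
proof -
  have z: "F (map set_encode Ts) * prod_list (map2 (\<lambda>G w. G w) Gs (map (\<lambda>T. filter (\<lambda>s. s \<in> T) v) Ts)) = 0" for v
  proof (cases "F = (\<lambda>_. 0)")
    case False
    then obtain i where i: "i < length Ts" "Gs ! i = (\<lambda>_. 0)" using assms by auto
    have "prod_list (map2 (\<lambda>G w. G w) Gs (map (\<lambda>T. filter (\<lambda>s. s \<in> T) v) Ts)) = 0"
      by (subst prod_list_map2) (use assms(2) i in \<open>auto intro!: prod_zero bexI[of _ i]\<close>)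
    then show ?thesis by simp
  qed simp
  show ?thesis
    by (rule ext) (simp only: desusp_def Com_simps Let_def operad.simps species.simps z mult_zero_right if_cancel)
qed

text \<open>Serves the degrees above the top one, where the only cochain is zero.\<close>

lemma rho_zero:
  assumes "a = (\<lambda>_. 0) \<or> (\<exists>i<length Ts. cs ! i = (\<lambda>_. 0))"
  shows "rho Ts p qs a cs = (\<lambda>_. 0 :: 'k::comm_ring_1)"
proof -
  have "a = (\<lambda>_. 0) \<or> kuenneth (map as_part Ts) as_le qs cs = (\<lambda>_. 0)"
  proof (cases "a = (\<lambda>_. 0)")
    case False
    then obtain i where "i < length Ts" "cs ! i = (\<lambda>_. 0)" using assms by auto
    then have "(\<Prod>i<length (map as_part Ts). (cs ! i) (xss ! i)) = 0" for xss
      by (intro prod_zero) (auto intro!: bexI[of _ i])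
    then show ?thesis unfolding kuenneth_def by simp
  qed simp
  then show ?thesis
    unfolding rho_def Let_def concat_chains_def by (elim disjE) (simp_all add: pullback_def lin_ext_def)
qed

section \<open>Cochains and classes in the top degree and outside it\<close>

context ordered_partitions
begin

abbreviation top :: nat where "top \<equiv> card S - 1"

lemma max_check_top: "as_max S top = as_check S top"
  unfolding c_max_def c_check_def top_chains_max ..

lemma diff_support: "c \<in> coboundaries (as_check S) (as_diff S) n \<Longrightarrow> c \<in> as_check S n"
  by (cases n) (auto simp: coboundaries_def c_check_def free_mod_def po.diff_apply)

lemma max_subset_check: "as_max S n \<subseteq> as_check S n"
  by (auto simp: c_max_def c_check_def free_mod_def max_chains_def)

lemma coboundaries_max_check: "coboundaries (as_max S) (as_diff S) n \<subseteq> coboundaries (as_check S) (as_diff S) n"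
  using max_subset_check by (cases n) (auto simp: coboundaries_def)

lemma cocycles_top: "cocycles (as_check S) (as_diff S) top = as_check S top"
  "cocycles (as_max S) (as_diff S) top = as_check S top"
  unfolding cocycles_def max_check_top using check_no_chains[of "Suc top"] by (auto simp: po.diff_apply)

lemma class_check_subset:
  assumes "X \<in> cohomology (as_check S) (as_diff S) n" "x \<in> X"
  shows "x \<in> as_check S n"
proof -
  obtain c b where "c \<in> as_check S n" "b \<in> coboundaries (as_check S) (as_diff S) n" "x = (\<lambda>z. c z + b z)"
    using assms by (auto simp: cohomology_def cocycles_def coh_class_def)
  then show ?thesis using diff_support[of b n] submodules_add[OF submodules_check, of c S n b] by simp
qed

lemma class_max_subset:
  assumes "X \<in> cohomology (as_max S) (as_diff S) n" "x \<in> X"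
  shows "x \<in> as_check S n"
proof -
  obtain c b where c: "c \<in> as_max S n" "b \<in> coboundaries (as_max S) (as_diff S) n" "x = (\<lambda>z. c z + b z)"
    using assms by (auto simp: cohomology_def cocycles_def coh_class_def)
  then have "c \<in> as_check S n" "b \<in> as_check S n"
    using diff_support max_subset_check coboundaries_max_check by blast+
  then show ?thesis using c(3) submodules_add[OF submodules_check, of c S n b] by simp
qed

lemma class_nonempty: "X \<in> cohomology (as_check S) (as_diff S) n \<Longrightarrow> X \<noteq> {}"
  "X \<in> cohomology (as_max S) (as_diff S) n \<Longrightarrow> X \<noteq> {}"
  unfolding cohomology_def
  by (elim imageE, metis coh_class_self[OF submodules_check] empty_iff)
    (elim imageE, metis coh_class_self[OF submodules_max] empty_iff)

lemma above_top_zero: "n > top \<Longrightarrow> c \<in> as_check S n \<Longrightarrow> c = (\<lambda>_. 0)"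
  using check_no_chains by (auto simp: c_check_def free_mod_def)

text \<open>Below the top degree every cocycle is a coboundary by the matching; above it there are
  no chains.\<close>

lemma cohomology_off_top:
  assumes "n \<noteq> top"
  shows "cohomology (as_check S) (as_diff S) n = {coh_class (as_check S) (as_diff S) n (\<lambda>_. 0 :: 'k::comm_ring_1)}"
proof -
  have "c \<in> coh_class (as_check S) (as_diff S) n (\<lambda>_. 0)" if "c \<in> cocycles (as_check S) (as_diff S) n" for c :: "_ \<Rightarrow> 'k"
  proof (cases "n < top")
    case True
    then show ?thesis using check_acyclic[of n c] that by (simp add: cocycles_def coh_class_iff)
  next
    case False
    then have "c = (\<lambda>_. 0)" by (intro above_top_zero[of n c]) (use assms that in \<open>auto simp: cocycles_def\<close>)
    then show ?thesis using coh_class_self[OF submodules_check] by simp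
  qed
  then have "coh_class (as_check S) (as_diff S) n c = coh_class (as_check S) (as_diff S) n (\<lambda>_. 0 :: 'k)"
    if "c \<in> cocycles (as_check S) (as_diff S) n" for c :: "_ \<Rightarrow> 'k"
    using that by (intro coh_class_eq[OF submodules_check]) blast
  moreover have "(\<lambda>_. 0 :: 'k) \<in> cocycles (as_check S) (as_diff S) n"
    using submodules_zero[OF submodules_check] by (simp add: cocycles_def diff_zero)
  ultimately show ?thesis unfolding cohomology_def by blast
qed

text \<open>The top degrees of the set of blocks and of the blocks add up to the top degree of
  \<open>S\<close>, so a composite of top cochains is a top cochain.\<close>

lemma card_split:
  assumes Ts: "Ts \<in> as_part S"
  shows "top = (card (blocks Ts) - 1) + (\<Sum>i<length Ts. card (Ts ! i) - 1)"
proof -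
  have pos: "card (Ts ! i) \<ge> 1" if "i < length Ts" for i
    using finite_block[OF Ts] as_part_nonempty[OF Ts] that by (simp add: Suc_le_eq card_gt_0_iff)
  have "(\<Sum>i<length Ts. card (Ts ! i)) = (\<Sum>i<length Ts. card (Ts ! i) - 1) + (\<Sum>i<length Ts. 1)"
    unfolding sum.distrib[symmetric] by (rule sum.cong) (use pos in fastforce)+
  then have "card S = (\<Sum>i<length Ts. card (Ts ! i) - 1) + length Ts" using sum_card_blocks[OF Ts finS] by simp
  moreover have "length Ts > 0" using Ts S by (auto simp: as_part_Nil)
  ultimately show ?thesis unfolding card_blocks[OF Ts] by arith
qed

lemma block_partitions:
  assumes "Ts \<in> as_part S"
  shows "ordered_partitions (blocks Ts)" "T \<in> set Ts \<Longrightarrow> ordered_partitions T"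
  using assms S finite_block[OF assms] as_part_nonempty[OF assms]
  by (unfold_locales, auto simp: blocks_def as_part_Nil)

end

section \<open>The isomorphism\<close>

locale as_operad_iso =
  fixes \<Psi> :: "nat set \<Rightarrow> nat \<Rightarrow> (nat list \<Rightarrow> nat list \<Rightarrow> 'k::comm_ring_1) \<Rightarrow> (nat set list list \<Rightarrow> 'k) set"
  assumes iso: "operad_iso (desusp As) h_operad \<Psi>"
    and product: "\<Psi> {1, 2} 1 product_elt = product_class"
begin

definition represents :: "nat set \<Rightarrow> (nat list \<Rightarrow> nat list \<Rightarrow> 'k) \<Rightarrow> (nat set list list \<Rightarrow> 'k) \<Rightarrow> bool" where
  "represents S F a \<longleftrightarrow> F \<in> piece (desusp As) S (card S - 1) \<and> a \<in> \<Psi> S (card S - 1) F"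

text \<open>Defined on cochains and not on classes of the smaller complex, because it is to be
  applied to coboundaries of the larger one, whose classes there need not vanish. The degree 0 is a
  dummy: \<open>desusp_map As_to_Com\<close> ignores that argument.\<close>

definition com_value :: "nat set \<Rightarrow> (nat set list list \<Rightarrow> 'k) \<Rightarrow> nat list \<Rightarrow> 'k" where
  "com_value S a = desusp_map As_to_Com S 0 (THE F. represents S F a)"

lemma species: "species_iso (desusp As) h_operad \<Psi>"
  using iso by (simp add: operad_iso_def)

lemma
  assumes "ordered_partitions S"
  shows bij: "bij_betw (\<Psi> S n) (piece (desusp As) S n) (cohomology (as_max S) (as_diff S) n)"
    and Psi_add: "F \<in> piece (desusp As) S n \<Longrightarrow> G \<in> piece (desusp As) S n \<Longrightarrow>
       \<Psi> S n (add (desusp As) S n F G) = add h_operad S n (\<Psi> S n F) (\<Psi> S n G)"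
    and Psi_scale: "F \<in> piece (desusp As) S n \<Longrightarrow> \<Psi> S n (scale (desusp As) S n k F) = scale h_operad S n k (\<Psi> S n F)"
    and Psi_relabel: "inj_on \<sigma> S \<Longrightarrow> F \<in> piece (desusp As) S n \<Longrightarrow>
       \<Psi> (\<sigma> ` S) n (relabel (desusp As) S n \<sigma> F) = relabel h_operad S n \<sigma> (\<Psi> S n F)"
proof -
  have "finite S \<and> S \<noteq> {}" using assms by (simp add: ordered_partitions_def)
  note s = species[unfolded species_iso_def, rule_format, OF this, of n]
  show "bij_betw (\<Psi> S n) (piece (desusp As) S n) (cohomology (as_max S) (as_diff S) n)"
    using conjunct1[OF s] unfolding h_operad_simps .
  show "F \<in> piece (desusp As) S n \<Longrightarrow> G \<in> piece (desusp As) S n \<Longrightarrow>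
       \<Psi> S n (add (desusp As) S n F G) = add h_operad S n (\<Psi> S n F) (\<Psi> S n G)"
    by (rule s[THEN conjunct2, THEN conjunct1, rule_format])
  show "F \<in> piece (desusp As) S n \<Longrightarrow> \<Psi> S n (scale (desusp As) S n k F) = scale h_operad S n k (\<Psi> S n F)"
    by (rule s[THEN conjunct2, THEN conjunct2, THEN conjunct1, rule_format])
  show "inj_on \<sigma> S \<Longrightarrow> F \<in> piece (desusp As) S n \<Longrightarrow>
       \<Psi> (\<sigma> ` S) n (relabel (desusp As) S n \<sigma> F) = relabel h_operad S n \<sigma> (\<Psi> S n F)"
    by (rule s[THEN conjunct2, THEN conjunct2, THEN conjunct2, rule_format])
qed

lemma represents_check:
  assumes oS: "ordered_partitions S" and r: "represents S F a"
  shows "a \<in> as_check S (card S - 1)"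
proof -
  interpret ordered_partitions S by (rule oS)
  have "\<Psi> S top F \<in> cohomology (as_max S) (as_diff S) top"
    using r bij_betwE[OF bij[OF oS]] by (auto simp: represents_def)
  then show ?thesis using class_max_subset r by (auto simp: represents_def)
qed

lemma represents_ex:
  assumes oS: "ordered_partitions S" and a: "a \<in> as_check S (card S - 1)"
  shows "\<exists>F. represents S F a \<and> \<Psi> S (card S - 1) F = coh_class (as_max S) (as_diff S) (card S - 1) a"
proof -
  interpret ordered_partitions S by (rule oS)
  have "coh_class (as_max S) (as_diff S) top a \<in> cohomology (as_max S) (as_diff S) top"
    using a cocycles_top by (auto simp: cohomology_def)
  then have "coh_class (as_max S) (as_diff S) top a \<in> \<Psi> S top ` piece (desusp As) S top"
    unfolding bij_betw_imp_surj_on[OF bij[OF oS]] .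
  then obtain F where F: "F \<in> piece (desusp As) S top" "\<Psi> S top F = coh_class (as_max S) (as_diff S) top a"
    by (elim imageE) simp
  have "represents S F a" unfolding represents_def F(2) using F(1) coh_class_self[OF submodules_max] by blast
  then show ?thesis using F(2) by blast
qed

text \<open>Classes are cosets, so two classes with a common cochain coincide; injectivity of
  \<open>\<Psi>\<close> does the rest.\<close>

lemma represents_unique:
  assumes oS: "ordered_partitions S" and r: "represents S F a" "represents S G a"
  shows "F = G"
proof -
  interpret ordered_partitions S by (rule oS)
  have cl: "\<Psi> S top H = coh_class (as_max S) (as_diff S) top a" if "represents S H a" for H
  proof -
    have "\<Psi> S top H \<in> cohomology (as_max S) (as_diff S) top" "a \<in> \<Psi> S top H"
      using that bij_betwE[OF bij[OF oS]] by (auto simp: represents_def)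
    then obtain c where c: "\<Psi> S top H = coh_class (as_max S) (as_diff S) top c" "a \<in> coh_class (as_max S) (as_diff S) top c"
      by (auto simp: cohomology_def)
    show ?thesis unfolding c(1) by (rule coh_class_eq[OF submodules_max c(2), symmetric])
  qed
  have "\<Psi> S top F = \<Psi> S top G" using cl[OF r(1)] cl[OF r(2)] by simp
  then show ?thesis
    by (rule inj_onD[OF bij_betw_imp_inj_on[OF bij[OF oS]]]) (use r in \<open>simp_all add: represents_def\<close>)
qed

lemma com_value:
  assumes "ordered_partitions S" "represents S F a"
  shows "com_value S a = desusp_map As_to_Com S n F"
proof -
  have "(THE F. represents S F a) = F" using represents_unique[OF assms(1)] assms(2) by blast
  then show ?thesis by (simp add: com_value_def desusp_map_def)
qed

lemma com_value_add:
  assumes oS: "ordered_partitions S" and "a \<in> as_check S (card S - 1)" "b \<in> as_check S (card S - 1)"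
  shows "com_value S (\<lambda>z. a z + b z) = (\<lambda>w. com_value S a w + com_value S b w)"
proof -
  obtain F where F: "represents S F a" using represents_ex[OF oS assms(2)] by blast
  obtain G where G: "represents S G b" using represents_ex[OF oS assms(3)] by blast
  have p: "F \<in> piece (desusp As) S (card S - 1)" "G \<in> piece (desusp As) S (card S - 1)"
    and m: "a \<in> \<Psi> S (card S - 1) F" "b \<in> \<Psi> S (card S - 1) G"
    using F G by (auto simp: represents_def)
  have "(\<lambda>z. a z + b z) \<in> \<Psi> S (card S - 1) (add (desusp As) S (card S - 1) F G)"
    unfolding Psi_add[OF oS p] h_operad_simps
    by (rule UN_I[OF m(1)], rule UN_I[OF m(2)], rule coh_class_self[OF submodules_max])
  then have "represents S (add (desusp As) S (card S - 1) F G) (\<lambda>z. a z + b z)"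
    using desusp_As_add(1)[OF p] by (simp only: represents_def simp_thms)
  from com_value[OF oS this, of 0] show ?thesis
    unfolding desusp_As_add(2)[OF p] com_value[OF oS F, of 0] com_value[OF oS G, of 0] .
qed

lemma com_value_scale:
  assumes oS: "ordered_partitions S" and "a \<in> as_check S (card S - 1)"
  shows "com_value S (\<lambda>z. k * a z) = (\<lambda>w. k * com_value S a w)"
proof -
  obtain F where F: "represents S F a" using represents_ex[OF oS assms(2)] by blast
  have p: "F \<in> piece (desusp As) S (card S - 1)" and m: "a \<in> \<Psi> S (card S - 1) F"
    using F by (auto simp: represents_def)
  have "(\<lambda>z. k * a z) \<in> \<Psi> S (card S - 1) (scale (desusp As) S (card S - 1) k F)"
    unfolding Psi_scale[OF oS p] h_operad_simps by (rule UN_I[OF m], rule coh_class_self[OF submodules_max])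
  then have "represents S (scale (desusp As) S (card S - 1) k F) (\<lambda>z. k * a z)"
    using desusp_As_scale(1)[OF p] by (simp only: represents_def simp_thms)
  from com_value[OF oS this, of 0] show ?thesis
    unfolding desusp_As_scale(2)[OF p] com_value[OF oS F, of 0] .
qed

lemma com_value_zero: "ordered_partitions S \<Longrightarrow> com_value S (\<lambda>_. 0) = (\<lambda>_. 0)"
  using com_value_scale[of S "\<lambda>_. 0" 0] submodules_zero[OF submodules_check, of S "card S - 1"] by simp

lemma com_value_relabel:
  assumes oS: "ordered_partitions S" and \<sigma>: "inj_on \<sigma> S" and r: "represents S F a"
  shows "represents (\<sigma> ` S) (relabel (desusp As) S (card S - 1) \<sigma> F)
      (lin_ext (chains (as_part S) as_le (card S - 1)) (\<lambda>xs. symb (map (map ((`) \<sigma>)) xs)) a)"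
    and "com_value (\<sigma> ` S) (lin_ext (chains (as_part S) as_le (card S - 1)) (\<lambda>xs. symb (map (map ((`) \<sigma>)) xs)) a)
      = relabel (desusp Com) S (card S - 1) \<sigma> (com_value S a)"
proof -
  have fS: "finite S" "ordered_partitions (\<sigma> ` S)" using oS by (auto simp: ordered_partitions_def)
  have F: "F \<in> piece (desusp As) S (card S - 1)" using r by (simp add: represents_def)
  note c = card_image[OF \<sigma>]
  show R: "represents (\<sigma> ` S) (relabel (desusp As) S (card S - 1) \<sigma> F)
      (lin_ext (chains (as_part S) as_le (card S - 1)) (\<lambda>xs. symb (map (map ((`) \<sigma>)) xs)) a)"
    unfolding represents_def c
  proof
    show "relabel (desusp As) S (card S - 1) \<sigma> F \<in> piece (desusp As) (\<sigma> ` S) (card S - 1)"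
      by (rule desusp_As_relabel(1)[OF fS(1) \<sigma> F])
    show "lin_ext (chains (as_part S) as_le (card S - 1)) (\<lambda>xs. symb (map (map ((`) \<sigma>)) xs)) a
        \<in> \<Psi> (\<sigma> ` S) (card S - 1) (relabel (desusp As) S (card S - 1) \<sigma> F)"
      unfolding Psi_relabel[OF oS \<sigma> F] h_operad_simps
      by (rule UN_I[OF conjunct2[OF r[unfolded represents_def]]], rule coh_class_self[OF submodules_max])
  qed
  show "com_value (\<sigma> ` S) (lin_ext (chains (as_part S) as_le (card S - 1)) (\<lambda>xs. symb (map (map ((`) \<sigma>)) xs)) a)
      = relabel (desusp Com) S (card S - 1) \<sigma> (com_value S a)"
    unfolding com_value[OF fS(2) R, of 0] com_value[OF oS r, of 0] by (rule desusp_As_relabel(2)[OF fS(1) \<sigma> F])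
qed

text \<open>\<open>\<Psi>\<close> turns \<open>rho\<close> into the composite in
  \<open>desusp As\<close>, whose image in \<open>desusp Com\<close> depends only on the images of
  the factors. As the top cochains of both complexes agree, the formula applies to the operad and to
  the module alike.\<close>

lemma com_value_rho:
  assumes oS: "ordered_partitions S" and Ts: "Ts \<in> as_part S"
    and p: "p = card (blocks Ts) - 1" and qs: "qs = map (\<lambda>T. card T - 1) Ts"
    and a: "represents (blocks Ts) F a" and bs: "length bs = length Ts"
      "\<And>i. i < length Ts \<Longrightarrow> bs ! i \<in> as_check (Ts ! i) (card (Ts ! i) - 1)"
  shows "rho Ts p qs a bs \<in> as_check S (card S - 1)"
    and "com_value S (rho Ts p qs a bs) = compose (desusp Com) Ts p qs (desusp_map As_to_Com (blocks Ts) n F)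
       (map2 com_value Ts bs)"
proof -
  interpret ordered_partitions S by (rule oS)
  have Ti: "ordered_partitions (Ts ! i)" if "i < length Ts" for i
    using block_partitions(2)[OF Ts] that by simp
  define Gs where "Gs = map2 (\<lambda>T b. SOME G. represents T G b) Ts bs"
  have lG: "length Gs = length Ts" using bs by (simp add: Gs_def)
  have G: "represents (Ts ! i) (Gs ! i) (bs ! i)" if i: "i < length Ts" for i
  proof -
    have "\<exists>G. represents (Ts ! i) G (bs ! i)" using represents_ex[OF Ti[OF i] bs(2)[OF i]] by blast
    then have "represents (Ts ! i) (SOME G. represents (Ts ! i) G (bs ! i)) (bs ! i)" by (rule someI_ex)
    moreover have "Gs ! i = (SOME G. represents (Ts ! i) G (bs ! i))" using i bs(1) by (simp add: Gs_def)
    ultimately show ?thesis by simp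
  qed
  have tot: "p + sum_list qs = top"
    using card_split[OF Ts] unfolding p qs by (simp add: sum_list_sum_nth atLeast0LessThan)
  have Gp: "Gs ! i \<in> piece (desusp As) (Ts ! i) (card (Ts ! i) - 1)" if "i < length Ts" for i
    using G[OF that] by (simp add: represents_def)
  have lq: "length qs = length Ts" using qs by simp
  have "\<Psi> S (p + sum_list qs) (compose (desusp As) Ts p qs F Gs)
      = compose h_operad Ts p qs (\<Psi> (blocks Ts) p F) (apply_blocks \<Psi> Ts qs Gs)"
  proof -
    have "F \<in> piece (desusp As) (blocks Ts) p" using a p by (simp add: represents_def)
    moreover have "Gs \<in> listset (map2 (piece (desusp As)) Ts qs)"
      using Gp lG by (simp add: listset_iff qs)
    ultimately show ?thesis using iso Ts finS S lq unfolding operad_iso_def by blast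
  qed
  moreover have "rho Ts p qs a bs \<in> rho_class as_max Ts p qs (\<Psi> (blocks Ts) p F) (apply_blocks \<Psi> Ts qs Gs)"
  proof -
    have m1: "a \<in> \<Psi> (blocks Ts) p F" using a p by (simp add: represents_def)
    have m2: "bs \<in> listset (apply_blocks \<Psi> Ts qs Gs)"
      using G lG bs(1) by (simp add: listset_iff apply_blocks_def qs represents_def)
    show ?thesis unfolding rho_class_def
      by (rule UN_I[OF m1], rule UN_I[OF m2], rule coh_class_self[OF submodules_max])
  qed
  ultimately have R: "represents S (compose (desusp As) Ts p qs F Gs) (rho Ts p qs a bs)"
    using desusp_As_compose(1)[OF Ts lG Gp] unfolding represents_def h_operad_simps tot by simp
  then show "rho Ts p qs a bs \<in> as_check S (card S - 1)" by (rule represents_check[OF oS])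
  have "apply_blocks (desusp_map As_to_Com) Ts qs Gs = map2 com_value Ts bs"
    by (rule nth_equalityI) (use lG bs(1) in \<open>auto simp: apply_blocks_def qs com_value[OF Ti G, symmetric]\<close>)
  then show "com_value S (rho Ts p qs a bs) = compose (desusp Com) Ts p qs (desusp_map As_to_Com (blocks Ts) n F)
       (map2 com_value Ts bs)"
    unfolding com_value[OF oS R, of 0] using desusp_As_compose(2)[OF Ts lG Gp lq] by simp
qed

text \<open>A coboundary of the smaller complex lies in the zero class and is represented by the
  same element as the zero cochain.\<close>

lemma com_value_max_coboundary:
  assumes oS: "ordered_partitions S" and b: "b \<in> coboundaries (as_max S) (as_diff S) (card S - 1)"
  shows "com_value S b = (\<lambda>_. 0)"
proof -
  obtain F where F: "represents S F (\<lambda>_. 0)" "\<Psi> S (card S - 1) F = coh_class (as_max S) (as_diff S) (card S - 1) (\<lambda>_. 0)"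
    using represents_ex[OF oS submodules_zero[OF submodules_check]] by blast
  have "b \<in> \<Psi> S (card S - 1) F" unfolding F(2) using b by (simp add: coh_class_iff)
  then have "represents S F b" using F(1) by (simp add: represents_def)
  then show ?thesis using com_value[OF oS F(1), of 0] com_value[OF oS, of F b 0] com_value_zero[OF oS] by simp
qed

text \<open>The normalisation of \<open>\<Psi>\<close> gives the value on \<open>{1, 2}\<close>;
  relabelling by the bijection that sends 1 to \<open>a\<close> and 2 to \<open>b\<close> carries it
  to any pair. This is the only place where the normalisation enters.\<close>

lemma pair_chain_value:
  assumes ab: "a \<noteq> b"
  shows "(symb [[{a, b}], [{a}, {b}]] :: _ \<Rightarrow> 'k) \<in> as_check {a, b} 1"
    and "com_value {a, b} (symb [[{a, b}], [{a}, {b}]]) = (\<lambda>w. if w = [a, b] then 1 else if w = [b, a] then - 1 else 0)"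
proof -
  define \<sigma> :: "nat \<Rightarrow> nat" where "\<sigma> i = (if i = 1 then a else b)" for i
  have \<sigma>: "inj_on \<sigma> {1, 2}" "\<sigma> ` {1, 2} = {a, b}" "\<sigma> 1 = a" "\<sigma> 2 = b" using ab by (auto simp: \<sigma>_def)
  have o12: "ordered_partitions {1, 2}" by unfold_locales auto
  have oab: "ordered_partitions {a, b}" by unfold_locales auto
  have card12: "card {1, 2 :: nat} - 1 = 1" by simp
  interpret o: ordered_partitions "{1, 2}" by (rule o12)
  let ?z = "[[{1, 2}], [{1}, {2}]] :: nat set list list"
  have z: "?z \<in> chains (as_part {1, 2}) as_le 1"
  proof -
    have p: "[{1, 2}] \<in> as_part {1, 2 :: nat}" "[{1}, {2}] \<in> as_part {1, 2 :: nat}"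
      by (auto simp: as_part_Cons as_part_Nil)
    have "as_le [{1, 2}] [{1}, {2 :: nat}]" by (rule cuts_imp_as_le[OF p]) simp
    then show ?thesis using p by (simp add: chains_def lt_of_def minimal_as_part)
  qed
  have pe: "(product_elt :: _ \<Rightarrow> _ \<Rightarrow> 'k) \<in> piece (desusp As) {1, 2} (card {1, 2 :: nat} - 1)"
  proof -
    have lo: "w \<in> lin_orders {1, 2} \<longleftrightarrow> w = [1, 2] \<or> w = [2, 1]" for w :: "nat list"
    proof
      assume "w \<in> lin_orders {1, 2}"
      then have w: "distinct w" "set w = {1, 2}" by (auto simp: lin_orders_def)
      then have "length w = 2" using distinct_card[of w] by simp
      then obtain x y where "w = [x, y]" by (auto simp: length_Suc_conv numeral_2_eq_2)
      then show "w = [1, 2] \<or> w = [2, 1]" using w by (auto simp: doubleton_eq_iff)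
    qed (auto simp: lin_orders_def)
    have rs: "reorder_sign [1, 2] [1, 2] = (1 :: 'k)" "reorder_sign [2, 1] [2, 1] = (1 :: 'k)"
      "reorder_sign [1, 2] [2, 1] = (- 1 :: 'k)" "reorder_sign [2, 1] [1, 2] = (- 1 :: 'k)"
    proof -
      have "swapped [1, 2] [1, 2] = {}" "swapped [2, 1] [2, 1] = {}" "swapped [1, 2] [2, 1] = {(1, 2)}" "swapped [2, 1] [1, 2] = {(2, 1)}"
        by (auto simp: swapped_def)
      then show "reorder_sign [1, 2] [1, 2] = (1 :: 'k)" "reorder_sign [2, 1] [2, 1] = (1 :: 'k)"
      "reorder_sign [1, 2] [2, 1] = (- 1 :: 'k)" "reorder_sign [2, 1] [1, 2] = (- 1 :: 'k)"
        by (simp_all add: reorder_sign_swapped)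
    qed
    show ?thesis
    proof (rule desusp_AsI)
      fix v w :: "nat list" assume "v \<in> lin_orders {1, 2}" "w \<in> lin_orders {1, 2}"
      then show "product_elt v = (\<lambda>l. reorder_sign v w * product_elt w l :: 'k)"
        unfolding lo using rs by (auto simp: product_elt_def fun_eq_iff)
    qed (auto simp: lin_orders_def product_elt_def free_mod_def symb_def)
  qed
  have "symb ?z \<in> product_class" unfolding product_class_def by (rule coh_class_self[OF submodules_max])
  then have r: "represents {1, 2} product_elt (symb ?z)"
    using pe product by (simp add: represents_def)
  have le: "lin_ext (chains (as_part {1, 2}) as_le (card {1, 2 :: nat} - 1)) (\<lambda>xs. symb (map (map ((`) \<sigma>)) xs)) (symb ?z)
      = (symb [[{a, b}], [{a}, {b}]] :: _ \<Rightarrow> 'k)"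
  proof
    fix u
    have "lin_ext (chains (as_part {1, 2}) as_le 1) (\<lambda>xs. symb (map (map ((`) \<sigma>)) xs)) (symb ?z) u
      = (\<Sum>xs\<in>chains (as_part {1, 2}) as_le 1. if xs = ?z then symb (map (map ((`) \<sigma>)) ?z) u else (0 :: 'k))"
      unfolding lin_ext_def by (rule sum.cong) (auto simp: symb_def)
    also have "\<dots> = symb (map (map ((`) \<sigma>)) ?z) u" using z finite_chains[OF finite_as_part[OF o.finS]] by simp
    also have "map (map ((`) \<sigma>)) ?z = [[{a, b}], [{a}, {b}]]" using \<sigma> by simp
    finally show "lin_ext (chains (as_part {1, 2}) as_le (card {1, 2 :: nat} - 1)) (\<lambda>xs. symb (map (map ((`) \<sigma>)) xs)) (symb ?z) u
      = (symb [[{a, b}], [{a}, {b}]] u :: 'k)" unfolding card12 .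
  qed
  have R: "represents {a, b} (relabel (desusp As) {1, 2} (card {1, 2 :: nat} - 1) \<sigma> product_elt) (symb [[{a, b}], [{a}, {b}]])"
    using com_value_relabel(1)[OF o12 \<sigma>(1) r] unfolding le \<sigma>(2) .
  show "(symb [[{a, b}], [{a}, {b}]] :: _ \<Rightarrow> 'k) \<in> as_check {a, b} 1"
    using represents_check[OF oab R] ab by simp
  have inv: "inv_into {1, 2} \<sigma> a = 1" "inv_into {1, 2} \<sigma> b = 2"
    using inv_into_f_f[OF \<sigma>(1), of 1] inv_into_f_f[OF \<sigma>(1), of 2] \<sigma>(3,4) by auto
  have one: "com_value {1, 2} (symb ?z) = (\<lambda>w. if w = [1, 2] then 1 else if w = [2, 1] then - 1 else 0)"
  proof
    fix w
    have l: "[1, 2] \<in> lin_orders {1, 2 :: nat}" by (auto simp: lin_orders_def)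
    have s: "(\<Sum>l\<in>lin_orders {1, 2}. symb [1, 2] l) = (1 :: 'k)"
      using l finite_lin_orders[of "{1, 2}"] by (simp add: symb_def)
    show "com_value {1, 2} (symb ?z) w = (if w = [1, 2] then 1 else if w = [2, 1] then - 1 else 0)"
      unfolding com_value[OF o12 r, of 0] desusp_map_def As_to_Com_def product_elt_def
      using s by (simp add: sum_negf)
  qed
  show "com_value {a, b} (symb [[{a, b}], [{a}, {b}]]) = (\<lambda>w. if w = [a, b] then 1 else if w = [b, a] then - 1 else 0)"
  proof
    fix w
    have "com_value {a, b} (symb [[{a, b}], [{a}, {b}]]) w
      = (if w \<in> lin_orders {a, b} then com_value {1, 2} (symb ?z) (map (inv_into {1, 2} \<sigma>) w) else 0)"
      using com_value_relabel(2)[OF o12 \<sigma>(1) r] unfolding le \<sigma>(2) desusp_Com_simps by simp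
    moreover have "w \<in> lin_orders {a, b} \<longleftrightarrow> w = [a, b] \<or> w = [b, a]"
    proof
      assume "w \<in> lin_orders {a, b}"
      then have w: "distinct w" "set w = {a, b}" by (auto simp: lin_orders_def)
      then have "length w = 2" using distinct_card[of w] ab by simp
      then obtain x y where "w = [x, y]" by (auto simp: length_Suc_conv numeral_2_eq_2)
      then show "w = [a, b] \<or> w = [b, a]" using w by (auto simp: doubleton_eq_iff)
    qed (use ab in \<open>auto simp: lin_orders_def\<close>)
    ultimately show "com_value {a, b} (symb [[{a, b}], [{a}, {b}]]) w = (if w = [a, b] then 1 else if w = [b, a] then - 1 else 0)"
      using ab inv one by auto
  qed
qed

text \<open>Exchanging the two points of a pair changes the sign of the enumeration but not the commutative
  product; so the sum of the two maximal chains dies in \<open>\<Lambda>\<^sup>-\<^sup>1Com\<close>.\<close>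

lemma pair_value:
  assumes T: "card T = 2"
  shows "com_value T (full_cochain T) = (\<lambda>_. 0)"
proof -
  obtain a b where ab: "T = {a, b}" "a \<noteq> b" using T by (auto simp: card_2_iff)
  have oT: "ordered_partitions {a, b}" by unfold_locales auto
  interpret ordered_partitions "{a, b}" by (rule oT)
  have c1: "card {a, b} - 1 = 1" using ab by simp
  have p: "[{a, b}] \<in> as_part {a, b}" "[{a}, {b}] \<in> as_part {a, b}" "[{b}, {a}] \<in> as_part {a, b}"
    using ab(2) by (auto simp: as_part_Cons as_part_Nil)
  have lts: "lt_of as_le [{a, b}] v \<longleftrightarrow> v = [{a}, {b}] \<or> v = [{b}, {a}]" if v: "v \<in> as_part {a, b}" for v
  proof
    assume l: "lt_of as_le [{a, b}] v"
    have "length v = 2" using lt_length[OF l] length_as_part[OF v] ab(2) by simp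
    then obtain A B where AB: "v = [A, B]" by (auto simp: length_Suc_conv numeral_2_eq_2)
    then have A: "A \<noteq> {}" "A \<subseteq> {a, b}" "B \<noteq> {}" "B = {a, b} - A" using v by (auto simp: as_part_Cons as_part_Nil)
    have "A = {} \<or> A = {a} \<or> A = {b} \<or> A = {a, b}" using A(2) by blast
    then have "A = {a} \<or> A = {b}" using A(1,3,4) by (elim disjE) simp_all
    moreover have "{a, b} - {a} = {b}" "{a, b} - {b} = {a}" using ab(2) by auto
    ultimately show "v = [{a}, {b}] \<or> v = [{b}, {a}]" unfolding AB A(4) by (elim disjE) simp_all
  next
    assume "v = [{a}, {b}] \<or> v = [{b}, {a}]"
    then show "lt_of as_le [{a, b}] v" using cuts_imp_as_le[OF p(1) v] by (auto simp: lt_of_def)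
  qed
  have ch: "z \<in> chains (as_part {a, b}) as_le 1 \<longleftrightarrow> z = [[{a, b}], [{a}, {b}]] \<or> z = [[{a, b}], [{b}, {a}]]" for z
  proof
    assume "z \<in> chains (as_part {a, b}) as_le 1"
    then have z: "length z = 2" "set z \<subseteq> as_part {a, b}" "sorted_wrt (lt_of as_le) z" "hd z = [{a, b}]"
      by (auto simp: chains_def minimal_as_part)
    then obtain u v where uv: "z = [u, v]" by (auto simp: length_Suc_conv numeral_2_eq_2)
    then have "u = [{a, b}]" "v \<in> as_part {a, b}" "lt_of as_le u v" using z by auto
    note uv this
    then show "z = [[{a, b}], [{a}, {b}]] \<or> z = [[{a, b}], [{b}, {a}]]" using lts[of v] by simp
  next
    assume "z = [[{a, b}], [{a}, {b}]] \<or> z = [[{a, b}], [{b}, {a}]]"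
    then show "z \<in> chains (as_part {a, b}) as_le 1"
      using p lts[OF p(2)] lts[OF p(3)] minimal_as_part[of "{a, b}" "[{a, b}]"] by (auto simp: chains_def)
  qed
  have f: "full_cochain {a, b} = (\<lambda>z. symb [[{a, b}], [{a}, {b}]] z + symb [[{a, b}], [{b}, {a}]] z :: 'k)"
    unfolding full_cochain_def c1 ch using ab(2) by (auto simp: symb_def fun_eq_iff)
  have ba: "{b, a} = {a, b}" by auto
  note v1 = pair_chain_value[OF ab(2)] and v2 = pair_chain_value[OF ab(2)[symmetric], unfolded ba]
  have "com_value {a, b} (full_cochain {a, b}) = (\<lambda>w. com_value {a, b} (symb [[{a, b}], [{a}, {b}]]) w + com_value {a, b} (symb [[{a, b}], [{b}, {a}]]) w)"
    unfolding f by (rule com_value_add[OF oT]) (use v1(1) v2(1) c1 in simp_all)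
  also have "\<dots> = (\<lambda>_. 0)" unfolding v1(2) v2(2) using ab(2) by (auto simp: fun_eq_iff)
  finally show ?thesis using ab(1) by simp
qed

lemma com_value_sum:
  assumes oS: "ordered_partitions S" and "finite X"
    and "\<And>x. x \<in> X \<Longrightarrow> f x \<in> as_check S (card S - 1) \<and> com_value S (f x) = (\<lambda>_. 0)"
  shows "(\<lambda>z. \<Sum>x\<in>X. k x * f x z) \<in> as_check S (card S - 1)
    \<and> com_value S (\<lambda>z. \<Sum>x\<in>X. k x * f x z) = (\<lambda>_. 0)"
  using assms(2,3)
proof (induction X rule: finite_induct)
  case empty
  then show ?case using com_value_zero[OF oS] submodules_zero[OF submodules_check] by simp
next
  case (insert x X)
  let ?g = "\<lambda>z. k x * f x z" and ?h = "\<lambda>z. \<Sum>x\<in>X. k x * f x z"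
  have g: "?g \<in> as_check S (card S - 1)" "com_value S ?g = (\<lambda>_. 0)"
    using insert.prems[of x] submodules_scale[OF submodules_check] com_value_scale[OF oS, of "f x" "k x"] by auto
  have h: "?h \<in> as_check S (card S - 1)" "com_value S ?h = (\<lambda>_. 0)" using insert by auto
  have e: "(\<lambda>z. \<Sum>x\<in>insert x X. k x * f x z) = (\<lambda>z. ?g z + ?h z)" using insert.hyps by simp
  show ?case unfolding e using submodules_add[OF submodules_check g(1) h(1)] com_value_add[OF oS g(1) h(1)] g(2) h(2) by simp
qed

text \<open>If the chain ends in a maximal element, its boundary is a coboundary of the smaller
  complex already. Otherwise it stops one refinement short, and \<open>rho_two_block\<close>
  presents the boundary as a composite.\<close>

lemma com_value_diff_symb:
  assumes oS: "ordered_partitions S" and n: "card S = Suc (Suc p)" and z: "z \<in> chains (as_part S) as_le p"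
  shows "(as_diff S p (symb z) :: _ \<Rightarrow> 'k) \<in> as_check S (card S - 1) \<and> com_value S (as_diff S p (symb z)) = (\<lambda>_. 0)"
proof -
  interpret ordered_partitions S by (rule oS)
  show ?thesis
  proof (cases "maximal_in (as_part S) as_le (last z)")
    case True
    then have "symb z \<in> as_max S p" using z by (simp add: c_max_def free_mod_def max_chains_def symb_def)
    then have "as_diff S p (symb z) \<in> coboundaries (as_max S) (as_diff S) top" using n by (auto simp: coboundaries_def)
    note b = this
    have "as_diff S p (symb z) \<in> coboundaries (as_check S) (as_diff S) top"
      by (rule subsetD[OF coboundaries_max_check b])
    then show ?thesis using diff_support com_value_max_coboundary[OF oS b] by simp
  next
    case False
    define x where "x = last z"
    note R = rho_two_block[OF n z x_def False[folded x_def]]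
    interpret b: ordered_partitions "blocks x" by (rule block_partitions(1)[OF R(2)])
    have cb: "card (blocks x) - 1 = p" using card_blocks[OF R(2)] R(3) n by simp
    have "map (phi x) z \<in> chains (as_part (blocks x)) as_le p"
      using phi_chain[OF z x_def] by (simp add: max_chains_def)
    then have "symb (map (phi x) z) \<in> as_check (blocks x) (card (blocks x) - 1)"
      unfolding cb by (auto simp: c_check_def free_mod_def symb_def)
    then obtain F where F: "represents (blocks x) F (symb (map (phi x) z))"
      using represents_ex[OF b.ordered_partitions_axioms] by blast
    have full: "map full_cochain x ! i \<in> as_check (x ! i) (card (x ! i) - 1)" if "i < length x" for i
      using that by (simp add: full_cochain_def c_check_def free_mod_def)
    have lf: "length (map full_cochain x) = length x" by simp
    note C = com_value_rho[OF oS R(2) cb[symmetric] refl F lf full]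
    obtain j where j: "j < length x" "card (x ! j) = 2" using two_block[OF R(2,3)] by blast
    \<comment> \<open>One vanishing factor suffices, since composition is linear in each
      argument.\<close>
    have "map2 com_value x (map full_cochain x) ! j = (\<lambda>_. 0)" using j pair_value[of "x ! j"] by simp
    then have "com_value S (rho x p (map (\<lambda>B. card B - 1) x) (symb (map (phi x) z)) (map full_cochain x)) = (\<lambda>_. 0)"
      by (intro trans[OF C(2)[where n = 0]] desusp_Com_compose_zero) (use j(1) in auto)
    then show ?thesis unfolding R(1)
      using com_value_scale[OF oS C(1), of "(- 1) ^ Suc p"] submodules_scale[OF submodules_check C(1), of "(- 1) ^ Suc p"] by simp
  qed
qed

lemma com_value_coboundary:
  assumes oS: "ordered_partitions S" and b: "b \<in> coboundaries (as_check S) (as_diff S) (card S - 1)"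
  shows "com_value S b = (\<lambda>_. 0)"
proof (cases "card S - 1")
  case 0
  then show ?thesis using b com_value_zero[OF oS] by (simp add: coboundaries_def)
next
  case (Suc p)
  interpret ordered_partitions S by (rule oS)
  have n: "card S = Suc (Suc p)" using Suc by simp
  obtain c where c: "b = as_diff S p c" using b Suc by (auto simp: coboundaries_def)
  have fC: "finite (chains (as_part S) as_le p)" by (rule finite_chains[OF finite_as_part[OF finS]])
  have ds: "as_diff S p (symb z) = (diff_sym (as_part S) as_le z :: _ \<Rightarrow> 'k)" if z: "z \<in> chains (as_part S) as_le p" for z
  proof
    fix u
    have "as_diff S p (symb z) u = (\<Sum>w\<in>chains (as_part S) as_le p. if w = z then diff_sym (as_part S) as_le z u else (0::'k))"
      unfolding diff_def lin_ext_def by (rule sum.cong) (auto simp: symb_def)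
    then show "as_diff S p (symb z) u = (diff_sym (as_part S) as_le z u :: 'k)" using z fC by simp
  qed
  have "b = (\<lambda>u. \<Sum>z\<in>chains (as_part S) as_le p. c z * diff_sym (as_part S) as_le z u)"
    unfolding c diff_def lin_ext_def ..
  moreover have "com_value S (\<lambda>u. \<Sum>z\<in>chains (as_part S) as_le p. c z * diff_sym (as_part S) as_le z u) = (\<lambda>_. 0)"
    by (rule conjunct2[OF com_value_sum[OF oS fC]]) (use com_value_diff_symb[OF oS n] ds in metis)
  ultimately show ?thesis by simp
qed

lemma com_value_piece:
  assumes oS: "ordered_partitions S" and a: "a \<in> as_check S (card S - 1)"
  shows "com_value S a \<in> piece (desusp Com) S (card S - 1)"
proof -
  obtain F where F: "represents S F a" using represents_ex[OF oS a] by blast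
  show ?thesis unfolding com_value[OF oS F, of 0]
    by (rule desusp_map_piece) (use F in \<open>simp add: represents_def\<close>)
qed

lemma com_value_surj:
  assumes oS: "ordered_partitions S" and G: "G \<in> piece (desusp Com) S (card S - 1)"
  shows "\<exists>a\<in>as_check S (card S - 1). com_value S a = G"
proof -
  interpret ordered_partitions S by (rule oS)
  obtain F where F: "F \<in> piece (desusp As) S top" "desusp_map As_to_Com S 0 F = G"
    using desusp_map_surj[OF finS G] by blast
  have "\<Psi> S top F \<in> cohomology (as_max S) (as_diff S) top" using bij_betwE[OF bij[OF oS]] F(1) by blast
  then obtain a where "a \<in> \<Psi> S top F" using class_nonempty(2) by blast
  then have r: "represents S F a" using F(1) by (simp add: represents_def)
  show ?thesis using represents_check[OF oS r] com_value[OF oS r, of 0] F(2) by auto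
qed

text \<open>The top cohomology is cyclic and surjects linearly onto \<open>K\<close>, so this surjection is injective.\<close>

lemma com_value_kernel:
  assumes oS: "ordered_partitions S" and c: "c \<in> as_check S (card S - 1)" and z: "com_value S c = (\<lambda>_. 0)"
  shows "c \<in> coboundaries (as_check S) (as_diff S) (card S - 1)"
proof -
  interpret ordered_partitions S by (rule oS)
  obtain l where l: "l \<in> lin_orders S" using lin_orders_nonempty[OF finS] by auto
  \<comment> \<open>The element of \<open>desusp Com\<close> normalised to have value 1 at
    \<open>l\<close>; a preimage of it is used to measure multiples of the generator.\<close>
  define G where "G w = (if w \<in> lin_orders S then reorder_sign w l else 0 :: 'k)" for w
  have "G \<in> piece (desusp Com) S top"
  proof (rule desusp_ComI)
    fix v w assume vw: "v \<in> lin_orders S" "w \<in> lin_orders S"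
    have "order_sign v * order_sign l = (order_sign v * (order_sign w * order_sign w) * order_sign l :: 'k)"
      by (simp add: order_sign_square)
    also have "\<dots> = reorder_sign v w * reorder_sign w l"
      using reorder_sign_eq[OF vw, where 'k='k] reorder_sign_eq[OF vw(2) l, where 'k='k] by (simp add: mult.assoc)
    finally show "G v = reorder_sign v w * G w" using vw reorder_sign_eq[OF vw(1) l, where 'k='k] by (simp add: G_def)
  qed (simp add: G_def)
  then obtain c1 where c1: "c1 \<in> as_check S top" "com_value S c1 = G" using com_value_surj[OF oS] by blast
  have Gl: "G l = 1" using l reorder_sign_eq[OF l l, where 'k='k] by (simp add: G_def order_sign_square)
  obtain t :: "nat set list list \<Rightarrow> 'k" where t: "\<forall>c\<in>as_check S top. \<exists>b\<in>coboundaries (as_check S) (as_diff S) top. \<exists>a. c = (\<lambda>z. a * t z + b z)"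
    using check_cyclic[where 'k='k] by blast
  obtain b k where b: "b \<in> coboundaries (as_check S) (as_diff S) top" "c = (\<lambda>z. k * t z + b z)" using t c by blast
  obtain b1 k1 where b1: "b1 \<in> coboundaries (as_check S) (as_diff S) top" "c1 = (\<lambda>z. k1 * t z + b1 z)" using t c1(1) by blast
  \<comment> \<open>Cross-multiplication eliminates the generator \<open>t\<close>, so this
    combination is a coboundary. Its value at \<open>l\<close> is \<open>- k\<close>, which gives
    \<open>k = 0\<close> without any division.\<close>
  have e: "(\<lambda>z. k1 * c z + (- k) * c1 z) = (\<lambda>z. k1 * b z + (- k) * b1 z)"
    unfolding b(2) b1(2) by (simp add: algebra_simps)
  have "(\<lambda>z. k1 * b z + (- k) * b1 z) \<in> coboundaries (as_check S) (as_diff S) top"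
    by (rule coboundary_add[OF submodules_check coboundary_scale[OF submodules_check b(1)] coboundary_scale[OF submodules_check b1(1)]])
  then have "com_value S (\<lambda>z. k1 * c z + (- k) * c1 z) = (\<lambda>_. 0)" unfolding e by (rule com_value_coboundary[OF oS])
  then have "(\<lambda>w. k1 * com_value S c w + (- k) * com_value S c1 w) = (\<lambda>_. 0)"
    using com_value_add[OF oS submodules_scale[OF submodules_check c, of k1] submodules_scale[OF submodules_check c1(1), of "- k"]]
    unfolding com_value_scale[OF oS c] com_value_scale[OF oS c1(1)] by simp
  then have "k1 * com_value S c l + (- k) * com_value S c1 l = 0" by (rule fun_cong)
  then have "k = 0" using z c1(2) Gl by simp
  then show ?thesis using b by simp
qed

text \<open>The kernel of \<open>com_value\<close> is the module of coboundaries, so the top classes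
  of the larger complex are the fibres of \<open>com_value\<close>. Questions about classes thereby
  become questions about values.\<close>

lemma check_class_iff:
  assumes oS: "ordered_partitions S" and c: "c \<in> as_check S (card S - 1)"
  shows "x \<in> coh_class (as_check S) (as_diff S) (card S - 1) c
    \<longleftrightarrow> x \<in> as_check S (card S - 1) \<and> com_value S x = com_value S c"
proof -
  interpret ordered_partitions S by (rule oS)
  have mc: "(\<lambda>z. - 1 * c z) \<in> as_check S top" by (rule submodules_scale[OF submodules_check c])
  have d: "com_value S (\<lambda>z. x z - c z) = (\<lambda>w. com_value S x w - com_value S c w)"
    if x: "x \<in> as_check S top" for x
    using com_value_add[OF oS x mc] com_value_scale[OF oS c, of "- 1"] by simp
  show ?thesis
  proof
    assume "x \<in> coh_class (as_check S) (as_diff S) top c"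
    then have b: "(\<lambda>z. x z - c z) \<in> coboundaries (as_check S) (as_diff S) top" by (simp add: coh_class_iff)
    then have "(\<lambda>z. (x z - c z) + c z) \<in> as_check S top"
      by (intro submodules_add[OF submodules_check diff_support c])
    then have x: "x \<in> as_check S top" by simp
    have "(\<lambda>w. com_value S x w - com_value S c w) = (\<lambda>_. 0)"
      using com_value_coboundary[OF oS b] d[OF x] by simp
    then have "com_value S x = com_value S c" by (auto simp: fun_eq_iff)
    then show "x \<in> as_check S top \<and> com_value S x = com_value S c" using x by simp
  next
    assume x: "x \<in> as_check S top \<and> com_value S x = com_value S c"
    then have "com_value S (\<lambda>z. x z - c z) = (\<lambda>_. 0)" using d by simp
    moreover have "(\<lambda>z. x z - c z) \<in> as_check S top"
      using submodules_add[OF submodules_check conjunct1[OF x] mc] by simp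
    ultimately show "x \<in> coh_class (as_check S) (as_diff S) top c"
      unfolding coh_class_iff by (intro com_value_kernel[OF oS])
  qed
qed

text \<open>The chosen member is irrelevant in top degree, since \<open>com_value\<close> is
  constant on a class. In all other degrees both modules are zero.\<close>

definition check_to_Com :: "nat set \<Rightarrow> nat \<Rightarrow> (nat set list list \<Rightarrow> 'k) set \<Rightarrow> nat list \<Rightarrow> 'k" where
  "check_to_Com S n X = (if n = card S - 1 then com_value S (SOME a. a \<in> X) else (\<lambda>_. 0))"

text \<open>Operations on classes are unions over representatives. With this criterion it is enough
  that such a union is nonempty and that all its members have one value; it need not first be
  identified as a class.\<close>

lemma check_to_Com_eq:
  assumes "X \<noteq> {}" "\<And>x. x \<in> X \<Longrightarrow> com_value S x = G"
  shows "check_to_Com S (card S - 1) X = G"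
proof -
  have "(SOME a. a \<in> X) \<in> X" using assms(1) by (simp add: some_in_eq)
  then show ?thesis using assms(2) by (simp add: check_to_Com_def)
qed

lemma check_to_Com_class:
  assumes oS: "ordered_partitions S" and X: "X \<in> cohomology (as_check S) (as_diff S) (card S - 1)"
  obtains c where "c \<in> X" "c \<in> as_check S (card S - 1)" "X = coh_class (as_check S) (as_diff S) (card S - 1) c"
    "check_to_Com S (card S - 1) X = com_value S c"
    "\<And>x. x \<in> X \<Longrightarrow> x \<in> as_check S (card S - 1) \<and> com_value S x = check_to_Com S (card S - 1) X"
proof -
  obtain c where c: "c \<in> as_check S (card S - 1)" "X = coh_class (as_check S) (as_diff S) (card S - 1) c"
    using X by (auto simp: cohomology_def cocycles_def)
  have cX: "c \<in> X" unfolding c(2) by (rule coh_class_self[OF submodules_check])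
  have mem: "x \<in> as_check S (card S - 1) \<and> com_value S x = com_value S c" if x: "x \<in> X" for x
    using x unfolding c(2) check_class_iff[OF oS c(1)] .
  have e: "check_to_Com S (card S - 1) X = com_value S c"
  proof (rule check_to_Com_eq)
    show "X \<noteq> {}" using cX by blast
  qed (rule conjunct2[OF mem])
  show ?thesis
  proof (rule that[OF cX c e])
    fix x assume "x \<in> X"
    from mem[OF this] show "x \<in> as_check S (card S - 1) \<and> com_value S x = check_to_Com S (card S - 1) X"
      unfolding e .
  qed
qed

lemma check_to_Com_bij_top:
  assumes oS: "ordered_partitions S"
  shows "bij_betw (check_to_Com S (card S - 1)) (cohomology (as_check S) (as_diff S) (card S - 1)) (piece (desusp Com) S (card S - 1))"
  unfolding bij_betw_def
proof
  interpret ordered_partitions S by (rule oS)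
  show "inj_on (check_to_Com S top) (cohomology (as_check S) (as_diff S) top)"
  proof (rule inj_onI)
    fix X Y assume XY: "X \<in> cohomology (as_check S) (as_diff S) top" "Y \<in> cohomology (as_check S) (as_diff S) top"
      "check_to_Com S top X = check_to_Com S top Y"
    obtain c where c: "c \<in> as_check S top" "X = coh_class (as_check S) (as_diff S) top c" "check_to_Com S top X = com_value S c"
      using check_to_Com_class[OF oS XY(1)] by metis
    obtain e where e: "e \<in> as_check S top" "Y = coh_class (as_check S) (as_diff S) top e" "check_to_Com S top Y = com_value S e"
      using check_to_Com_class[OF oS XY(2)] by metis
    have "com_value S c = com_value S e" using c(3) e(3) XY(3) by simp
    then show "X = Y" unfolding c(2) e(2) by (intro set_eqI) (simp only: check_class_iff[OF oS c(1)] check_class_iff[OF oS e(1)])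
  qed
  show "check_to_Com S top ` cohomology (as_check S) (as_diff S) top = piece (desusp Com) S top"
  proof (intro equalityI subsetI)
    fix G assume "G \<in> check_to_Com S top ` cohomology (as_check S) (as_diff S) top"
    then obtain X where X: "X \<in> cohomology (as_check S) (as_diff S) top" "G = check_to_Com S top X" by blast
    obtain c where "c \<in> as_check S top" "check_to_Com S top X = com_value S c" using check_to_Com_class[OF oS X(1)] by metis
    then show "G \<in> piece (desusp Com) S top" using com_value_piece[OF oS] X(2) by simp
  next
    fix G :: "nat list \<Rightarrow> 'k"
    assume "G \<in> piece (desusp Com) S top"
    then obtain a where a: "a \<in> as_check S top" "com_value S a = G" using com_value_surj[OF oS] by blast
    have X: "coh_class (as_check S) (as_diff S) top a \<in> cohomology (as_check S) (as_diff S) top"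
      unfolding cohomology_def cocycles_top using a(1) by blast
    have "check_to_Com S top (coh_class (as_check S) (as_diff S) top a) = G"
    proof (rule check_to_Com_eq)
      show "coh_class (as_check S) (as_diff S) top a \<noteq> {}"
        by (rule ordered_partitions.class_nonempty(1)[OF oS X])
      show "com_value S x = G" if "x \<in> coh_class (as_check S) (as_diff S) top a" for x
        using that a(2) unfolding check_class_iff[OF oS a(1)] by simp
    qed
    then show "G \<in> check_to_Com S top ` cohomology (as_check S) (as_diff S) top" using X by blast
  qed
qed

lemma check_to_Com_species_iso:
  "species_iso (restrict_module \<Psi> h_check_module)
     (restrict_module (desusp_map As_to_Com) (regular_module (desusp Com))) check_to_Com"
  unfolding species_iso_def check_module_simps Com_module_simps desusp_Com_simps
proof (intro allI impI)
  fix S :: "nat set" and n :: nat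
  assume "finite S \<and> S \<noteq> {}"
  then have oS: "ordered_partitions S" by (simp add: ordered_partitions_def)
  interpret ordered_partitions S by (rule oS)
  let ?H = "cohomology (as_check S) (as_diff S) n :: (nat set list list \<Rightarrow> 'k) set set"
  show "bij_betw (check_to_Com S n) ?H (piece (desusp Com) S n) \<and>
    (\<forall>a\<in>?H. \<forall>b\<in>?H. check_to_Com S n (\<Union>a\<in>a. \<Union>b\<in>b. coh_class (as_check S) (as_diff S) n (\<lambda>z. a z + b z))
        = (\<lambda>w. check_to_Com S n a w + check_to_Com S n b w)) \<and>
    (\<forall>k. \<forall>a\<in>?H. check_to_Com S n (\<Union>a\<in>a. coh_class (as_check S) (as_diff S) n (\<lambda>z. k * a z))
        = (\<lambda>w. k * check_to_Com S n a w)) \<and>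
    (\<forall>\<sigma>. inj_on \<sigma> S \<longrightarrow> (\<forall>a\<in>?H. check_to_Com (\<sigma> ` S) n
        (\<Union>a\<in>a. coh_class (as_check (\<sigma> ` S)) (as_diff (\<sigma> ` S)) n
          (lin_ext (chains (as_part S) as_le n) (\<lambda>xs. symb (map (map ((`) \<sigma>)) xs)) a))
        = (\<lambda>w. if w \<in> lin_orders (\<sigma> ` S) then check_to_Com S n a (map (inv_into S \<sigma>) w) else 0)))"
  proof (cases "n = top")
    case False
    have z: "check_to_Com S n X = (\<lambda>_. 0)" for X using False by (simp add: check_to_Com_def)
    have z': "check_to_Com (\<sigma> ` S) n X = (\<lambda>_. 0)" if "inj_on \<sigma> S" for X \<sigma>
      using False card_image[OF that] by (simp add: check_to_Com_def)
    have "piece (desusp Com) S n = {\<lambda>_. 0 :: 'k}" using False by (auto simp: desusp_Com_piece)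
    then show ?thesis using z z' by (auto simp: cohomology_off_top[OF False] bij_betw_def)
  next
    case True
    have "bij_betw (check_to_Com S n) ?H (piece (desusp Com) S n)"
      unfolding True by (rule check_to_Com_bij_top[OF oS])
    moreover have "check_to_Com S n (\<Union>a\<in>A. \<Union>b\<in>B. coh_class (as_check S) (as_diff S) n (\<lambda>z. a z + b z))
        = (\<lambda>w. check_to_Com S n A w + check_to_Com S n B w)" if AB: "A \<in> ?H" "B \<in> ?H" for A B
      unfolding True
    proof (rule check_to_Com_eq)
      obtain a where a: "a \<in> A" "\<And>x. x \<in> A \<Longrightarrow> x \<in> as_check S top \<and> com_value S x = check_to_Com S top A"
        using check_to_Com_class[OF oS AB(1)[unfolded True]] by blast
      obtain b where b: "b \<in> B" "\<And>x. x \<in> B \<Longrightarrow> x \<in> as_check S top \<and> com_value S x = check_to_Com S top B"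
        using check_to_Com_class[OF oS AB(2)[unfolded True]] by blast
      have "(\<lambda>z. a z + b z) \<in> (\<Union>a\<in>A. \<Union>b\<in>B. coh_class (as_check S) (as_diff S) top (\<lambda>z. a z + b z))"
        by (rule UN_I[OF a(1)], rule UN_I[OF b(1)], rule coh_class_self[OF submodules_check])
      then show "(\<Union>a\<in>A. \<Union>b\<in>B. coh_class (as_check S) (as_diff S) top (\<lambda>z. a z + b z)) \<noteq> {}" by blast
      fix x assume "x \<in> (\<Union>a\<in>A. \<Union>b\<in>B. coh_class (as_check S) (as_diff S) top (\<lambda>z. a z + b z))"
      then obtain a' b' where x: "a' \<in> A" "b' \<in> B" "x \<in> coh_class (as_check S) (as_diff S) top (\<lambda>z. a' z + b' z)" by blast
      have ab: "a' \<in> as_check S top" "b' \<in> as_check S top" using a(2)[OF x(1)] b(2)[OF x(2)] by auto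
      have "com_value S x = com_value S (\<lambda>z. a' z + b' z)"
        using x(3) check_class_iff[OF oS submodules_add[OF submodules_check ab]] by blast
      then show "com_value S x = (\<lambda>w. check_to_Com S top A w + check_to_Com S top B w)"
        using com_value_add[OF oS ab] a(2)[OF x(1)] b(2)[OF x(2)] by simp
    qed
    moreover have "check_to_Com S n (\<Union>a\<in>A. coh_class (as_check S) (as_diff S) n (\<lambda>z. k * a z))
        = (\<lambda>w. k * check_to_Com S n A w)" if A: "A \<in> ?H" for A k
      unfolding True
    proof (rule check_to_Com_eq)
      obtain a where a: "a \<in> A" "\<And>x. x \<in> A \<Longrightarrow> x \<in> as_check S top \<and> com_value S x = check_to_Com S top A"
        using check_to_Com_class[OF oS A[unfolded True]] by blast
      have "(\<lambda>z. k * a z) \<in> (\<Union>a\<in>A. coh_class (as_check S) (as_diff S) top (\<lambda>z. k * a z))"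
        by (rule UN_I[OF a(1)], rule coh_class_self[OF submodules_check])
      then show "(\<Union>a\<in>A. coh_class (as_check S) (as_diff S) top (\<lambda>z. k * a z)) \<noteq> {}" by blast
      fix x assume "x \<in> (\<Union>a\<in>A. coh_class (as_check S) (as_diff S) top (\<lambda>z. k * a z))"
      then obtain a' where x: "a' \<in> A" "x \<in> coh_class (as_check S) (as_diff S) top (\<lambda>z. k * a' z)" by blast
      have ab: "a' \<in> as_check S top" using a(2)[OF x(1)] by auto
      have "com_value S x = com_value S (\<lambda>z. k * a' z)"
        using x(2) check_class_iff[OF oS submodules_scale[OF submodules_check ab]] by blast
      then show "com_value S x = (\<lambda>w. k * check_to_Com S top A w)"
        using com_value_scale[OF oS ab] a(2)[OF x(1)] by simp
    qed
    moreover have "check_to_Com (\<sigma> ` S) n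
        (\<Union>a\<in>A. coh_class (as_check (\<sigma> ` S)) (as_diff (\<sigma> ` S)) n
          (lin_ext (chains (as_part S) as_le n) (\<lambda>xs. symb (map (map ((`) \<sigma>)) xs)) a))
        = (\<lambda>w. if w \<in> lin_orders (\<sigma> ` S) then check_to_Com S n A (map (inv_into S \<sigma>) w) else 0)"
      if A: "A \<in> ?H" and \<sigma>: "inj_on \<sigma> S" for A \<sigma>
    proof -
      have oT: "ordered_partitions (\<sigma> ` S)" using oS by (simp add: ordered_partitions_def)
      have nT: "n = card (\<sigma> ` S) - 1" using True card_image[OF \<sigma>] by simp
      let ?r = "\<lambda>a. lin_ext (chains (as_part S) as_le n) (\<lambda>xs. symb (map (map ((`) \<sigma>)) xs)) a :: _ \<Rightarrow> 'k"
      let ?U = "\<Union>a\<in>A. coh_class (as_check (\<sigma> ` S)) (as_diff (\<sigma> ` S)) n (?r a)"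
      obtain a where a: "a \<in> A" "\<And>x. x \<in> A \<Longrightarrow> x \<in> as_check S top \<and> com_value S x = check_to_Com S top A"
        using check_to_Com_class[OF oS A[unfolded True]] by blast
      have ne: "?U \<noteq> {}"
      proof -
        have "?r a \<in> ?U" by (rule UN_I[OF a(1)], rule coh_class_self[OF submodules_check])
        then show ?thesis by blast
      qed
      have "com_value (\<sigma> ` S) x = relabel (desusp Com) S n \<sigma> (check_to_Com S n A)" if "x \<in> ?U" for x
      proof -
        obtain a' where x: "a' \<in> A" "x \<in> coh_class (as_check (\<sigma> ` S)) (as_diff (\<sigma> ` S)) n (?r a')" using \<open>x \<in> ?U\<close> by blast
        have a': "a' \<in> as_check S top" using a(2)[OF x(1)] by auto
        obtain F where F: "represents S F a'" using represents_ex[OF oS a'] by blast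
        have "?r a' \<in> as_check (\<sigma> ` S) (card (\<sigma> ` S) - 1)"
          using represents_check[OF oT com_value_relabel(1)[OF oS \<sigma> F]] True by simp
        then have "com_value (\<sigma> ` S) x = com_value (\<sigma> ` S) (?r a')"
          using x(2) check_class_iff[OF oT] nT by blast
        then show ?thesis using com_value_relabel(2)[OF oS \<sigma> F] a(2)[OF x(1)] True by simp
      qed
      then have "check_to_Com (\<sigma> ` S) (card (\<sigma> ` S) - 1) ?U = relabel (desusp Com) S n \<sigma> (check_to_Com S n A)"
        by (rule check_to_Com_eq[OF ne])
      then show ?thesis unfolding desusp_Com_simps nT[symmetric] .
    qed
    ultimately show ?thesis by blast
  qed
qed

text \<open>If all degrees are top degrees, this is \<open>com_value_rho\<close>. Otherwise some
  factor on the right is zero. On the left, either the total degree is not the top one, where the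
  map is zero by definition, or a cochain of too high degree makes \<open>rho\<close>
  vanish.\<close>

lemma check_to_Com_act:
  assumes oS: "ordered_partitions S" and Ts: "Ts \<in> as_part S" and lq: "length qs = length Ts"
    and a: "a \<in> piece (desusp As) (blocks Ts) p"
    and ms: "ms \<in> listset (map2 (\<lambda>T. cohomology (as_check T) (as_diff T)) Ts qs)"
  shows "check_to_Com S (p + sum_list qs) (rho_class as_check Ts p qs (\<Psi> (blocks Ts) p a) ms)
    = compose (desusp Com) Ts p qs (desusp_map As_to_Com (blocks Ts) p a) (apply_blocks check_to_Com Ts qs ms)"
proof -
  interpret ordered_partitions S by (rule oS)
  interpret b: ordered_partitions "blocks Ts" by (rule block_partitions(1)[OF Ts])
  have UN: "\<Union>(set Ts) = S" using as_part_Union[OF Ts] .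
  have oT: "ordered_partitions (Ts ! i)" if "i < length Ts" for i using block_partitions(2)[OF Ts] that by simp
  have lm: "length ms = length Ts" and mi: "\<And>i. i < length Ts \<Longrightarrow> ms ! i \<in> cohomology (as_check (Ts ! i)) (as_diff (Ts ! i)) (qs ! i)"
    using ms lq by (auto simp: listset_iff)
  have Pa: "\<Psi> (blocks Ts) p a \<in> cohomology (as_max (blocks Ts)) (as_diff (blocks Ts)) p"
    using bij_betwE[OF bij[OF b.ordered_partitions_axioms]] a by blast
  have ab: "apply_blocks check_to_Com Ts qs ms ! i = check_to_Com (Ts ! i) (qs ! i) (ms ! i)" if "i < length Ts" for i
    using that lq lm by (simp add: apply_blocks_def)
  have lab: "length (apply_blocks check_to_Com Ts qs ms) = length Ts" using lq lm by (simp add: apply_blocks_def)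
  let ?R = "rho_class as_check Ts p qs (\<Psi> (blocks Ts) p a) ms"
  have RI: "x \<in> ?R \<longleftrightarrow> (\<exists>a'\<in>\<Psi> (blocks Ts) p a. \<exists>bs\<in>listset ms.
      x \<in> coh_class (as_check S) (as_diff S) (p + sum_list qs) (rho Ts p qs a' bs))" for x
    by (simp add: rho_class_def UN)
  have ne: "?R \<noteq> {}"
  proof -
    obtain a' where a': "a' \<in> \<Psi> (blocks Ts) p a" using b.class_nonempty(2)[OF Pa] by blast
    have "(SOME x. x \<in> ms ! i) \<in> ms ! i" if i: "i < length Ts" for i
      using ordered_partitions.class_nonempty(1)[OF oT[OF i] mi[OF i]] by (simp add: some_in_eq)
    then have "map (\<lambda>m. SOME x. x \<in> m) ms \<in> listset ms" using lm by (simp add: listset_iff)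
    then have "rho Ts p qs a' (map (\<lambda>m. SOME x. x \<in> m) ms) \<in> ?R"
      unfolding RI using a' coh_class_self[OF submodules_check] by blast
    then show ?thesis by blast
  qed
  show ?thesis
  proof (cases "p = card (blocks Ts) - 1 \<and> (\<forall>i<length Ts. qs ! i = card (Ts ! i) - 1)")
    case True
    then have p: "p = card (blocks Ts) - 1" and qi: "\<And>i. i < length Ts \<Longrightarrow> qs ! i = card (Ts ! i) - 1" by auto
    have qs: "qs = map (\<lambda>T. card T - 1) Ts" by (rule nth_equalityI) (use lq qi in auto)
    have tot: "p + sum_list qs = top"
      using card_split[OF Ts] unfolding p qs by (simp add: sum_list_sum_nth atLeast0LessThan)
    show ?thesis unfolding tot
    proof (rule check_to_Com_eq[OF ne])
      fix x assume "x \<in> ?R"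
      then obtain a' bs where x: "a' \<in> \<Psi> (blocks Ts) p a" "bs \<in> listset ms"
          "x \<in> coh_class (as_check S) (as_diff S) top (rho Ts p qs a' bs)" unfolding RI tot by blast
      have r: "represents (blocks Ts) a a'" using x(1) a p by (simp add: represents_def)
      have lb: "length bs = length Ts" and bi: "\<And>i. i < length Ts \<Longrightarrow> bs ! i \<in> ms ! i" using x(2) lm by (auto simp: listset_iff)
      have bc: "bs ! i \<in> as_check (Ts ! i) (card (Ts ! i) - 1) \<and> com_value (Ts ! i) (bs ! i) = check_to_Com (Ts ! i) (card (Ts ! i) - 1) (ms ! i)"
        if i: "i < length Ts" for i
      proof -
        have "ms ! i \<in> cohomology (as_check (Ts ! i)) (as_diff (Ts ! i)) (card (Ts ! i) - 1)" using mi[OF i] qi[OF i] by simp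
        from check_to_Com_class[OF oT[OF i] this] show ?thesis using bi[OF i] by metis
      qed
      note C = com_value_rho[OF oS Ts p qs r lb conjunct1[OF bc]]
      have "map2 com_value Ts bs = apply_blocks check_to_Com Ts qs ms"
        by (rule nth_equalityI) (use lb lab ab bc qi in auto)
      then show "com_value S x = compose (desusp Com) Ts p qs (desusp_map As_to_Com (blocks Ts) p a) (apply_blocks check_to_Com Ts qs ms)"
        using x(3) check_class_iff[OF oS C(1)] C(2)[of p] by simp
    qed
  next
    case False
    then consider (p) "p \<noteq> card (blocks Ts) - 1" | (q) i where "i < length Ts" "qs ! i \<noteq> card (Ts ! i) - 1" by blast
    then have "desusp_map As_to_Com (blocks Ts) p a = (\<lambda>_. 0) \<or> (\<exists>i<length Ts. apply_blocks check_to_Com Ts qs ms ! i = (\<lambda>_. 0))"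
    proof cases
      case p
      then have "a = (\<lambda>_ _. 0)" using a unfolding desusp_As_piece by simp
      then show ?thesis by (simp add: desusp_map_def As_to_Com_zero)
    next
      case q
      then show ?thesis using ab[OF q(1)] by (auto simp: check_to_Com_def)
    qed
    then have rhs: "compose (desusp Com) Ts p qs (desusp_map As_to_Com (blocks Ts) p a) (apply_blocks check_to_Com Ts qs ms) = (\<lambda>_. 0)"
      by (rule desusp_Com_compose_zero[OF _ lab])
    have lhs: "check_to_Com S (p + sum_list qs) ?R = (\<lambda>_. 0)"
    proof (cases "p + sum_list qs = top")
      case tot: True
      \<comment> \<open>The degrees add up to the sum of the top degrees without all being equal to
        them, so one of them is too large. This is what is wanted: a class of too small degree is
        zero too, but its representatives need not vanish.\<close>
      have big: "p > card (blocks Ts) - 1 \<or> (\<exists>i<length Ts. qs ! i > card (Ts ! i) - 1)"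
      proof (rule ccontr)
        assume "\<not> ?thesis"
        then have le: "p \<le> card (blocks Ts) - 1" "\<And>i. i < length Ts \<Longrightarrow> qs ! i \<le> card (Ts ! i) - 1"
          by (meson not_less)+
        have sl: "sum_list qs = (\<Sum>i<length Ts. qs ! i)" using lq by (simp add: sum_list_sum_nth atLeast0LessThan)
        have s: "(\<Sum>i<length Ts. qs ! i) \<le> (\<Sum>i<length Ts. card (Ts ! i) - 1)" by (rule sum_mono, rule le(2)) simp
        then have pe: "p = card (blocks Ts) - 1" and "(\<Sum>i<length Ts. qs ! i) = (\<Sum>i<length Ts. card (Ts ! i) - 1)"
          using tot card_split[OF Ts] le(1) sl by linarith+
        then have "qs ! i = card (Ts ! i) - 1" if i: "i < length Ts" for i
          using sum_mono_inv[of "\<lambda>i. qs ! i" "{..<length Ts}" "\<lambda>i. card (Ts ! i) - 1" i] le(2) i by auto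
        then show False using \<open>\<not> (p = _ \<and> _)\<close> pe by blast
      qed
      have z: "rho Ts p qs a' bs = (\<lambda>_. 0)" if "a' \<in> \<Psi> (blocks Ts) p a" "bs \<in> listset ms" for a' bs
      proof (rule rho_zero, rule disjE[OF big])
        assume "p > card (blocks Ts) - 1"
        then have "a' = (\<lambda>_. 0)" using b.above_top_zero b.class_max_subset[OF Pa that(1)] by blast
        then show "a' = (\<lambda>_. 0) \<or> (\<exists>i<length Ts. bs ! i = (\<lambda>_. 0))" ..
      next
        assume "\<exists>i<length Ts. qs ! i > card (Ts ! i) - 1"
        then obtain i where i: "i < length Ts" "qs ! i > card (Ts ! i) - 1" by blast
        have "bs ! i \<in> ms ! i" using that(2) i(1) lm by (auto simp: listset_iff)
        then have "bs ! i \<in> as_check (Ts ! i) (qs ! i)"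
          by (rule ordered_partitions.class_check_subset[OF oT[OF i(1)] mi[OF i(1)]])
        then have "bs ! i = (\<lambda>_. 0)" by (rule ordered_partitions.above_top_zero[OF oT[OF i(1)] i(2)])
        then show "a' = (\<lambda>_. 0) \<or> (\<exists>i<length Ts. bs ! i = (\<lambda>_. 0))" using i(1) by blast
      qed
      show ?thesis unfolding tot
      proof (rule check_to_Com_eq[OF ne])
        fix x assume "x \<in> ?R"
        then have "x \<in> coh_class (as_check S) (as_diff S) top (\<lambda>_. 0)" unfolding RI tot using z by auto
        then show "com_value S x = (\<lambda>_. 0)"
          using check_class_iff[OF oS submodules_zero[OF submodules_check]] com_value_zero[OF oS] by simp
      qed
    qed (simp add: check_to_Com_def)
    show ?thesis unfolding rhs lhs ..
  qed
qed

end

theorem proposition4p10: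
  fixes \<Psi> :: "nat set \<Rightarrow> nat \<Rightarrow> (nat list \<Rightarrow> nat list \<Rightarrow> 'k::comm_ring_1)
                \<Rightarrow> (nat set list list \<Rightarrow> 'k) set"
  assumes iso: "operad_iso (desusp As) h_operad \<Psi>"
    and product: "\<Psi> {1, 2} 1 product_elt = product_class"
  shows "\<exists>\<theta>. left_module_iso (desusp As)
           (restrict_module \<Psi> h_check_module)
           (restrict_module (desusp_map As_to_Com) (regular_module (desusp Com))) \<theta>"
proof -
  interpret as_operad_iso \<Psi> by unfold_locales (fact iso, fact product)
  have "left_module_iso (desusp As) (restrict_module \<Psi> h_check_module)
      (restrict_module (desusp_map As_to_Com) (regular_module (desusp Com))) check_to_Com"
    unfolding left_module_iso_def
  proof (intro conjI allI impI ballI)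
    fix S Ts p qs and a :: "nat list \<Rightarrow> nat list \<Rightarrow> 'k" and ms
    assume "finite S \<and> S \<noteq> {} \<and> Ts \<in> as_part S \<and> length qs = length Ts"
      and "a \<in> piece (desusp As) (blocks Ts) p" "ms \<in> listset (map2 (piece (restrict_module \<Psi> h_check_module)) Ts qs)"
    then show "check_to_Com S (p + sum_list qs) (act (restrict_module \<Psi> h_check_module) Ts p qs a ms)
        = act (restrict_module (desusp_map As_to_Com) (regular_module (desusp Com))) Ts p qs a (apply_blocks check_to_Com Ts qs ms)"
      unfolding check_module_simps Com_module_simps
      by (intro check_to_Com_act) (auto simp: ordered_partitions_def)
  qed (rule check_to_Com_species_iso)
  then show ?thesis by blast
qed

end
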